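(* Every $\bar w\in Sys(Fin)$ is solvable in every algebraic group over an algebraically closed field.
   Context: An algebraic group over an algebraically closed field $K$ is identified with its group of $K$-points, regarded as an abstract group. A finite system of equations is a finite tuple $\bar w=(w_1,\dots,w_n)$ of elements of the free group on symbols $\bar a=(a_1,\dots,a_r)$ (constants) and $\bar x=(x_1,\dots,x_k)$ (variables). It is solvable in a group $G$ if for all $\bar a\in G^r$ there is $\bar x\in G^k$ with $w_i(\bar a,\bar x)=1$ for all $i$. $Sys(Fin)$ is the set of all finite systems that are solvable in every finite group. *)

theory Defs
  imports "HOL-Algebra.Group" "HOL-Computational_Algebra.Polynomial"
begin

section \<open>Systems of equations over groups\<close>

datatype symbol = Const nat | Var nat

text \<open>
  The letter (s, True) stands for the symbol s and (s, False) for its inverse.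
\<close>

type_synonym word = "(symbol \<times> bool) list"

definition symbols :: "nat \<Rightarrow> nat \<Rightarrow> symbol set" where
  "symbols r k = Const ` {..<r} \<union> Var ` {..<k}"

text \<open>
  The elements of the free group on a set of symbols are represented by their unique
  normal forms, the freely reduced words.
\<close>

definition reduced :: "word \<Rightarrow> bool" where
  "reduced = successively (\<lambda>l l'. \<not> (fst l = fst l' \<and> snd l \<noteq> snd l'))"

definition free_group_elements :: "symbol set \<Rightarrow> word set" where
  "free_group_elements S = {w. fst ` set w \<subseteq> S \<and> reduced w}"

text \<open>
  A finite system (r, k, ws) is a tuple ws of elements of the free group on r constants
  and k variables.
\<close>

type_synonym system = "nat \<times> nat \<times> word list"

definition finite_systems :: "system set" where
  "finite_systems = {(r, k, ws). set ws \<subseteq> free_group_elements (symbols r k)}"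

fun symbol_value :: "(nat \<Rightarrow> 'g) \<Rightarrow> (nat \<Rightarrow> 'g) \<Rightarrow> symbol \<Rightarrow> 'g" where
  "symbol_value a x (Const i) = a i"
| "symbol_value a x (Var j) = x j"

fun word_value :: "('g, 'b) monoid_scheme \<Rightarrow> (nat \<Rightarrow> 'g) \<Rightarrow> (nat \<Rightarrow> 'g) \<Rightarrow> word \<Rightarrow> 'g" where
  "word_value G a x [] = \<one>\<^bsub>G\<^esub>"
| "word_value G a x ((s, e) # w) =
    (if e then symbol_value a x s else inv\<^bsub>G\<^esub> (symbol_value a x s)) \<otimes>\<^bsub>G\<^esub> word_value G a x w"

definition solvable_in :: "system \<Rightarrow> ('g, 'b) monoid_scheme \<Rightarrow> bool" where
  "solvable_in = (\<lambda>(r, k, ws) G.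
    \<forall>a \<in> {..<r} \<rightarrow> carrier G. \<exists>x \<in> {..<k} \<rightarrow> carrier G.
      \<forall>w \<in> set ws. word_value G a x w = \<one>\<^bsub>G\<^esub>)"

text \<open>
  A definition cannot quantify over types, so the finite groups are taken with carrier in
  the natural numbers, which covers every isomorphism class. The lemma
  \<open>Sys_Fin_solvable_in_finite\<close> below recovers finite groups on arbitrary types.
\<close>

definition Sys_Fin :: "system set" where
  "Sys_Fin = {W \<in> finite_systems.
    \<forall>G :: nat monoid. group G \<and> finite (carrier G) \<longrightarrow> solvable_in W G}"

lemma word_value_closed:
  assumes "group G" "fst ` set w \<subseteq> S" "\<And>s. s \<in> S \<Longrightarrow> symbol_value a x s \<in> carrier G"
  shows "word_value G a x w \<in> carrier G"
proof -
  interpret group G by fact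
  show ?thesis using assms(2,3) by (induction w) auto
qed

lemma word_value_hom:
  assumes G: "group G" and H: "group H" and h: "h \<in> hom G H"
    and "fst ` set w \<subseteq> S" "\<And>s. s \<in> S \<Longrightarrow> symbol_value a x s \<in> carrier G"
    and "\<And>s. s \<in> S \<Longrightarrow> symbol_value a' x' s = h (symbol_value a x s)"
  shows "word_value H a' x' w = h (word_value G a x w)"
proof -
  interpret group_hom G H h
    using G H h by (simp add: group_hom_def group_hom_axioms_def)
  show ?thesis using assms(4,5,6)
  proof (induction w)
    case (Cons l w)
    obtain s e where l: "l = (s, e)" by force
    have "word_value G a x w \<in> carrier G"
      using word_value_closed[OF G, of w S a x] Cons.prems by auto
    then show ?case using Cons l by auto
  qed auto
qed

lemma Sys_Fin_solvable_in_finite: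
  fixes G :: "'g monoid"
  assumes W: "W \<in> Sys_Fin" and G: "group G" and fin: "finite (carrier G)"
  shows "solvable_in W G"
proof -
  obtain r k ws where W': "W = (r, k, ws)" by (cases W) auto
  interpret G: group G by fact
  obtain f where f: "bij_betw f (carrier G) {0..<card (carrier G)}"
    using ex_bij_betw_finite_nat[OF fin] by blast
  define g where "g = inv_into (carrier G) f"
  define H :: "nat monoid" where
    "H = \<lparr>carrier = f ` carrier G, monoid.mult = (\<lambda>u v. f (g u \<otimes>\<^bsub>G\<^esub> g v)), one = f \<one>\<^bsub>G\<^esub>\<rparr>"
  have inj: "inj_on f (carrier G)" using f by (simp add: bij_betw_def)
  have gf: "g (f u) = u" if "u \<in> carrier G" for u
    using inj that by (simp add: g_def)
  have H: "group H"
  proof (rule groupI)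
    fix u assume "u \<in> carrier H"
    then obtain v where v: "v \<in> carrier G" "u = f v" by (auto simp: H_def)
    then show "\<exists>y\<in>carrier H. y \<otimes>\<^bsub>H\<^esub> u = \<one>\<^bsub>H\<^esub>"
      by (intro bexI[of _ "f (inv\<^bsub>G\<^esub> v)"]) (auto simp: H_def gf)
  qed (auto simp: H_def gf G.m_assoc)
  have hf: "f \<in> hom G H" by (auto simp: hom_def H_def gf)
  have hg: "g \<in> hom H G" by (auto simp: hom_def H_def gf)
  have sol: "solvable_in W H"
    using W H fin by (auto simp: Sys_Fin_def H_def)
  have ws: "fst ` set w \<subseteq> symbols r k" if "w \<in> set ws" for w
    using W that by (auto simp: Sys_Fin_def finite_systems_def free_group_elements_def W')
  show ?thesis
    unfolding solvable_in_def W' prod.case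
  proof
    fix a assume a: "a \<in> {..<r} \<rightarrow> carrier G"
    then have "f \<circ> a \<in> {..<r} \<rightarrow> carrier H" by (auto simp: H_def)
    then obtain x where x: "x \<in> {..<k} \<rightarrow> carrier H"
      and eq: "\<And>w. w \<in> set ws \<Longrightarrow> word_value H (f \<circ> a) x w = \<one>\<^bsub>H\<^esub>"
      using sol unfolding solvable_in_def W' prod.case by blast
    have "word_value G a (g \<circ> x) w = \<one>\<^bsub>G\<^esub>" if w: "w \<in> set ws" for w
    proof -
      have "word_value G a (g \<circ> x) w = g (word_value H (f \<circ> a) x w)"
      proof (rule word_value_hom[OF H G hg ws[OF w]])
        fix s assume "s \<in> symbols r k"
        then show "symbol_value (f \<circ> a) x s \<in> carrier H"
          using a x by (auto simp: symbols_def H_def Pi_iff)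
        show "symbol_value a (g \<circ> x) s = g (symbol_value (f \<circ> a) x s)"
          using \<open>s \<in> symbols r k\<close> a by (auto simp: symbols_def gf Pi_iff)
      qed
      also have "\<dots> = \<one>\<^bsub>G\<^esub>" using eq[OF w] gf by (simp add: H_def)
      finally show ?thesis .
    qed
    moreover have "g \<circ> x \<in> {..<k} \<rightarrow> carrier G"
      using x hg by (auto simp: hom_def Pi_iff)
    ultimately show "\<exists>x\<in>{..<k} \<rightarrow> carrier G. \<forall>w\<in>set ws. word_value G a x w = \<one>\<^bsub>G\<^esub>"
      by blast
  qed
qed


section \<open>Affine algebraic sets and regular functions\<close>

text \<open>
  A point of affine n-space over \<open>'k\<close> is a list of length n. Polynomial functions on it
  form the \<open>'k\<close>-algebra generated by the constants and the coordinate functions.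
\<close>

inductive_set poly_funs :: "nat \<Rightarrow> ('k::comm_ring_1 list \<Rightarrow> 'k) set" for n :: nat where
  const: "(\<lambda>v. c) \<in> poly_funs n"
| coord: "i < n \<Longrightarrow> (\<lambda>v. v ! i) \<in> poly_funs n"
| add: "p \<in> poly_funs n \<Longrightarrow> q \<in> poly_funs n \<Longrightarrow> (\<lambda>v. p v + q v) \<in> poly_funs n"
| mult: "p \<in> poly_funs n \<Longrightarrow> q \<in> poly_funs n \<Longrightarrow> (\<lambda>v. p v * q v) \<in> poly_funs n"

definition zariski_closed :: "nat \<Rightarrow> 'k::field list set \<Rightarrow> bool" where
  "zariski_closed n Z \<longleftrightarrow>
    (\<exists>P \<subseteq> poly_funs n. Z = {v. length v = n \<and> (\<forall>p \<in> P. p v = 0)})"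

definition zariski_open_in :: "nat \<Rightarrow> 'k::field list set \<Rightarrow> 'k list set \<Rightarrow> bool" where
  "zariski_open_in n V U \<longleftrightarrow> (\<exists>Z. zariski_closed n Z \<and> U = V - Z)"

text \<open>
  Regularity on a subset S of affine n-space: locally, in the Zariski topology induced on
  S, a quotient of two polynomials with nowhere vanishing denominator.
\<close>

definition regular_on :: "nat \<Rightarrow> 'k::field list set \<Rightarrow> ('k list \<Rightarrow> 'k) \<Rightarrow> bool" where
  "regular_on n S f \<longleftrightarrow>
    (\<forall>v \<in> S. \<exists>U p q. zariski_open_in n S U \<and> v \<in> U \<and> p \<in> poly_funs n \<and> q \<in> poly_funs n \<and>
      (\<forall>u \<in> U. q u \<noteq> 0 \<and> f u = p u / q u))"



section \<open>Varieties\<close>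

text \<open>
  Varieties in the sense of Weil and Serre: a set of points covered by finitely many charts,
  each a bijection from a patch onto a closed subset of an affine space, glued along open
  subsets by regular maps. They need not be affine, irreducible or connected. The values of
  the coordinate map outside the patch are irrelevant.
\<close>

record ('p, 'k) chart =
  patch :: "'p set"
  dim :: nat
  coords :: "'p \<Rightarrow> 'k list"

definition affine_chart :: "('p, 'k::field) chart \<Rightarrow> bool" where
  "affine_chart c \<longleftrightarrow>
    inj_on (coords c) (patch c) \<and> zariski_closed (dim c) (coords c ` patch c)"

text \<open>
  The map f, read in the charts c and d, is defined on an open set and regular there.
\<close>

definition regular_in_charts ::
  "('p, 'k::field) chart \<Rightarrow> ('q, 'k) chart \<Rightarrow> ('p \<Rightarrow> 'q) \<Rightarrow> bool" where
  "regular_in_charts c d f \<longleftrightarrow>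
    (let S = coords c ` {x \<in> patch c. f x \<in> patch d} in
      zariski_open_in (dim c) (coords c ` patch c) S \<and>
      (\<forall>i < dim d. regular_on (dim c) S
        (\<lambda>v. coords d (f (inv_into (patch c) (coords c) v)) ! i)))"

definition prevariety :: "'p set \<Rightarrow> ('p, 'k::field) chart set \<Rightarrow> bool" where
  "prevariety X A \<longleftrightarrow>
    finite A \<and> X = (\<Union>c \<in> A. patch c) \<and> (\<forall>c \<in> A. affine_chart c) \<and>
    (\<forall>c \<in> A. \<forall>d \<in> A. regular_in_charts c d (\<lambda>x. x))"

definition closed_subvariety :: "('p, 'k::field) chart set \<Rightarrow> 'p set \<Rightarrow> bool" where
  "closed_subvariety A Y \<longleftrightarrow>
    Y \<subseteq> (\<Union>c \<in> A. patch c) \<and>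
    (\<forall>c \<in> A. zariski_closed (dim c) (coords c ` (Y \<inter> patch c)))"

definition prod_chart ::
  "('p, 'k) chart \<Rightarrow> ('q, 'k) chart \<Rightarrow> ('p \<times> 'q, 'k) chart" where
  "prod_chart c d =
    \<lparr>patch = patch c \<times> patch d, dim = dim c + dim d,
     coords = (\<lambda>(x, y). coords c x @ coords d y)\<rparr>"

definition prod_atlas ::
  "('p, 'k) chart set \<Rightarrow> ('q, 'k) chart set \<Rightarrow> ('p \<times> 'q, 'k) chart set" where
  "prod_atlas A B = (\<lambda>(c, d). prod_chart c d) ` (A \<times> B)"

text \<open>The last condition is separatedness: the diagonal is closed.\<close>

definition variety :: "'p set \<Rightarrow> ('p, 'k::field) chart set \<Rightarrow> bool" where
  "variety X A \<longleftrightarrow>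
    prevariety X A \<and> closed_subvariety (prod_atlas A A) ((\<lambda>x. (x, x)) ` X)"

definition morphism ::
  "'p set \<Rightarrow> ('p, 'k::field) chart set \<Rightarrow> 'q set \<Rightarrow> ('q, 'k) chart set \<Rightarrow> ('p \<Rightarrow> 'q) \<Rightarrow> bool" where
  "morphism X A Y B f \<longleftrightarrow>
    f \<in> X \<rightarrow> Y \<and> (\<forall>c \<in> A. \<forall>d \<in> B. regular_in_charts c d f)"


section \<open>Algebraic groups\<close>

definition algebraic_group :: "('g, 'k::field) chart set \<Rightarrow> ('g, 'b) monoid_scheme \<Rightarrow> bool" where
  "algebraic_group A G \<longleftrightarrow>
    group G \<and> variety (carrier G) A \<and>
    morphism (carrier G \<times> carrier G) (prod_atlas A A) (carrier G) A (\<lambda>(x, y). x \<otimes>\<^bsub>G\<^esub> y) \<and>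
    morphism (carrier G) A (carrier G) A (\<lambda>x. inv\<^bsub>G\<^esub> x)"

end

theory Submission
  imports Defs "HOL-Computational_Algebra.Fundamental_Theorem_Algebra"
    "HOL-Library.Function_Algebras" "HOL-Library.Sublist" "HOL-Library.Countable"
begin

text \<open>
  Noetherianity makes the group law piecewise rational, so the points of G can be coded by the vectors
  satisfying a quantifier-free formula, with every coordinate of a product given, on each of finitely
  many definable pieces, by a quotient of polynomials. That this is a group in which the system has no
  solution for the given constants is then a universal sentence over K whose parameters are the
  coefficients involved. Quantifier elimination, uniform in the field, turns its satisfiability by some
  parameters into a statement about the characteristic alone, hence makes it true for some parameters
  in an algebraic closure of a prime field. This closure is taken as the ring of algebraic integers
  modulo a maximal ideal, in which finitely many elements always lie in a finite subfield. A universal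
  sentence passes to that subfield, and since products are given by quotients, the points over it form
  a finite group, in which the system has no solution either.
\<close>

section \<open>Quantifier-free formulas\<close>

text \<open>The obstacle is that only universal sentences pass to a subring, while a group law
  asserts existence. Products are therefore asserted through the nonvanishing of a denominator, and
  inverses are replaced by right cancellation, which yields inverses once the model is finite. A
  solution of the system is an assignment, so its absence is universal as well. Constants of K may
  be transcendental; quantifying them existentially leaves an exists-forall sentence without
  parameters.

  Truth is defined relative to a subset M of a ring, with membership in M in place of equality to 0.
  One elimination procedure then serves both K, with M = {0}, and the algebraic integers modulo a
  maximal ideal, without forming a quotient. Monic polynomials have roots among the algebraic
  integers, so the residue field is algebraically closed, and p generates a proper ideal because 1/p
  is not integral. Finiteness comes from subrings with finitely generated additive group, which have
  finitely many classes modulo p; nonzero residues are invertible there because a finite integral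
  domain is a field.\<close>

datatype 'x trm = Vr 'x | Cst int | Plus "'x trm" "'x trm" | Times "'x trm" "'x trm"

datatype 'x form = Zero "'x trm" | Neg "'x form" | Conj "'x form" "'x form"

primrec tval :: "('x \<Rightarrow> 'r::comm_ring_1) \<Rightarrow> 'x trm \<Rightarrow> 'r" where
  "tval e (Vr x) = e x"
| "tval e (Cst c) = of_int c"
| "tval e (Plus s t) = tval e s + tval e t"
| "tval e (Times s t) = tval e s * tval e t"

text \<open>For M = {0} this is truth in the ring itself. For a maximal ideal M it is truth in the
  residue field, with ring elements standing for their residue classes.\<close>

primrec holds :: "'r::comm_ring_1 set \<Rightarrow> ('x \<Rightarrow> 'r) \<Rightarrow> 'x form \<Rightarrow> bool" where
  "holds M e (Zero t) \<longleftrightarrow> tval e t \<in> M"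
| "holds M e (Neg f) \<longleftrightarrow> \<not> holds M e f"
| "holds M e (Conj f g) \<longleftrightarrow> holds M e f \<and> holds M e g"

lemma tval_cong: "(\<And>x. x \<in> set_trm t \<Longrightarrow> e x = e' x) \<Longrightarrow> tval e t = tval e' t"
  by (induction t) auto

lemma holds_cong: "(\<And>x. x \<in> set_form f \<Longrightarrow> e x = e' x) \<Longrightarrow> holds M e f = holds M e' f"
proof (induction f)
  case (Zero t)
  then have "tval e t = tval e' t" by (intro tval_cong) auto
  then show ?case by simp
qed auto

lemma tval_map: "tval e (map_trm f t) = tval (e \<circ> f) t"
  by (induction t) auto

lemma holds_map: "holds M e (map_form f g) = holds M (e \<circ> f) g"
proof (induction g)
  case (Zero t)
  then show ?case by (simp only: form.map holds.simps tval_map)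
qed auto

abbreviation Disj :: "'x form \<Rightarrow> 'x form \<Rightarrow> 'x form" where
  "Disj f g \<equiv> Neg (Conj (Neg f) (Neg g))"

text \<open>False only for a set M that omits 1; this is the origin of the recurring assumption
  \<open>1 \<notin> M\<close>.\<close>

abbreviation Falsum :: "'x form" where
  "Falsum \<equiv> Zero (Cst 1)"

definition Disjs :: "'x form list \<Rightarrow> 'x form" where
  "Disjs fs = foldr Disj fs Falsum"

definition Conjs :: "'x form list \<Rightarrow> 'x form" where
  "Conjs fs = foldr Conj fs (Neg Falsum)"

lemma set_Disjs [simp]: "set_form (Disjs fs) = (\<Union>f\<in>set fs. set_form f)"
  by (induction fs) (auto simp: Disjs_def)

lemma set_Conjs [simp]: "set_form (Conjs fs) = (\<Union>f\<in>set fs. set_form f)"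
  by (induction fs) (auto simp: Conjs_def)

lemma holds_Disjs [simp]: "1 \<notin> M \<Longrightarrow> holds M e (Disjs fs) \<longleftrightarrow> (\<exists>f\<in>set fs. holds M e f)"
  by (induction fs) (auto simp: Disjs_def)

lemma holds_Conjs [simp]: "1 \<notin> M \<Longrightarrow> holds M e (Conjs fs) \<longleftrightarrow> (\<forall>f\<in>set fs. holds M e f)"
  by (induction fs) (auto simp: Conjs_def)

section \<open>Terms as polynomials in one variable\<close>

fun padd :: "'x trm list \<Rightarrow> 'x trm list \<Rightarrow> 'x trm list" where
  "padd [] q = q"
| "padd p [] = p"
| "padd (a # p) (b # q) = Plus a b # padd p q"

fun pmul :: "'x trm list \<Rightarrow> 'x trm list \<Rightarrow> 'x trm list" where
  "pmul [] q = []"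
| "pmul (a # p) q = padd (map (Times a) q) (Cst 0 # pmul p q)"

fun ppow :: "'x trm list \<Rightarrow> nat \<Rightarrow> 'x trm list" where
  "ppow p 0 = [Cst 1]"
| "ppow p (Suc n) = pmul p (ppow p n)"

definition tpoly :: "('x \<Rightarrow> 'r::comm_ring_1) \<Rightarrow> 'x trm list \<Rightarrow> 'r poly" where
  "tpoly e p = Poly (map (tval e) p)"

lemma tpoly_Nil [simp]: "tpoly e [] = 0"
  and tpoly_Cons [simp]: "tpoly e (a # p) = pCons (tval e a) (tpoly e p)"
  by (simp_all add: tpoly_def)

lemma tpoly_padd [simp]: "tpoly e (padd p q) = tpoly e p + tpoly e q"
  by (induction p q rule: padd.induct) auto

lemma tpoly_map_Times [simp]: "tpoly e (map (Times a) p) = smult (tval e a) (tpoly e p)"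
  by (induction p) auto

lemma tpoly_pmul [simp]: "tpoly e (pmul p q) = tpoly e p * tpoly e q"
  by (induction p) auto

lemma tpoly_ppow [simp]: "tpoly e (ppow p n) = tpoly e p ^ n"
  by (induction n) auto

definition tvars :: "'x trm list \<Rightarrow> 'x set" where
  "tvars p = (\<Union>t\<in>set p. set_trm t)"

lemma tvars_Nil [simp]: "tvars [] = {}"
  and tvars_Cons [simp]: "tvars (t # p) = set_trm t \<union> tvars p"
  and tvars_append [simp]: "tvars (p @ q) = tvars p \<union> tvars q"
  and tvars_rev [simp]: "tvars (rev p) = tvars p"
  by (auto simp: tvars_def)

lemma tvars_padd: "tvars (padd p q) \<subseteq> tvars p \<union> tvars q"
  by (induction p q rule: padd.induct) auto

lemma tvars_pmul: "tvars (pmul p q) \<subseteq> tvars p \<union> tvars q"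
proof (induction p)
  case (Cons a p)
  have "tvars (map (Times a) q) \<subseteq> set_trm a \<union> tvars q" by (auto simp: tvars_def)
  with Cons tvars_padd[of "map (Times a) q" "Cst 0 # pmul p q"] show ?case by auto
qed simp

lemma tvars_ppow: "tvars (ppow p n) \<subseteq> tvars p"
proof (induction n)
  case (Suc n)
  with tvars_pmul[of p "ppow p n"] show ?case by auto
qed simp

text \<open>The term as a polynomial in x, lowest coefficient first. The last coefficient is itself
  a term that may vanish under some assignments, which is why elimination has to split into
  cases.\<close>

primrec tcoeffs :: "'x \<Rightarrow> 'x trm \<Rightarrow> 'x trm list" where
  "tcoeffs x (Vr y) = (if y = x then [Cst 0, Cst 1] else [Vr y])"
| "tcoeffs x (Cst c) = [Cst c]"
| "tcoeffs x (Plus s t) = padd (tcoeffs x s) (tcoeffs x t)"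
| "tcoeffs x (Times s t) = pmul (tcoeffs x s) (tcoeffs x t)"

lemma poly_tcoeffs: "poly (tpoly e (tcoeffs x t)) a = tval (e(x := a)) t"
  by (induction t) auto

lemma tvars_tcoeffs: "tvars (tcoeffs x t) \<subseteq> set_trm t - {x}"
proof (induction t)
  case (Plus s t)
  with tvars_padd[of "tcoeffs x s" "tcoeffs x t"] show ?case by auto
next
  case (Times s t)
  with tvars_pmul[of "tcoeffs x s" "tcoeffs x t"] show ?case by auto
qed auto

section \<open>Pseudo-division and the elimination of one variable\<close>

text \<open>For the division algorithm coefficients are listed from the highest downwards.\<close>

primrec hpoly :: "('x \<Rightarrow> 'r::comm_ring_1) \<Rightarrow> 'x trm list \<Rightarrow> 'r poly" where
  "hpoly e [] = 0"
| "hpoly e (c # p) = monom (tval e c) (length p) + hpoly e p"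

lemma hpoly_append: "hpoly e (p @ q) = monom 1 (length q) * hpoly e p + hpoly e q"
  by (induction p) (auto simp: algebra_simps mult_monom)

lemma hpoly_rev: "hpoly e (rev p) = tpoly e p"
  by (induction p) (auto simp: hpoly_append monom_0 monom_Suc algebra_simps)

lemma coeff_hpoly_ge: "i \<ge> length p \<Longrightarrow> coeff (hpoly e p) i = 0"
  by (induction p) auto

lemma coeff_hpoly: "i < length p \<Longrightarrow> coeff (hpoly e p) i = tval e (rev p ! i)"
proof (induction p)
  case (Cons c p)
  then show ?case
    by (cases "i = length p") (auto simp: nth_append coeff_hpoly_ge)
qed simp

text \<open>One step of pseudo-division of \<open>d # s\<close> by \<open>c # p\<close>: c times the
  former minus d times a shift of the latter. The leading terms cancel and are omitted; the zeros
  appended to p realise the shift.\<close>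

definition red :: "'x trm \<Rightarrow> 'x trm list \<Rightarrow> 'x trm \<Rightarrow> 'x trm list \<Rightarrow> 'x trm list" where
  "red c p d s = map2 (\<lambda>a b. Plus (Times c a) (Times (Times (Cst (-1)) d) b)) s
     (p @ replicate (length s - length p) (Cst 0))"

lemma length_red [simp]: "length p \<le> length s \<Longrightarrow> length (red c p d s) = length s"
  by (simp add: red_def)

lemma tvars_red: "tvars (red c p d s) \<subseteq> set_trm c \<union> set_trm d \<union> tvars p \<union> tvars s"
proof
  fix x assume "x \<in> tvars (red c p d s)"
  then obtain a b where ab: "(a, b) \<in> set (zip s (p @ replicate (length s - length p) (Cst 0)))"
    and x: "x \<in> set_trm c \<union> set_trm a \<union> set_trm d \<union> set_trm b"
    by (auto simp: red_def tvars_def)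
  from ab have "a \<in> set s" "b \<in> set p \<or> b = Cst 0"
    by (auto dest: set_zip_leftD set_zip_rightD)
  with x show "x \<in> set_trm c \<union> set_trm d \<union> tvars p \<union> tvars s" by (auto simp: tvars_def)
qed

lemma hpoly_map2:
  "length s = length p \<Longrightarrow>
   hpoly e (map2 (\<lambda>a b. Plus (Times c a) (Times (Times (Cst (-1)) d) b)) s p) =
   smult (tval e c) (hpoly e s) - smult (tval e d) (hpoly e p)"
  by (induction s p rule: list_induct2)
     (auto simp: algebra_simps smult_monom smult_add_right add_monom diff_monom simp flip: add_monom diff_monom)

lemma hpoly_replicate_0 [simp]: "hpoly e (replicate n (Cst 0)) = 0"
  by (induction n) auto

lemma hpoly_red:
  assumes "length p \<le> length s"
  shows "hpoly e (red c p d s) =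
    smult (tval e c) (hpoly e (d # s)) - monom (tval e d) (length s - length p) * hpoly e (c # p)"
proof -
  have "hpoly e (red c p d s) = smult (tval e c) (hpoly e s)
      - smult (tval e d) (monom 1 (length s - length p) * hpoly e p)"
    unfolding red_def using assms by (subst hpoly_map2) (auto simp: hpoly_append)
  moreover have "smult (tval e d) (monom 1 (length s - length p) * hpoly e p)
      = monom (tval e d) (length s - length p) * hpoly e p"
    by (metis mult.right_neutral mult_smult_left smult_monom)
  ultimately show ?thesis using assms
    by (simp add: algebra_simps mult_monom smult_monom smult_add_right)
qed

function prem :: "'x trm \<Rightarrow> 'x trm list \<Rightarrow> 'x trm list \<Rightarrow> 'x trm list" where
  "prem c p [] = []"
| "prem c p (d # s) = (if length s < length p then d # s else prem c p (red c p d s))"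
  by pat_completeness auto
termination by (relation "measure (\<lambda>(c, p, s). length s)") (auto simp: red_def)

lemma length_prem: "length (prem c p s) \<le> length p"
  by (induction c p s rule: prem.induct) auto

lemma tvars_prem: "tvars (prem c p s) \<subseteq> set_trm c \<union> tvars p \<union> tvars s"
proof (induction c p s rule: prem.induct)
  case (2 c p d s)
  with tvars_red[of c p d s] show ?case by auto
qed auto

text \<open>Multiplying by c before each subtraction avoids division, so the identity holds in every
  commutative ring and for every value of c, at the price of one factor c per step.\<close>

lemma prem_correct:
  "\<exists>j h. smult (tval e c ^ j) (hpoly e s) = hpoly e (c # p) * h + hpoly e (prem c p s)"
proof (induction c p s rule: prem.induct)
  case (1 c p)
  show ?case by (rule exI[of _ 0], rule exI[of _ 0]) simp
next
  case (2 c p d s)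
  show ?case
  proof (cases "length s < length p")
    case True
    then show ?thesis by (intro exI[of _ 0]) simp
  next
    case False
    then obtain j h where jh: "smult (tval e c ^ j) (hpoly e (red c p d s)) =
        hpoly e (c # p) * h + hpoly e (prem c p (red c p d s))" using 2 by blast
    define m where "m = monom (tval e d) (length s - length p)"
    have "hpoly e (red c p d s) = smult (tval e c) (hpoly e (d # s)) - m * hpoly e (c # p)"
      using False by (simp only: hpoly_red not_less m_def)
    then have "smult (tval e c) (hpoly e (d # s)) = hpoly e (red c p d s) + m * hpoly e (c # p)"
      by (simp add: algebra_simps del: hpoly.simps)
    then have "smult (tval e c ^ Suc j) (hpoly e (d # s)) =
        smult (tval e c ^ j) (hpoly e (red c p d s)) + smult (tval e c ^ j) (m * hpoly e (c # p))"
      by (metis power_Suc2 smult_smult smult_add_right)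
    then have "smult (tval e c ^ Suc j) (hpoly e (d # s)) =
        hpoly e (c # p) * (h + smult (tval e c ^ j) m) + hpoly e (prem c p (d # s))"
      using jh False by (simp add: algebra_simps del: hpoly.simps)
    then show ?thesis by blast
  qed
qed

text \<open>Over an algebraically closed field, all roots of a polynomial f of degree n are roots of
  q exactly when f divides \<open>q ^ n\<close>, since no root of f has multiplicity above n. The
  formula denies this divisibility by means of the pseudo-remainder; \<open>length p\<close> is n
  because c heads the list.\<close>

fun elim_last :: "'x trm \<Rightarrow> 'x trm list \<Rightarrow> 'x trm list \<Rightarrow> 'x form" where
  "elim_last c p q = Disjs (map (\<lambda>r. Neg (Zero r)) (prem c p (rev (ppow q (length p)))))"

text \<open>
  The polynomials in the first argument list the highest coefficient first, and the
  polynomial q the lowest one.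
\<close>

function elim_system :: "'x trm list list \<Rightarrow> 'x trm list \<Rightarrow> 'x form" where
  "elim_system [] q = Disjs (map (\<lambda>r. Neg (Zero r)) q)"
| "elim_system ([] # ps) q = elim_system ps q"
| "elim_system [c # p] q =
     Disj (Conj (Zero c) (elim_system [p] q)) (Conj (Neg (Zero c)) (elim_last c p q))"
| "elim_system ((c # p) # [] # ps) q = elim_system ((c # p) # ps) q"
| "elim_system ((c # p) # (d # s) # ps) q =
     (if length p \<le> length s
      then Disj (Conj (Zero c) (elim_system (p # (d # s) # ps) q))
                (Conj (Neg (Zero c)) (elim_system ((c # p) # red c p d s # ps) q))
      else Disj (Conj (Zero d) (elim_system ((c # p) # s # ps) q))
                (Conj (Neg (Zero d)) (elim_system (red d s c p # (d # s) # ps) q)))"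
  by pat_completeness auto
termination
  \<comment> \<open>Calls either drop a leading coefficient or replace a polynomial by a reduction
    that is one coefficient shorter; the second summand pays for discarding an empty
    polynomial.\<close>
  by (relation "measure (\<lambda>(ps, q). sum_list (map length ps) + length ps)") auto

lemma set_elim_system: "set_form (elim_system ps q) \<subseteq> (\<Union>p\<in>set ps. tvars p) \<union> tvars q"
proof (induction ps q rule: elim_system.induct)
  case (1 q)
  then show ?case by (auto simp: tvars_def)
next
  case (3 c p q)
  have "set_form (elim_last c p q) \<subseteq> set_trm c \<union> tvars p \<union> tvars q"
    using tvars_prem[of c p "rev (ppow q (length p))"] tvars_ppow[of q "length p"]
    by (auto simp: tvars_def)
  with 3 show ?case by auto
next
  case (5 c p d s ps q)
  show ?case
  proof (cases "length p \<le> length s")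
    case True
    then show ?thesis using 5(1,2)[OF True] tvars_red[of c p d s]
      by (simp del: Un_subset_iff) blast
  next
    case False
    then show ?thesis using 5(3,4)[OF False] tvars_red[of d s c p]
      by (simp del: Un_subset_iff) blast
  qed
qed auto

text \<open>The flag is the desired truth value, so a negation merely flips it. A pair
  \<open>(ps, q)\<close> stands for the vanishing of all of ps and the nonvanishing of q; a single q
  suffices because over a field several inequations combine into one for their product.\<close>

fun dnf :: "bool \<Rightarrow> 'x form \<Rightarrow> ('x trm list \<times> 'x trm) list" where
  "dnf True (Zero t) = [([t], Cst 1)]"
| "dnf False (Zero t) = [([], t)]"
| "dnf b (Neg f) = dnf (\<not> b) f"
| "dnf True (Conj f g) =
     map (\<lambda>((p, q), (p', q')). (p @ p', Times q q')) (List.product (dnf True f) (dnf True g))"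
| "dnf False (Conj f g) = dnf False f @ dnf False g"

lemma set_dnf: "(ps, q) \<in> set (dnf b f) \<Longrightarrow> tvars (q # ps) \<subseteq> set_form f"
  by (induction b f arbitrary: ps q rule: dnf.induct) fastforce+

definition elim :: "'x \<Rightarrow> 'x form \<Rightarrow> 'x form" where
  "elim x f = Disjs (map (\<lambda>(ps, q).
     elim_system (map (rev \<circ> tcoeffs x) ps) (tcoeffs x q)) (dnf True f))"

lemma set_elim: "set_form (elim x f) \<subseteq> set_form f - {x}"
proof -
  have "set_form (elim_system (map (rev \<circ> tcoeffs x) ps) (tcoeffs x q)) \<subseteq> set_form f - {x}"
    if "(ps, q) \<in> set (dnf True f)" for ps q
  proof -
    have "tvars (tcoeffs x t) \<subseteq> set_form f - {x}" if "t \<in> insert q (set ps)" for t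
      using set_dnf[OF \<open>(ps, q) \<in> _\<close>] that tvars_tcoeffs[of x t] by (auto simp: tvars_def)
    then show ?thesis using set_elim_system[of "map (rev \<circ> tcoeffs x) ps" "tcoeffs x q"]
      by fastforce
  qed
  then show ?thesis by (fastforce simp: elim_def)
qed

section \<open>Quantifier elimination modulo a maximal ideal\<close>

text \<open>M is a maximal ideal, with maximality expressed by inverses modulo M. Roots are required
  only of monic polynomials, but in the ring itself, as integral closure provides them. This makes
  the residue field algebraically closed: a leading coefficient outside M can be normalised modulo
  M.\<close>

locale residually_closed =
  fixes M :: "'r::comm_ring_1 set"
  assumes zero_mem: "0 \<in> M"
    and add_mem: "\<And>a b. a \<in> M \<Longrightarrow> b \<in> M \<Longrightarrow> a + b \<in> M"
    and mult_mem: "\<And>a b. b \<in> M \<Longrightarrow> a * b \<in> M"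
    and one_notin: "1 \<notin> M"
    and ex_inverse: "\<And>a. a \<notin> M \<Longrightarrow> \<exists>b. a * b - 1 \<in> M"
    and ex_root: "\<And>p :: 'r poly. lead_coeff p = 1 \<Longrightarrow> degree p > 0 \<Longrightarrow> \<exists>a. poly p a = 0"
begin

declare zero_mem [simp] one_notin [simp]

lemma mult_mem': "a \<in> M \<Longrightarrow> a * b \<in> M"
  using mult_mem[of a b] by (simp add: mult.commute)

lemma minus_mem: "a \<in> M \<Longrightarrow> - a \<in> M"
  using mult_mem[of a "-1"] by simp

lemma diff_mem: "a \<in> M \<Longrightarrow> b \<in> M \<Longrightarrow> a - b \<in> M"
  using add_mem[of a "-b"] minus_mem by simp

lemma mem_cong: "a - b \<in> M \<Longrightarrow> a \<in> M \<longleftrightarrow> b \<in> M"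
  using add_mem[of "a - b" b] diff_mem[of a "a - b"] by auto

lemma sum_mem: "(\<And>i. i \<in> I \<Longrightarrow> f i \<in> M) \<Longrightarrow> sum f I \<in> M"
  by (induction I rule: infinite_finite_induct) (auto intro: add_mem)

lemma prime_mem: "a * b \<in> M \<longleftrightarrow> a \<in> M \<or> b \<in> M"
proof
  assume ab: "a * b \<in> M"
  show "a \<in> M \<or> b \<in> M"
  proof (rule disjCI)
    assume "b \<notin> M"
    then obtain c where "b * c - 1 \<in> M" using ex_inverse by blast
    then have "a * b * c - a * (b * c - 1) \<in> M" by (rule diff_mem[OF mult_mem'[OF ab] mult_mem])
    then show "a \<in> M" by (simp add: algebra_simps)
  qed
qed (auto intro: mult_mem mult_mem')

lemma power_mem_iff: "a ^ n \<in> M \<longleftrightarrow> n > 0 \<and> a \<in> M"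
  by (induction n) (auto simp: prime_mem)

text \<open>The polynomials that become 0 over the residue field.\<close>

definition pmem :: "'r poly set" where
  "pmem = {f. \<forall>i. coeff f i \<in> M}"

lemma pmem_0 [simp]: "0 \<in> pmem"
  and pmem_add: "f \<in> pmem \<Longrightarrow> g \<in> pmem \<Longrightarrow> f + g \<in> pmem"
  and pmem_diff: "f \<in> pmem \<Longrightarrow> g \<in> pmem \<Longrightarrow> f - g \<in> pmem"
  and pmem_smult: "f \<in> pmem \<Longrightarrow> smult c f \<in> pmem"
  and pmem_monom: "c \<in> M \<Longrightarrow> monom c n \<in> pmem"
  by (auto simp: pmem_def add_mem diff_mem mult_mem)

lemma pmem_mult: "f \<in> pmem \<Longrightarrow> g * f \<in> pmem"
  by (auto simp: pmem_def coeff_mult intro!: sum_mem mult_mem)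

lemma poly_mem: "f \<in> pmem \<Longrightarrow> poly f a \<in> M"
  by (auto simp: pmem_def poly_altdef intro!: sum_mem mult_mem')

lemma smult_mem_iff: "c \<notin> M \<Longrightarrow> smult c f \<in> pmem \<longleftrightarrow> f \<in> pmem"
  by (auto simp: pmem_def prime_mem)

lemma ex_monic:
  assumes "coeff f n \<notin> M" "\<And>i. i > n \<Longrightarrow> coeff f i = 0"
  obtains u g where "lead_coeff g = 1" "degree g = n" "smult u f - g \<in> pmem" "u \<notin> M"
proof -
  obtain u where u: "coeff f n * u - 1 \<in> M" using ex_inverse assms(1) by blast
  \<comment> \<open>The coefficient of \<open>smult u f\<close> at n is only congruent to 1; the
    added monomial makes it equal to 1, as \<open>ex_root\<close> demands.\<close>
  define g where "g = smult u f + monom (1 - coeff f n * u) n"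
  have "coeff g n = 1" by (simp add: g_def algebra_simps)
  moreover have "coeff g i = 0" if "i > n" for i using that assms(2) by (simp add: g_def)
  ultimately have "degree g = n"
    by (metis le_degree coeff_0 leading_coeff_0_iff linorder_neqE_nat not_less one_neq_zero)
  moreover have "smult u f - g = monom (coeff f n * u - 1) n"
    by (simp add: g_def minus_monom[symmetric] algebra_simps flip: minus_monom add_monom)
      (simp add: diff_monom[symmetric])
  moreover have "u \<notin> M"
    using u one_notin mult_mem[of u "coeff f n"] mem_cong[of "coeff f n * u" 1] by blast
  ultimately show ?thesis using that[of g u] u \<open>coeff g n = 1\<close> by (simp add: pmem_monom)
qed

text \<open>For monic g of positive degree, \<open>g - 1\<close> has a root, and there g takes the
  value 1. The general case reduces to this one by discarding leading coefficients in M and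
  normalising the first one outside M.\<close>

lemma ex_nonroot:
  assumes "f \<notin> pmem"
  shows "\<exists>a. poly f a \<notin> M"
  using assms
proof (induction "degree f" arbitrary: f rule: less_induct)
  case less
  show ?case
  proof (cases "lead_coeff f \<in> M")
    case True
    define g where "g = f - monom (lead_coeff f) (degree f)"
    have m: "monom (lead_coeff f) (degree f) \<in> pmem" using True by (rule pmem_monom)
    then have g: "g \<notin> pmem" using less.prems pmem_add[OF m, of g] by (auto simp: g_def)
    have "coeff g i = 0" if "i \<ge> degree f" for i
      using that by (cases "i = degree f") (auto simp: g_def coeff_eq_0)
    moreover have "g \<noteq> 0" using g by auto
    ultimately have "degree g < degree f" by (meson leading_coeff_0_iff not_less)
    then obtain a where "poly g a \<notin> M" using less.hyps g by blast
    moreover have "poly f a - poly g a \<in> M"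
      using poly_mem[OF m, of a] by (simp add: g_def)
    ultimately show ?thesis using mem_cong by blast
  next
    case False
    obtain u g where g: "lead_coeff g = 1" "degree g = degree f" "smult u f - g \<in> pmem"
      using ex_monic[of f "degree f"] False coeff_eq_0[of f] by metis
    have "\<exists>a. poly g a = 1"
    proof (cases "degree f = 0")
      case True
      then show ?thesis using g by (metis degree_0_id mult_1 poly_monom monom_0 power_0 mult.right_neutral)
    next
      case False
      have dg: "degree (g - 1) = degree g"
      proof -
        have "degree (g + (- 1)) = degree g" using False g by (intro degree_add_eq_left) auto
        then show ?thesis by simp
      qed
      have "lead_coeff (g - 1) = 1" using g False dg by simp
      then obtain a where "poly (g - 1) a = 0" using ex_root[of "g - 1"] dg g False by auto
      then show ?thesis by (intro exI[of _ a]) simp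
    qed
    then obtain a where a: "poly g a = 1" by blast
    have "u * poly f a - poly g a \<in> M" using poly_mem[OF g(3), of a] by simp
    then have "u * poly f a \<notin> M" using a mem_cong by (metis one_notin)
    then show ?thesis using mult_mem by blast
  qed
qed

lemma poly_eq_linear_factor: "\<exists>g. f = [:-a, 1:] * g + [:poly f a:]" for f :: "'r poly"
  using synthetic_div_correct'[of a f] by metis

text \<open>Split a linear factor off f at a root a. Modulo M, g is divisible by the same factor
  because its value at a lies in M, while the cofactor of f divides the next lower power of g by
  induction. Each root thus uses up one factor g.\<close>

lemma root_power:
  assumes "lead_coeff f = 1" "\<And>a. poly f a \<in> M \<Longrightarrow> poly g a \<in> M"
  shows "\<exists>h. g ^ degree f - f * h \<in> pmem"
  using assms
proof (induction "degree f" arbitrary: f)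
  case 0
  then have "f = 1" by (metis degree_0_id of_nat_1 one_pCons)
  then show ?case by (intro exI[of _ 1]) simp
next
  case (Suc n)
  obtain a where a: "poly f a = 0" using ex_root[of f] Suc by auto
  obtain f' where f': "f = [:-a, 1:] * f'" using poly_eq_linear_factor[of f a] a by auto
  obtain g' where g': "g = [:-a, 1:] * g' + [:poly g a:]" using poly_eq_linear_factor by blast
  have ga: "poly g a \<in> M" using Suc.prems(2)[of a] a by simp
  have nz: "f' \<noteq> 0" using f' Suc.prems by auto
  then have "degree (pCons 0 f' + smult (- a) f') = degree (pCons 0 f')"
    by (intro degree_add_eq_left) (auto simp: less_Suc_eq_le degree_smult_le)
  then have d: "degree f = Suc (degree f')" using nz by (simp add: f')
  have l: "lead_coeff f' = 1"
    using Suc.prems(1) d by (simp add: f' coeff_eq_0)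
  have "poly g b \<in> M" if "poly f' b \<in> M" for b
    using Suc.prems(2)[of b] that by (auto simp: f' intro!: mult_mem simp del: mult_pCons_left)
  then obtain h where h: "g ^ degree f' - f' * h \<in> pmem" using Suc.hyps(1)[of f'] Suc.hyps(2) d l by auto
  have "g ^ degree f - f * (g' * h) =
      ([:-a, 1:] * g') * (g ^ degree f' - f' * h) + g ^ degree f' * [:poly g a:]"
  proof -
    have "(u * g' + v) * w - u * f' * (g' * h) = u * g' * (w - f' * h) + w * v" for u v w :: "'r poly"
      by (simp add: algebra_simps)
    from this[of "[:-a, 1:]" "[:poly g a:]" "g ^ degree f'"] show ?thesis
      unfolding d power_Suc g'[symmetric] f'[symmetric] .
  qed
  moreover have "[:poly g a:] \<in> pmem" using pmem_monom[OF ga, of 0] by (simp add: monom_0)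
  ultimately show ?case using h by (metis pmem_add pmem_mult)
qed

text \<open>Uniqueness of remainders over the residue field. Since f is monic, the leading
  coefficient of h is congruent to a coefficient of r at or above the degree of f, hence lies in M,
  and the leading term of h can be removed.\<close>

lemma monic_multiple:
  assumes "lead_coeff f = 1" "r - f * h \<in> pmem" "\<And>i. i \<ge> degree f \<Longrightarrow> coeff r i \<in> M"
  shows "r \<in> pmem"
  using assms(2)
proof (induction "degree h" arbitrary: h rule: less_induct)
  case less
  show ?case
  proof (cases "h = 0")
    case True
    then show ?thesis using less.prems by simp
  next
    case False
    define m where "m = monom (lead_coeff h) (degree h)"
    have "coeff (f * h) (degree f + degree h) = lead_coeff h"
      using assms(1) by (simp add: coeff_mult_degree_sum)
    moreover have "coeff r (degree f + degree h) - coeff (f * h) (degree f + degree h) \<in> M"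
      using less.prems by (simp add: pmem_def flip: coeff_diff)
    ultimately have lm: "lead_coeff h \<in> M" using assms(3)[of "degree f + degree h"] mem_cong by simp
    have fm: "f * m \<in> pmem" using lm by (simp add: m_def pmem_monom pmem_mult)
    have eq: "r - f * (h - m) = (r - f * h) + f * m" by (simp add: algebra_simps)
    have pm: "r - f * (h - m) \<in> pmem" unfolding eq using less.prems fm by (rule pmem_add)
    show ?thesis
    proof (cases "h - m = 0")
      case True
      then show ?thesis using pm by simp
    next
      case False
      have "coeff (h - m) i = 0" if "i \<ge> degree h" for i
        using that by (cases "i = degree h") (auto simp: m_def coeff_eq_0)
      then have "degree (h - m) < degree h" using False by (meson leading_coeff_0_iff not_less)
      then show ?thesis using less.hyps pm by blast
    qed
  qed
qed

lemma holds_elim_last: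
  assumes c: "tval e c \<notin> M"
  shows "holds M e (elim_last c p q) \<longleftrightarrow>
    (\<exists>a. poly (hpoly e (c # p)) a \<in> M \<and> poly (tpoly e q) a \<notin> M)"
proof -
  define f where "f = hpoly e (c # p)"
  define g where "g = tpoly e q"
  define n where "n = length p"
  define r where "r = hpoly e (prem c p (rev (ppow q n)))"
  have cf: "coeff f n = tval e c" "\<And>i. i > n \<Longrightarrow> coeff f i = 0"
    by (auto simp: f_def n_def coeff_hpoly_ge simp del: hpoly.simps)
       (simp_all add: coeff_hpoly_ge)
  obtain j h where jh: "smult (tval e c ^ j) (g ^ n) = f * h + r"
    using prem_correct[of e c "rev (ppow q n)" p] by (auto simp: f_def g_def r_def hpoly_rev)
  obtain u f' where f': "lead_coeff f' = 1" "degree f' = n" "smult u f - f' \<in> pmem" "u \<notin> M"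
    using ex_monic[of f n] cf c by metis
  have rt: "poly f a \<in> M \<longleftrightarrow> poly f' a \<in> M" for a
    using poly_mem[OF f'(3), of a] mem_cong[of "u * poly f a" "poly f' a"] f'(4) by (auto simp: prime_mem)
  have r0: "coeff r i \<in> M" if "i \<ge> n" for i
    using that length_prem[of c p "rev (ppow q n)"] by (simp add: r_def n_def coeff_hpoly_ge)
  have "holds M e (elim_last c p q) \<longleftrightarrow> (\<exists>t\<in>set (prem c p (rev (ppow q n))). tval e t \<notin> M)"
    by (auto simp: n_def)
  also have "\<dots> \<longleftrightarrow> r \<notin> pmem"
  proof -
    let ?l = "prem c p (rev (ppow q n))"
    have "r \<in> pmem \<longleftrightarrow> (\<forall>i<length ?l. tval e (rev ?l ! i) \<in> M)"
      unfolding pmem_def r_def mem_Collect_eq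
      by (metis coeff_hpoly coeff_hpoly_ge not_less zero_mem)
    also have "\<dots> \<longleftrightarrow> (\<forall>t\<in>set (rev ?l). tval e t \<in> M)"
      unfolding all_set_conv_all_nth by simp
    finally show ?thesis by auto
  qed
  also have "r \<in> pmem \<longleftrightarrow> (\<forall>a. poly f a \<in> M \<longrightarrow> poly g a \<in> M)"
  proof
    assume r: "r \<in> pmem"
    show "\<forall>a. poly f a \<in> M \<longrightarrow> poly g a \<in> M"
    proof (intro allI impI)
      fix a assume "poly f a \<in> M"
      then have "poly (f * h + r) a \<in> M" using poly_mem[OF r, of a] by (auto intro: add_mem mult_mem')
      then have "tval e c ^ j * poly g a ^ n \<in> M" by (simp flip: jh)
      then show "poly g a \<in> M" using c by (auto simp: prime_mem power_mem_iff)
    qed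
  next
    assume "\<forall>a. poly f a \<in> M \<longrightarrow> poly g a \<in> M"
    then obtain h' where h': "g ^ n - f' * h' \<in> pmem"
      using root_power[of f' g] f' rt by auto
    \<comment> \<open>Modulo M, \<open>smult u f\<close> is \<open>f'\<close>, and
      \<open>g ^ n\<close> is a multiple of \<open>f'\<close>. So r, up to a factor invertible
      modulo M, is a multiple of the monic \<open>f'\<close> of lower degree and must
      vanish.\<close>
    have "smult u r - f' * (smult (u * tval e c ^ j) h' - h)
        = smult (u * tval e c ^ j) (g ^ n - f' * h') - h * (smult u f - f')"
    proof -
      have "smult (u * tval e c ^ j) (g ^ n) = smult u (f * h + r)" using jh by (simp flip: smult_smult)
      then show ?thesis by (simp add: algebra_simps smult_diff_right smult_add_right)
    qed
    then have "smult u r - f' * (smult (u * tval e c ^ j) h' - h) \<in> pmem"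
      using h' f'(3) by (metis pmem_diff pmem_mult pmem_smult)
    then have "smult u r \<in> pmem" by (rule monic_multiple[OF f'(1)]) (use r0 f' in \<open>auto intro: mult_mem\<close>)
    then show "r \<in> pmem" using smult_mem_iff f'(4) by blast
  qed
  finally show ?thesis by (auto simp: f_def g_def)
qed

text \<open>The Euclidean algorithm with a case split on leading coefficients. One lying in M is
  dropped; otherwise reducing by that polynomial keeps the common zeros. With no equation left, q
  needs a nonroot, which exists unless all its coefficients lie in M.\<close>

lemma holds_elim_system:
  "holds M e (elim_system ps q) \<longleftrightarrow>
    (\<exists>a. (\<forall>p\<in>set ps. poly (hpoly e p) a \<in> M) \<and> poly (tpoly e q) a \<notin> M)"
proof (induction ps q rule: elim_system.induct)
  case (1 q)
  have "tpoly e q \<in> pmem \<longleftrightarrow> (\<forall>t\<in>set q. tval e t \<in> M)"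
    by (induction q) (auto simp: pmem_def coeff_pCons split: nat.splits)
  then show ?case using ex_nonroot[of "tpoly e q"] poly_mem[of "tpoly e q"] by auto
next
  case (3 c p q)
  have z: "tval e c \<in> M \<Longrightarrow> poly (hpoly e (c # p)) a \<in> M \<longleftrightarrow> poly (hpoly e p) a \<in> M" for a
    using mem_cong[of "poly (hpoly e (c # p)) a" "poly (hpoly e p) a"]
    by (simp add: poly_monom mult_mem')
  show ?case
  proof (cases "tval e c \<in> M")
    case True
    then show ?thesis using 3 z by simp
  next
    case False
    then show ?thesis using holds_elim_last[OF False, of p q] by simp
  qed
next
  case (5 c p d s ps q)
  have z: "tval e c \<in> M \<Longrightarrow> poly (hpoly e (c # p)) a \<in> M \<longleftrightarrow> poly (hpoly e p) a \<in> M" for c p a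
    using mem_cong[of "poly (hpoly e (c # p)) a" "poly (hpoly e p) a"]
    by (simp add: poly_monom mult_mem')
  have r: "poly (hpoly e (red c p d s)) a \<in> M \<longleftrightarrow> poly (hpoly e (d # s)) a \<in> M"
    if "length p \<le> length s" "tval e c \<notin> M" "poly (hpoly e (c # p)) a \<in> M" for a c p d s
  proof -
    have "poly (hpoly e (red c p d s)) a - tval e c * poly (hpoly e (d # s)) a \<in> M"
      unfolding hpoly_red[OF that(1)] using that(3)
      by (simp add: minus_mem mult_mem del: hpoly.simps)
    from mem_cong[OF this] show ?thesis using that(2) by (simp add: prime_mem del: hpoly.simps)
  qed
  define R where "R f a \<longleftrightarrow> poly (hpoly e f) a \<in> M" for f a
  show ?case
  proof (cases "length p \<le> length s")
    case True
    have c: "tval e c \<in> M \<Longrightarrow> R (c # p) a = R p a" for a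
      unfolding R_def by (rule z)
    have c': "tval e c \<notin> M \<Longrightarrow> (R (c # p) a \<and> R (red c p d s) a \<and> X) = (R (c # p) a \<and> R (d # s) a \<and> X)" for a X
      unfolding R_def using r[OF True] by blast
    show ?thesis
    proof (cases "tval e c \<in> M")
      case cM: True
      then show ?thesis using 5(1)[OF True] True
        by (simp del: hpoly.simps flip: R_def add: c conj_ac)
    next
      case cM: False
      then show ?thesis using 5(2)[OF True] True
        by (simp del: hpoly.simps flip: R_def add: c') blast
    qed
  next
    case False
    have d: "tval e d \<in> M \<Longrightarrow> R (d # s) a = R s a" for a
      unfolding R_def by (rule z)
    have d': "tval e d \<notin> M \<Longrightarrow> (R (red d s c p) a \<and> R (d # s) a \<and> X) = (R (c # p) a \<and> R (d # s) a \<and> X)" for a X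
      unfolding R_def using r[of s p d a c] False by auto
    show ?thesis
    proof (cases "tval e d \<in> M")
      case dM: True
      then show ?thesis using 5(3)[OF False] False
        by (simp del: hpoly.simps flip: R_def add: d conj_ac)
    next
      case dM: False
      then show ?thesis using 5(4)[OF False] False
        by (simp del: hpoly.simps flip: R_def add: d') blast
    qed
  qed
qed auto

lemma holds_dnf:
  "(\<exists>(ps, q)\<in>set (dnf b f). (\<forall>p\<in>set ps. tval e p \<in> M) \<and> tval e q \<notin> M) \<longleftrightarrow> (holds M e f \<longleftrightarrow> b)"
proof -
  define D where "D z \<longleftrightarrow> (\<forall>p\<in>set (fst z). tval e p \<in> M) \<and> tval e (snd z) \<notin> M" for z
  have D: "D (ps @ ps', Times q q') \<longleftrightarrow> D (ps, q) \<and> D (ps', q')" for ps ps' q q'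
    by (auto simp: D_def prime_mem)
  have "(\<exists>z\<in>set (dnf b f). D z) \<longleftrightarrow> (holds M e f \<longleftrightarrow> b)"
  proof (induction b f rule: dnf.induct)
    case (4 f g)
    have "(\<exists>z\<in>set (dnf True (Conj f g)). D z) \<longleftrightarrow>
      (\<exists>x\<in>set (dnf True f). \<exists>y\<in>set (dnf True g). D x \<and> D y)"
      by (simp add: D split_beta)
    also have "\<dots> \<longleftrightarrow> (\<exists>x\<in>set (dnf True f). D x) \<and> (\<exists>y\<in>set (dnf True g). D y)"
      by blast
    finally show ?case using 4 by simp
  next
    case (5 f g)
    then show ?case by (simp add: bex_Un)
  qed (auto simp: D_def)
  then show ?thesis by (simp add: D_def split_beta)
qed

lemma holds_elim: "holds M e (elim x f) \<longleftrightarrow> (\<exists>a. holds M (e(x := a)) f)"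
proof -
  have "holds M e (elim x f) \<longleftrightarrow>
    (\<exists>(ps, q)\<in>set (dnf True f). \<exists>a. (\<forall>p\<in>set ps. tval (e(x := a)) p \<in> M) \<and> tval (e(x := a)) q \<notin> M)"
    by (simp add: elim_def holds_elim_system hpoly_rev poly_tcoeffs split_beta)
  also have "\<dots> \<longleftrightarrow> (\<exists>a. \<exists>(ps, q)\<in>set (dnf True f).
      (\<forall>p\<in>set ps. tval (e(x := a)) p \<in> M) \<and> tval (e(x := a)) q \<notin> M)"
    unfolding case_prod_beta by blast
  also have "\<dots> \<longleftrightarrow> (\<exists>a. holds M (e(x := a)) f)" using holds_dnf[of True f] by simp
  finally show ?thesis .
qed

lemma holds_elims:
  "holds M e (foldr elim xs f) \<longleftrightarrow> (\<exists>e'. (\<forall>x. x \<notin> set xs \<longrightarrow> e' x = e x) \<and> holds M e' f)"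
proof (induction xs arbitrary: e)
  case Nil
  then show ?case by (metis empty_iff list.set(1) ext foldr_Nil id_apply)
next
  case (Cons y xs)
  have "holds M e (foldr elim (y # xs) f) \<longleftrightarrow>
      (\<exists>a e'. (\<forall>x. x \<notin> set xs \<longrightarrow> e' x = (e(y := a)) x) \<and> holds M e' f)"
    by (simp add: holds_elim Cons)
  also have "\<dots> \<longleftrightarrow> (\<exists>e'. (\<forall>x. x \<notin> set (y # xs) \<longrightarrow> e' x = e x) \<and> holds M e' f)"
  proof
    assume "\<exists>e'. (\<forall>x. x \<notin> set (y # xs) \<longrightarrow> e' x = e x) \<and> holds M e' f"
    then obtain e' where "\<forall>x. x \<notin> set (y # xs) \<longrightarrow> e' x = e x" "holds M e' f" by blast
    then show "\<exists>a e'. (\<forall>x. x \<notin> set xs \<longrightarrow> e' x = (e(y := a)) x) \<and> holds M e' f"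
      by (intro exI[of _ "e' y"] exI[of _ e']) auto
  next
    assume "\<exists>a e'. (\<forall>x. x \<notin> set xs \<longrightarrow> e' x = (e(y := a)) x) \<and> holds M e' f"
    then obtain a e' where "\<forall>x. x \<notin> set xs \<longrightarrow> e' x = (e(y := a)) x" "holds M e' f" by blast
    then show "\<exists>e'. (\<forall>x. x \<notin> set (y # xs) \<longrightarrow> e' x = e x) \<and> holds M e' f"
      by (intro exI[of _ e']) auto
  qed
  finally show ?case .
qed

end

lemma set_elims: "set_form (foldr elim xs f) \<subseteq> set_form f - set xs"
proof (induction xs)
  case (Cons x xs)
  with set_elim[of x "foldr elim xs f"] show ?case by auto
qed simp

section \<open>Transfer of sentences to residue fields of algebraic integers\<close>

lemma module_int: "module (\<lambda>n (z :: 'a::comm_ring_1). of_int n * z)"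
  by unfold_locales (auto simp: algebra_simps)

abbreviation zspan :: "'a::comm_ring_1 set \<Rightarrow> 'a set" where
  "zspan \<equiv> module.span (\<lambda>n z. of_int n * z)"

lemmas zspan_zero = module.span_zero[OF module_int]
  and zspan_add = module.span_add[OF module_int]
  and zspan_neg = module.span_neg[OF module_int]
  and zspan_scale = module.span_scale[OF module_int]
  and zspan_base = module.span_base[OF module_int]
  and zspan_sum = module.span_sum[OF module_int]
  and zspan_singleton = module.span_singleton[OF module_int]
  and zspan_finite = module.span_finite[OF module_int]
  and zspan_breakdown_eq = module.span_breakdown_eq[OF module_int]

lemma zspan_subset: "A \<subseteq> zspan B \<Longrightarrow> zspan A \<subseteq> zspan B"
  by (rule module.span_minimal[OF module_int _ module.subspace_span[OF module_int]])

lemmas zspan_induct_alt [consumes 1, case_names base step] =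
  module.span_induct_alt[OF module_int]

lemma zspan_times:
  fixes x y :: "'a::comm_ring_1"
  assumes "x \<in> zspan A" "y \<in> zspan B"
  shows "x * y \<in> zspan ((\<lambda>(a, b). a * b) ` (A \<times> B))"
  using assms(1)
proof (induction rule: zspan_induct_alt)
  case base
  then show ?case by (simp add: zspan_zero)
next
  case (step c a x)
  have "a * y \<in> zspan ((\<lambda>(a, b). a * b) ` (A \<times> B))"
    using assms(2)
  proof (induction rule: zspan_induct_alt)
    case base
    then show ?case by (simp add: zspan_zero)
  next
    case (step d b y)
    have "a * b \<in> zspan ((\<lambda>(a, b). a * b) ` (A \<times> B))"
      using step \<open>a \<in> A\<close> by (intro zspan_base) auto
    from zspan_add[OF zspan_scale[OF this, of d] step.IH] show ?case
      by (simp add: algebra_simps)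
  qed
  from zspan_add[OF zspan_scale[OF this, of c] step.IH] show ?case
    by (simp add: algebra_simps)
qed

text \<open>The complex numbers lying in such a ring are the algebraic integers. Integrality is
  phrased through rings rather than monic equations so that sums and products need only a common
  larger ring.\<close>

definition finite_order :: "'a::comm_ring_1 set \<Rightarrow> bool" where
  "finite_order S \<longleftrightarrow> 1 \<in> S \<and> (\<forall>x\<in>S. \<forall>y\<in>S. x * y \<in> S) \<and> (\<exists>B. finite B \<and> S = zspan B)"

lemma finite_orderI:
  assumes "finite B" "1 \<in> zspan B" "\<And>x y. x \<in> B \<Longrightarrow> y \<in> B \<Longrightarrow> x * y \<in> zspan B"
  shows "finite_order (zspan B)"
proof -
  have "x * y \<in> zspan B" if "x \<in> zspan B" "y \<in> zspan B" for x y
  proof -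
    have "zspan ((\<lambda>(a, b). a * b) ` (B \<times> B)) \<subseteq> zspan B"
      using assms(3) by (intro zspan_subset) auto
    then show ?thesis using zspan_times[OF that] by blast
  qed
  with assms show ?thesis by (auto simp: finite_order_def)
qed

lemma finite_order_ring:
  assumes "finite_order S"
  shows "0 \<in> S" "1 \<in> S" "x \<in> S \<Longrightarrow> y \<in> S \<Longrightarrow> x + y \<in> S" "x \<in> S \<Longrightarrow> - x \<in> S"
    "x \<in> S \<Longrightarrow> y \<in> S \<Longrightarrow> x * y \<in> S"
  using assms by (auto simp: finite_order_def zspan_zero zspan_add zspan_neg)

lemma finite_order_UNIV: "finite_order (range of_int :: 'a::comm_ring_1 set)"
proof -
  have "range of_int = zspan {1::'a}" by (auto simp: zspan_singleton)
  then show ?thesis using finite_orderI[of "{1::'a}"] by (auto simp: zspan_base)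
qed

text \<open>The products of the generators of both rings span the compositum.\<close>

lemma finite_order_join:
  assumes "finite_order S" "finite_order S'"
  obtains S'' where "finite_order S''" "S \<union> S' \<subseteq> S''"
proof -
  obtain B B' where B: "finite B" "S = zspan B" "finite B'" "S' = zspan B'"
    using assms by (auto simp: finite_order_def)
  define C where "C = (\<lambda>(a, b). a * b) ` (B \<times> B')"
  have mem: "x * y \<in> zspan C" if "x \<in> S" "y \<in> S'" for x y
    using that zspan_times B by (auto simp: C_def)
  have "finite_order (zspan C)"
  proof (rule finite_orderI)
    show "1 \<in> zspan C" using mem[of 1 1] finite_order_ring(2) assms by auto
    fix x y assume "x \<in> C" "y \<in> C"
    then obtain a b c d where "x = a * b" "y = c * d" "a \<in> B" "b \<in> B'" "c \<in> B" "d \<in> B'"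
      by (auto simp: C_def)
    then have "x * y = (a * c) * (b * d)" by (simp add: mult_ac)
    moreover have "a * c \<in> S" "b * d \<in> S'"
      using \<open>a \<in> B\<close> \<open>b \<in> B'\<close> \<open>c \<in> B\<close> \<open>d \<in> B'\<close> unfolding B
      by (intro finite_order_ring(5) assms[unfolded B] zspan_base; simp)+
    ultimately show "x * y \<in> zspan C" using mem by metis
  qed (use B in \<open>auto simp: C_def\<close>)
  moreover have "S \<union> S' \<subseteq> zspan C"
    using mem[of _ 1] mem[of 1] finite_order_ring(2) assms by auto
  ultimately show ?thesis using that by blast
qed

text \<open>The monic equation rewrites high powers of z by powers below the degree of P, so
  finitely many products of a generator of S with a power of z span S[z].\<close>

lemma finite_order_adjoin_root:
  fixes P :: "'a::comm_ring_1 poly"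
  assumes S: "finite_order S" and P: "lead_coeff P = 1" "degree P > 0" "\<And>i. coeff P i \<in> S"
    and z: "poly P z = 0"
  obtains S' where "finite_order S'" "S \<subseteq> S'" "z \<in> S'"
proof -
  obtain B where B: "finite B" "S = zspan B" using S by (auto simp: finite_order_def)
  define n where "n = degree P"
  define C where "C = (\<lambda>(a, b). a * b) ` (B \<times> (\<lambda>i. z ^ i) ` {..<n})"
  have mem: "s * z ^ m \<in> zspan C" if "s \<in> S" for s m
    using that
  proof (induction m arbitrary: s rule: less_induct)
    case (less m)
    show ?case
    proof (cases "m < n")
      case True
      have "z ^ m \<in> zspan ((\<lambda>i. z ^ i) ` {..<n})" using True by (intro zspan_base) auto
      then show ?thesis using zspan_times less.prems B by (auto simp: C_def)
    next
      case False
      have "z ^ n + (\<Sum>i<n. coeff P i * z ^ i) = 0"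
        using z P(1) by (simp add: poly_altdef n_def lessThan_Suc_atMost[symmetric] add.commute)
      then have zn: "z ^ n = - (\<Sum>i<n. coeff P i * z ^ i)" by (rule eq_neg_iff_add_eq_0[THEN iffD2])
      have "s * z ^ m = s * z ^ (m - n) * z ^ n" using False by (simp add: mult.assoc flip: power_add)
      also have "\<dots> = - (\<Sum>i<n. s * coeff P i * z ^ (m - n + i))"
        unfolding zn by (simp add: sum_distrib_left power_add mult_ac)
      also have "\<dots> \<in> zspan C"
      proof (intro zspan_neg zspan_sum less.IH)
        fix i assume "i \<in> {..<n}"
        then show "m - n + i < m" using False by auto
        show "s * coeff P i \<in> S" using less.prems P(3) S finite_order_ring(5) by blast
      qed
      finally show ?thesis .
    qed
  qed
  have "finite_order (zspan C)"
  proof (rule finite_orderI)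
    show "1 \<in> zspan C" using mem[of 1 0] S finite_order_ring(2) by auto
    fix x y assume "x \<in> C" "y \<in> C"
    then obtain a i c j where "x = a * z ^ i" "y = c * z ^ j" "a \<in> B" "c \<in> B"
      by (auto simp: C_def)
    then have "x * y = (a * c) * z ^ (i + j)" by (simp add: power_add mult_ac)
    moreover have "a * c \<in> S"
      using \<open>a \<in> B\<close> \<open>c \<in> B\<close> unfolding B
      by (intro finite_order_ring(5) S[unfolded B] zspan_base)
    ultimately show "x * y \<in> zspan C" using mem by metis
  qed (use B in \<open>auto simp: C_def\<close>)
  moreover have "S \<subseteq> zspan C" using mem[of _ 0] by auto
  moreover have "z \<in> zspan C" using mem[of 1 1] S finite_order_ring(2) by auto
  ultimately show ?thesis using that by blast
qed

lemma zspan_annihilated: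
  fixes x :: "'a::comm_ring_1"
  assumes "x \<in> zspan B" "\<forall>b\<in>B. of_int w * b = 0"
  shows "of_int w * x = 0"
  using assms(1)
proof (induction rule: zspan_induct_alt)
  case (step c b y)
  have "of_int w * (of_int c * b + y) = of_int c * (of_int w * b) + of_int w * y"
    by (simp add: algebra_simps)
  with step assms(2) show ?case by simp
qed simp

text \<open>Nakayama's lemma for the ideal generated by p, proved by eliminating one generator at a
  time in place of a determinant. Allowing any u congruent to 1 modulo p, instead of 1 alone, is
  what lets the induction close.\<close>

lemma nakayama_int:
  fixes B :: "'a::comm_ring_1 set" and p :: int
  assumes "finite B" "p dvd u - 1" "\<And>b. b \<in> B \<Longrightarrow> \<exists>x\<in>zspan B. of_int u * b = of_int p * x"
  shows "\<exists>w. p dvd w - 1 \<and> (\<forall>b\<in>B. of_int w * b = 0)"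
  using assms
proof (induction B arbitrary: u)
  case empty
  then show ?case by auto
next
  case (insert c B)
  obtain x m where x: "x \<in> zspan B" and uc: "of_int u * c = of_int p * (of_int m * c + x)"
  proof -
    obtain y where y: "y \<in> zspan (insert c B)" "of_int u * c = of_int p * y"
      using insert.prems by blast
    then obtain k where "y - of_int k * c \<in> zspan B"
      using zspan_breakdown_eq[of y c B] by blast
    with y that[of "y - of_int k * c" k] show ?thesis by auto
  qed
  \<comment> \<open>Moving the multiple of c to the left expresses v times c through the other
    generators alone, and v is still congruent to 1 modulo p.\<close>
  define v where "v = u - p * m"
  have dv: "p dvd v - 1"
  proof -
    have "v - 1 = (u - 1) - p * m" by (simp add: v_def)
    then show ?thesis using insert.prems(1) dvd_diff dvd_triv_left by metis
  qed
  have vc: "of_int v * c = of_int p * x"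
  proof -
    have "of_int v * c = of_int u * c - of_int p * (of_int m * c)"
      by (simp add: v_def algebra_simps)
    also have "\<dots> = of_int p * x" unfolding uc by (simp add: algebra_simps)
    finally show ?thesis .
  qed
  have "\<exists>w. p dvd w - 1 \<and> (\<forall>b\<in>B. of_int w * b = 0)"
  proof (rule insert.IH)
    show "p dvd v * u - 1"
    proof -
      have "v * u - 1 = (v - 1) * u + (u - 1)" by (simp add: algebra_simps)
      then show ?thesis using dv insert.prems(1) by (metis dvd_add dvd_mult2)
    qed
    fix b assume "b \<in> B"
    then obtain y where y: "y \<in> zspan (insert c B)" "of_int u * b = of_int p * y"
      using insert.prems by blast
    then obtain k where k: "y - of_int k * c \<in> zspan B"
      using zspan_breakdown_eq[of y c B] by blast
    have "of_int (v * u) * b = of_int v * (of_int u * b)" by (simp only: of_int_mult mult.assoc)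
    also have "\<dots> = of_int p * (of_int k * (of_int v * c) + of_int v * (y - of_int k * c))"
      unfolding y by (simp add: algebra_simps)
    also have "\<dots> = of_int p * (of_int (k * p) * x + of_int v * (y - of_int k * c))"
      unfolding vc by (simp add: mult.assoc)
    finally show "\<exists>x\<in>zspan B. of_int (v * u) * b = of_int p * x"
      using zspan_add[OF zspan_scale[OF x, of "k * p"] zspan_scale[OF k, of v]] by blast
  qed
  then obtain w where w: "p dvd w - 1" "\<forall>b\<in>B. of_int w * b = 0" by blast
  have "of_int w * x = 0" using zspan_annihilated[OF x w(2)] .
  then have "of_int p * (of_int w * x) = 0" by simp
  then have "of_int (w * v) * c = 0" using vc by (simp only: of_int_mult mult.assoc mult.left_commute)
  moreover have "p dvd w * v - 1"
  proof -
    have "w * v - 1 = (w - 1) * v + (v - 1)" by (simp add: algebra_simps)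
    then show ?thesis using dv w(1) by (metis dvd_add dvd_mult2)
  qed
  moreover have "of_int (w * v) * b = 0" if "b \<in> B" for b
  proof -
    have "of_int (w * v) * b = of_int v * (of_int w * b)" by (simp add: mult_ac)
    then show ?thesis using w(2) that by simp
  qed
  ultimately show ?case by blast
qed

text \<open>If p were invertible in S, then S = pS, and Nakayama would give an integer w congruent
  to 1 modulo p that annihilates S. As S contains 1 and the characteristic is 0, w = 0, so p divides
  1.\<close>

lemma finite_order_not_inverse:
  fixes z :: "'a::{idom, ring_char_0}"
  assumes S: "finite_order S" and z: "z \<in> S" and p: "p > 1"
  shows "of_int p * z \<noteq> 1"
proof
  assume pz: "of_int p * z = 1"
  obtain B where B: "finite B" "S = zspan B" using S by (auto simp: finite_order_def)
  have "\<exists>x\<in>zspan B. of_int 1 * b = of_int p * x" if "b \<in> B" for b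
  proof
    show "of_int 1 * b = of_int p * (z * b)" using pz by (simp flip: mult.assoc)
    show "z * b \<in> zspan B" using that z S finite_order_ring(5) B zspan_base by metis
  qed
  then obtain w where w: "p dvd w - 1" "\<forall>b\<in>B. of_int w * b = 0"
    using nakayama_int[OF B(1), of p 1] by auto
  have "of_int w * x = 0" if "x \<in> zspan B" for x
    using zspan_annihilated[OF that w(2)] .
  then have "(of_int w :: 'a) = 0" using finite_order_ring(2)[OF S] B by (metis mult.right_neutral)
  then have "p dvd 1" using w(1) by simp
  with p show False by auto
qed

text \<open>S / pS is finite: reduce the integer coordinates with respect to finitely many
  generators modulo p. All finiteness of residue fields rests on this.\<close>

lemma finite_order_residues:
  assumes "finite_order S" "p > 0"
  obtains T where "finite T" "T \<subseteq> S" "\<And>x. x \<in> S \<Longrightarrow> \<exists>t\<in>T. \<exists>s\<in>S. x - t = of_int p * s"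
proof -
  obtain B where B: "finite B" "S = zspan B" using assms by (auto simp: finite_order_def)
  define T where "T = (\<lambda>f. \<Sum>b\<in>B. of_int (f b) * b) ` (B \<rightarrow>\<^sub>E {0..<p})"
  show thesis
  proof
    show "finite T" using B by (auto simp: T_def finite_PiE)
    have sum_mem: "(\<Sum>b\<in>B. of_int (f b) * b) \<in> S" for f
      unfolding B by (intro zspan_sum zspan_scale) (rule zspan_base)
    then show "T \<subseteq> S" by (auto simp: T_def)
    fix x assume "x \<in> S"
    then obtain f where f: "x = (\<Sum>b\<in>B. of_int (f b) * b)"
      using B by (auto simp: zspan_finite)
    define t where "t = (\<Sum>b\<in>B. of_int (restrict (\<lambda>b. f b mod p) B b) * b)"
    have "t \<in> T" unfolding t_def T_def
      using assms(2) by (intro imageI) auto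
    moreover have "x - t = of_int p * (\<Sum>b\<in>B. of_int (f b div p) * b)"
    proof -
      have "of_int (f b) - of_int (f b mod p) = (of_int (p * (f b div p)) :: 'a)" for b
        by (metis of_int_diff minus_mod_eq_mult_div)
      then show ?thesis
        by (simp add: f t_def sum_distrib_left flip: sum_subtractf left_diff_distrib mult.assoc)
    qed
    moreover have "(\<Sum>b\<in>B. of_int (f b div p) * b) \<in> S"
      by (rule sum_mem)
    ultimately show "\<exists>t\<in>T. \<exists>s\<in>S. x - t = of_int p * s" by blast
  qed
qed

section \<open>The ring of algebraic integers\<close>

typedef algint = "{z :: complex. \<exists>S. finite_order S \<and> z \<in> S}"
  using finite_order_UNIV by blast

setup_lifting type_definition_algint

lemma finite_order_join_mem:
  assumes "\<exists>S. finite_order S \<and> x \<in> S" "\<exists>S. finite_order S \<and> y \<in> S"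
  shows "\<exists>S. finite_order S \<and> x \<in> S \<and> y \<in> S"
  using assms finite_order_join by (metis UnCI subsetD)

instantiation algint :: comm_ring_1
begin

lift_definition zero_algint :: algint is 0
  by (rule exI[of _ "range of_int"]) (simp add: finite_order_UNIV finite_order_ring(1))
lift_definition one_algint :: algint is 1
  by (rule exI[of _ "range of_int"]) (simp add: finite_order_UNIV finite_order_ring(2))
lift_definition plus_algint :: "algint \<Rightarrow> algint \<Rightarrow> algint" is "(+)"
  by (drule finite_order_join_mem, assumption) (auto intro: finite_order_ring(3))
lift_definition times_algint :: "algint \<Rightarrow> algint \<Rightarrow> algint" is "(*)"
  by (drule finite_order_join_mem, assumption) (auto intro: finite_order_ring(5))
lift_definition uminus_algint :: "algint \<Rightarrow> algint" is uminus
  by (auto intro: finite_order_ring(4))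
definition minus_algint :: "algint \<Rightarrow> algint \<Rightarrow> algint" where
  "minus_algint a b = a + - b"

instance
proof
  fix a b c :: algint
  note rep = Rep_algint_inject[THEN iffD1]
  note eqs = zero_algint.rep_eq one_algint.rep_eq plus_algint.rep_eq times_algint.rep_eq
    uminus_algint.rep_eq
  show "a + b + c = a + (b + c)" "a + b = b + a" "0 + a = a" "- a + a = 0"
    "a * b * c = a * (b * c)" "a * b = b * a" "1 * a = a" "(a + b) * c = a * c + b * c"
    by (rule rep; simp only: eqs; simp add: distrib_right)+
  show "a - b = a + - b" by (rule minus_algint_def)
  have "Rep_algint 0 \<noteq> Rep_algint 1" by (simp only: eqs) simp
  then show "(0 :: algint) \<noteq> 1" by auto
qed

end

lemma Rep_algint_sum: "Rep_algint (sum f A) = (\<Sum>x\<in>A. Rep_algint (f x))"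
  by (induction A rule: infinite_finite_induct) (auto simp: zero_algint.rep_eq plus_algint.rep_eq)

lemma Rep_algint_power: "Rep_algint (x ^ n) = Rep_algint x ^ n"
  by (induction n) (auto simp: one_algint.rep_eq times_algint.rep_eq)

lemma Rep_algint_minus: "Rep_algint (x - y) = Rep_algint x - Rep_algint y"
  by (simp only: minus_algint_def plus_algint.rep_eq uminus_algint.rep_eq) simp

lemma Rep_algint_of_nat: "Rep_algint (of_nat n) = of_nat n"
  by (induction n) (auto simp: zero_algint.rep_eq one_algint.rep_eq plus_algint.rep_eq)

lemma Rep_algint_of_int: "Rep_algint (of_int n) = of_int n"
  by (cases n rule: int_diff_cases) (simp add: Rep_algint_minus Rep_algint_of_nat)

lemma finite_order_superset:
  assumes "finite X"
  obtains S where "finite_order S" "Rep_algint ` X \<subseteq> S"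
proof -
  from assms have "\<exists>S. finite_order S \<and> Rep_algint ` X \<subseteq> S"
  proof induction
    case empty
    then show ?case using finite_order_UNIV by auto
  next
    case (insert x X)
    then obtain S where S: "finite_order S" "Rep_algint ` X \<subseteq> S" by blast
    obtain S' where S': "finite_order S'" "Rep_algint x \<in> S'" using Rep_algint[of x] by auto
    obtain S'' where "finite_order S''" "S \<union> S' \<subseteq> S''"
      using finite_order_join[OF S(1) S'(1)] by blast
    then show ?case using S S' by (intro exI[of _ S'']) auto
  qed
  then show ?thesis using that by blast
qed

text \<open>A complex root exists by the fundamental theorem of algebra. The coefficients lie in a
  common finitely generated ring, and adjoining a root of a monic polynomial keeps it finitely
  generated.\<close>

lemma algint_ex_root:
  fixes p :: "algint poly"
  assumes p: "lead_coeff p = 1" "degree p > 0"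
  shows "\<exists>a. poly p a = 0"
proof -
  obtain S where S: "finite_order S" "Rep_algint ` coeff p ` {..degree p} \<subseteq> S"
    using finite_order_superset[of "coeff p ` {..degree p}"] by auto
  define q where "q = map_poly Rep_algint p"
  have cq: "coeff q i = Rep_algint (coeff p i)" for i
    by (simp add: q_def coeff_map_poly zero_algint.rep_eq)
  have dq: "degree q = degree p" using p
    by (intro antisym degree_le le_degree) (auto simp: cq coeff_eq_0 zero_algint.rep_eq one_algint.rep_eq)
  then obtain z where z: "poly q z = 0" using alg_closed_imp_poly_has_root[of q] p by auto
  have "coeff q i \<in> S" for i
    using S finite_order_ring(1)[OF S(1)]
    by (cases "i \<le> degree p") (auto simp: cq coeff_eq_0 zero_algint.rep_eq)
  then obtain S' where S': "finite_order S'" "z \<in> S'"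
    using finite_order_adjoin_root[OF S(1), of q z] z dq p by (metis cq one_algint.rep_eq)
  then have "Rep_algint (Abs_algint z) = z" by (intro Abs_algint_inverse) auto
  then have "Rep_algint (poly p (Abs_algint z)) = poly q z"
    by (simp add: poly_altdef dq cq Rep_algint_sum times_algint.rep_eq Rep_algint_power)
  then show ?thesis using z by (metis Rep_algint_inject zero_algint.rep_eq)
qed

section \<open>Maximal ideals\<close>

definition is_ideal :: "'a::comm_ring_1 set \<Rightarrow> bool" where
  "is_ideal I \<longleftrightarrow> 0 \<in> I \<and> (\<forall>a\<in>I. \<forall>b\<in>I. a + b \<in> I) \<and> (\<forall>a. \<forall>b\<in>I. a * b \<in> I)"

text \<open>Zorn's lemma, with maximality delivered as inverses modulo M: for a outside M the ideal
  M + (a) contains 1.\<close>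

lemma ex_maximal_ideal:
  assumes "is_ideal I" "(1::'a::comm_ring_1) \<notin> I"
  obtains M where "is_ideal M" "I \<subseteq> M" "1 \<notin> M" "\<And>a. a \<notin> M \<Longrightarrow> \<exists>b. a * b - 1 \<in> M"
proof -
  define F where "F = {J. is_ideal J \<and> I \<subseteq> J \<and> 1 \<notin> J}"
  have "\<Union>C \<in> F" if C: "C \<noteq> {}" "subset.chain F C" for C
  proof -
    have CF: "is_ideal J \<and> I \<subseteq> J \<and> 1 \<notin> J" if "J \<in> C" for J
      using C(2) that by (auto simp: subset_chain_def F_def)
    have "a + b \<in> \<Union>C" if "a \<in> \<Union>C" "b \<in> \<Union>C" for a b
    proof -
      obtain J J' where J: "J \<in> C" "a \<in> J" "J' \<in> C" "b \<in> J'" using \<open>a \<in> _\<close> \<open>b \<in> _\<close> by blast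
      then have "J \<subseteq> J' \<or> J' \<subseteq> J" using C(2) by (auto simp: subset_chain_def)
      then obtain K where "K \<in> C" "a \<in> K" "b \<in> K" using J by blast
      then show ?thesis using CF[of K] by (auto simp: is_ideal_def)
    qed
    moreover have "I \<subseteq> \<Union>C" "0 \<in> \<Union>C" "1 \<notin> \<Union>C"
      using C(1) CF unfolding is_ideal_def by blast+
    moreover have "a * b \<in> \<Union>C" if "b \<in> \<Union>C" for a b
      using that CF unfolding is_ideal_def by blast
    ultimately show ?thesis by (simp add: F_def is_ideal_def)
  qed
  then obtain M where M: "M \<in> F" "\<And>J. J \<in> F \<Longrightarrow> M \<subseteq> J \<Longrightarrow> J = M"
    using subset_Zorn_nonempty[of F] assms by (auto simp: F_def)
  have "\<exists>b. a * b - 1 \<in> M" if a: "a \<notin> M" for a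
  proof -
    define J where "J = {m + a * b | m b. m \<in> M}"
    have "is_ideal J"
      unfolding is_ideal_def J_def
    proof (intro conjI ballI allI)
      have "0 = 0 + a * 0" "0 \<in> M" using M(1) by (auto simp: F_def is_ideal_def)
      then show "0 \<in> {m + a * b | m b. m \<in> M}" by blast
    next
      fix x y assume "x \<in> {m + a * b | m b. m \<in> M}" "y \<in> {m + a * b | m b. m \<in> M}"
      then obtain m b m' b' where "x = m + a * b" "y = m' + a * b'" "m \<in> M" "m' \<in> M" by blast
      then have "x + y = (m + m') + a * (b + b')" "m + m' \<in> M"
        using M(1) by (auto simp: F_def is_ideal_def algebra_simps)
      then show "x + y \<in> {m + a * b | m b. m \<in> M}" by blast
    next
      fix c y assume "y \<in> {m + a * b | m b. m \<in> M}"
      then obtain m b where "y = m + a * b" "m \<in> M" by blast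
      then have "c * y = c * m + a * (c * b)" "c * m \<in> M"
        using M(1) by (auto simp: F_def is_ideal_def algebra_simps)
      then show "c * y \<in> {m + a * b | m b. m \<in> M}" by blast
    qed
    moreover have MJ: "M \<subseteq> J"
    proof
      fix m assume "m \<in> M"
      moreover have "m = m + a * 0" by simp
      ultimately show "m \<in> J" unfolding J_def by blast
    qed
    moreover have "a \<in> J"
    proof -
      have "a = 0 + a * 1" "0 \<in> M" using M(1) by (auto simp: F_def is_ideal_def)
      then show ?thesis unfolding J_def by blast
    qed
    ultimately have "1 \<in> J" using M a by (auto simp: F_def)
    then obtain m b where mb: "1 = m + a * b" "m \<in> M" by (auto simp: J_def)
    then have "a * b - 1 = (- 1) * m" by (simp add: algebra_simps)
    moreover have "(- 1) * m \<in> M" using M(1) mb(2) unfolding F_def is_ideal_def by blast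
    ultimately show ?thesis by metis
  qed
  with M show ?thesis using that by (auto simp: F_def)
qed

text \<open>The multiples of p form a proper ideal because 1/p is not an algebraic integer, so some
  maximal ideal contains p.\<close>

lemma ex_residually_closed:
  assumes "p > (1::int)"
  obtains M :: "algint set" where "residually_closed M" "of_int p \<in> M"
proof -
  have "is_ideal (range (\<lambda>x. of_int p * x :: algint))"
    unfolding is_ideal_def
  proof (intro conjI ballI allI)
    show "0 \<in> range (\<lambda>x. of_int p * x :: algint)" by (rule range_eqI[of _ _ 0]) simp
    fix a b :: algint
    assume b: "b \<in> range (\<lambda>x. of_int p * x)"
    then obtain x where x: "b = of_int p * x" by blast
    have "a * b = of_int p * (a * x)" unfolding x by (rule mult.left_commute)
    then show "a * b \<in> range (\<lambda>x. of_int p * x)" by blast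
    assume "a \<in> range (\<lambda>x. of_int p * x)"
    then obtain y where "a = of_int p * y" by blast
    then have "a + b = of_int p * (y + x)" using x by (simp only: distrib_left)
    then show "a + b \<in> range (\<lambda>x. of_int p * x)" by blast
  qed
  moreover have "(1 :: algint) \<notin> range (\<lambda>x. of_int p * x)"
  proof
    assume "(1 :: algint) \<in> range (\<lambda>x. of_int p * x)"
    then obtain x :: algint where "1 = of_int p * x" by blast
    then have "of_int p * Rep_algint x = 1"
      by (metis Rep_algint_of_int one_algint.rep_eq times_algint.rep_eq)
    moreover obtain S where "finite_order S" "Rep_algint x \<in> S" using Rep_algint[of x] by auto
    ultimately show False using finite_order_not_inverse assms by blast
  qed
  ultimately obtain M :: "algint set" where M: "is_ideal M" "range (\<lambda>x. of_int p * x) \<subseteq> M"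
    "1 \<notin> M" "\<And>a. a \<notin> M \<Longrightarrow> \<exists>b. a * b - 1 \<in> M"
    using ex_maximal_ideal[of "range (\<lambda>x. of_int p * x :: algint)"] by metis
  have "residually_closed M"
  proof
    show "0 \<in> M" "\<And>a b. a \<in> M \<Longrightarrow> b \<in> M \<Longrightarrow> a + b \<in> M" "\<And>a b. b \<in> M \<Longrightarrow> a * b \<in> M"
      using M(1) unfolding is_ideal_def by blast+
  qed (rule M(3), erule M(4), erule (1) algint_ex_root)
  moreover have "of_int p \<in> M" using M(2) by (metis mult.right_neutral rangeI subset_iff)
  ultimately show ?thesis using that by blast
qed

section \<open>Dependence of sentences on the characteristic\<close>

lemma finite_set_trm [simp]: "finite (set_trm t)"
  by (induction t) auto

lemma finite_set_form [simp]: "finite (set_form f)"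
  by (induction f) auto

lemma tval_closed: "set_trm t = {} \<Longrightarrow> tval e t = of_int (tval (\<lambda>_. 0) t)"
  by (induction t) auto

lemma holds_closed:
  "set_form f = {} \<Longrightarrow> holds M e f \<longleftrightarrow> holds {n. of_int n \<in> M} (\<lambda>_. 0) f"
proof (induction f)
  case (Zero t)
  then show ?case using tval_closed[of t e] by simp
qed auto

text \<open>Under a fixed assignment a formula tests only finitely many integers. If I contains 0
  but none of the nonzero ones among them, it answers every test as {0} does. This allows
  characteristic 0 to be replaced by a large prime.\<close>

lemma holds_avoiding:
  "\<exists>N. finite N \<and> 0 \<notin> N \<and> (\<forall>I :: int set. 0 \<in> I \<and> I \<inter> N = {} \<longrightarrow> holds I e f = holds {0} e f)"
proof (induction f)
  case (Zero t)
  show ?case by (rule exI[of _ "{tval e t} - {0}"]) auto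
next
  case (Conj f g)
  obtain N where N: "finite N" "0 \<notin> N"
    "\<And>I. 0 \<in> I \<Longrightarrow> I \<inter> N = {} \<Longrightarrow> holds I e f = holds {0} e f" using Conj.IH(1) by blast
  obtain N' where N': "finite N'" "0 \<notin> N'"
    "\<And>I. 0 \<in> I \<Longrightarrow> I \<inter> N' = {} \<Longrightarrow> holds I e g = holds {0} e g" using Conj.IH(2) by blast
  have "holds I e (Conj f g) = holds {0} e (Conj f g)" if "0 \<in> I" "I \<inter> (N \<union> N') = {}" for I
    using N(3)[of I] N'(3)[of I] that by (simp add: Int_Un_distrib)
  then show ?case using N(1,2) N'(1,2) by (metis Un_iff finite_UnI)
next
  case (Neg f)
  then show ?case unfolding holds.simps by metis
qed

lemma residually_closed_0: "residually_closed {0 :: 'k::alg_closed_field}"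
proof
  fix a :: 'k assume "a \<notin> {0}"
  then show "\<exists>b. a * b - 1 \<in> {0}" by (intro exI[of _ "inverse a"]) simp
next
  fix p :: "'k poly" assume "degree p > 0"
  then show "\<exists>a. poly p a = 0" by (rule alg_closed_imp_poly_has_root)
qed simp_all

lemma (in residually_closed) of_int_mem_iff:
  assumes "prime p" "of_int p \<in> M"
  shows "of_int n \<in> M \<longleftrightarrow> p dvd n"
proof
  assume n: "of_int n \<in> M"
  show "p dvd n"
  proof (rule ccontr)
    assume "\<not> p dvd n"
    then have "coprime p n" using assms(1) prime_imp_coprime by blast
    then obtain a b where "a * p + b * n = 1" by (metis bezout_int coprime_imp_gcd_eq_1)
    then have "(of_int a * of_int p + of_int b * of_int n :: 'r) = 1"
      by (metis of_int_1 of_int_add of_int_mult)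
    then show False using n assms(2) add_mem mult_mem one_notin by metis
  qed
qed (use assms in \<open>auto simp: mult_mem'\<close>)

text \<open>The elements of K occurring in f are variables \<open>Inl\<close>, true to themselves
  under \<open>id\<close>. Forgetting their values and asserting that some values work yields a
  sentence without parameters, decided by which integers vanish. Witnesses modulo M give the new
  interpretation c of these constants.\<close>

theorem transfer_to_residue_field:
  fixes f :: "('k::alg_closed_field + 'v) form"
  assumes K: "\<And>v. holds {0} (case_sum id v) f"
  obtains M :: "algint set" and p :: int and c where "residually_closed M" "prime p" "of_int p \<in> M"
    "\<And>v. holds M (case_sum c v) f"
proof -
  obtain xs ys where xs: "set xs = set_form f \<inter> range Inr" and ys: "set ys = set_form f \<inter> range Inl"
    by (metis finite_Int finite_list finite_set_form)
  \<comment> \<open>This is the eliminated form of: some values of the \<open>Inl\<close> variables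
    make f true for all values of the \<open>Inr\<close> variables.\<close>
  define \<tau> where "\<tau> = foldr elim ys (Neg (foldr elim xs (Neg f)))"
  have "set_form \<tau> \<subseteq> set_form f - set xs - set ys"
    using set_elims[of ys "Neg (foldr elim xs (Neg f))"] set_elims[of xs "Neg f"] by (auto simp: \<tau>_def)
  moreover have "x \<in> range Inl \<union> range Inr" for x :: "'k + 'v" by (cases x) auto
  ultimately have closed: "set_form \<tau> = {}" using xs ys by blast
  have tau: "holds M e \<tau> \<longleftrightarrow> (\<exists>e'. (\<forall>x. x \<notin> set ys \<longrightarrow> e' x = e x) \<and>
      (\<forall>e''. (\<forall>x. x \<notin> set xs \<longrightarrow> e'' x = e' x) \<longrightarrow> holds M e'' f))"
    if "residually_closed M" for e and M :: "'r::comm_ring_1 set"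
    unfolding \<tau>_def by (simp only: holds.simps residually_closed.holds_elims[OF that]) blast
  have "holds {0 :: 'k} (case_sum id (\<lambda>_. 0)) \<tau>"
    unfolding tau[OF residually_closed_0]
  proof (intro exI[of _ "case_sum id (\<lambda>_. 0)"] conjI allI impI)
    fix e'' assume "\<forall>x. x \<notin> set xs \<longrightarrow> e'' x = case_sum id (\<lambda>_. 0) x"
    then have "holds {0} e'' f \<longleftrightarrow> holds {0} (case_sum id (e'' \<circ> Inr)) f"
      using xs by (intro holds_cong) (auto split: sum.split)
    then show "holds {0} e'' f" using K by simp
  qed auto
  then have K': "holds {n. of_int n = (0 :: 'k)} (\<lambda>_. 0) \<tau>"
    using holds_closed[OF closed, of "{0 :: 'k}"] by simp
  obtain p :: int where p: "prime p" "holds {n. p dvd n} (\<lambda>_. 0) \<tau>"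
  proof (cases "CHAR('k) = 0")
    case True
    obtain N :: "int set" where N: "finite N" "0 \<notin> N"
      "\<forall>I. 0 \<in> I \<and> I \<inter> N = {} \<longrightarrow> holds I (\<lambda>_. 0) \<tau> = holds {0 :: int} (\<lambda>_. 0) \<tau>"
      using holds_avoiding[of "\<lambda>_. 0" \<tau>] by blast
    \<comment> \<open>A prime exceeding the absolute value of each member of N divides none of them,
      as they are nonzero. The inserted 0 covers an empty N.\<close>
    obtain q where q: "prime q" "q > Max (insert 0 ((nat \<circ> abs) ` N))" using bigger_prime by blast
    have "\<not> int q dvd n" if "n \<in> N" for n
    proof
      assume "int q dvd n"
      then have "int q \<le> \<bar>n\<bar>" using that N(2) dvd_imp_le_int[of n "int q"] by fastforce
      moreover have "nat \<bar>n\<bar> \<le> Max (insert 0 ((nat \<circ> abs) ` N))" using that N(1) by (intro Max_ge) auto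
      ultimately show False using q(2) by linarith
    qed
    then have "holds {n. int q dvd n} (\<lambda>_. 0) \<tau> = holds {0 :: int} (\<lambda>_. 0) \<tau>"
      by (intro N(3)[rule_format]) auto
    moreover have "{n. of_int n = (0 :: 'k)} = {0}"
      using True by (auto simp: of_int_eq_0_iff_char_dvd)
    ultimately have "holds {n. int q dvd n} (\<lambda>_. 0) \<tau>" using K' by metis
    then show ?thesis using that[of "int q"] q(1) by simp
  next
    case False
    then have "prime CHAR('k)" using prime_CHAR_semidom by blast
    then show ?thesis using that[of "int CHAR('k)"] K' by (simp add: of_int_eq_0_iff_char_dvd)
  qed
  then have "p > 1" using prime_gt_1_int by blast
  then obtain M :: "algint set" where M: "residually_closed M" "of_int p \<in> M"
    using ex_residually_closed by blast
  have "holds M (\<lambda>_. 0) \<tau>"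
    using p(2) holds_closed[OF closed, of M] residually_closed.of_int_mem_iff[OF M(1) p(1) M(2)] by simp
  then obtain e' where e': "\<And>e''. (\<forall>x. x \<notin> set xs \<longrightarrow> e'' x = e' x) \<Longrightarrow> holds M e'' f"
    using tau[OF M(1)] by blast
  have "holds M (case_sum (e' \<circ> Inl) v) f" for v
  proof -
    define e'' where "e'' x = (if x \<in> set xs then case_sum (e' \<circ> Inl) v x else e' x)" for x
    have "holds M e'' f" by (rule e') (simp add: e''_def)
    moreover have "holds M e'' f = holds M (case_sum (e' \<circ> Inl) v) f"
      using xs by (intro holds_cong) (auto simp: e''_def split: sum.split)
    ultimately show ?thesis by simp
  qed
  with M p(1) show ?thesis using that by blast
qed

section \<open>Noetherianity\<close>

inductive_set gen_ideal :: "'a::comm_ring_1 set \<Rightarrow> 'a set \<Rightarrow> 'a set" for A Q where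
  zero: "0 \<in> gen_ideal A Q"
| step: "a \<in> A \<Longrightarrow> q \<in> Q \<Longrightarrow> x \<in> gen_ideal A Q \<Longrightarrow> a * q + x \<in> gen_ideal A Q"

definition subring_of :: "'a::comm_ring_1 set \<Rightarrow> bool" where
  "subring_of A \<longleftrightarrow> 0 \<in> A \<and> 1 \<in> A \<and> (\<forall>x\<in>A. - x \<in> A) \<and>
     (\<forall>x\<in>A. \<forall>y\<in>A. x + y \<in> A) \<and> (\<forall>x\<in>A. \<forall>y\<in>A. x * y \<in> A)"

text \<open>Phrased for a subset of an ambient ring because polynomial functions are a subset of all
  functions. The finite set is chosen inside the given P, which is the form that yields finite
  subcovers.\<close>

definition noetherian :: "'a::comm_ring_1 set \<Rightarrow> bool" where
  "noetherian A \<longleftrightarrow> (\<forall>P\<subseteq>A. \<exists>F\<subseteq>P. finite F \<and> P \<subseteq> gen_ideal A F)"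

lemma subring_ofD:
  assumes "subring_of A"
  shows "0 \<in> A" "1 \<in> A" "x \<in> A \<Longrightarrow> - x \<in> A" "x \<in> A \<Longrightarrow> y \<in> A \<Longrightarrow> x + y \<in> A"
    "x \<in> A \<Longrightarrow> y \<in> A \<Longrightarrow> x * y \<in> A"
  using assms by (auto simp: subring_of_def)

lemma subring_of_sum: "subring_of A \<Longrightarrow> (\<And>i. i \<in> I \<Longrightarrow> f i \<in> A) \<Longrightarrow> sum f I \<in> A"
  by (induction I rule: infinite_finite_induct) (auto intro: subring_ofD)

lemma gen_ideal_mono: "x \<in> gen_ideal A Q \<Longrightarrow> Q \<subseteq> Q' \<Longrightarrow> x \<in> gen_ideal A Q'"
  by (induction rule: gen_ideal.induct) (auto intro: gen_ideal.intros)

lemma gen_ideal_add: "x \<in> gen_ideal A Q \<Longrightarrow> y \<in> gen_ideal A Q \<Longrightarrow> x + y \<in> gen_ideal A Q"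
  by (induction rule: gen_ideal.induct) (auto intro: gen_ideal.intros simp: add.assoc)

lemma gen_ideal_mult:
  assumes "subring_of A" "b \<in> A" "x \<in> gen_ideal A Q"
  shows "b * x \<in> gen_ideal A Q"
  using assms(3)
proof (induction rule: gen_ideal.induct)
  case (step a q x)
  have "(b * a) * q + b * x \<in> gen_ideal A Q"
    using step assms(1,2) by (intro gen_ideal.step) (auto intro: subring_ofD)
  then show ?case by (simp add: algebra_simps)
qed (simp add: gen_ideal.zero)

lemma gen_ideal_diff:
  assumes "subring_of A" "x \<in> gen_ideal A Q" "y \<in> gen_ideal A Q"
  shows "x - y \<in> gen_ideal A Q"
proof -
  have "- 1 \<in> A" using assms(1) by (auto intro: subring_ofD)
  from gen_ideal_add[OF assms(2) gen_ideal_mult[OF assms(1) this assms(3)]] show ?thesis by simp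
qed

lemma gen_ideal_base: "subring_of A \<Longrightarrow> q \<in> Q \<Longrightarrow> q \<in> gen_ideal A Q"
  using gen_ideal.step[of 1 A q Q 0] subring_ofD(2) gen_ideal.zero by fastforce

lemma gen_ideal_trans:
  assumes "subring_of A" "x \<in> gen_ideal A Q'" "Q' \<subseteq> gen_ideal A Q"
  shows "x \<in> gen_ideal A Q"
  using assms(2)
proof (induction rule: gen_ideal.induct)
  case (step a q x)
  then show ?case using assms gen_ideal_add gen_ideal_mult by (metis subsetD)
qed (rule gen_ideal.zero)

lemma gen_ideal_finite:
  "x \<in> gen_ideal A Q \<Longrightarrow> \<exists>F. finite F \<and> F \<subseteq> Q \<and> x \<in> gen_ideal A F"
proof (induction rule: gen_ideal.induct)
  case zero
  then show ?case using gen_ideal.zero by blast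
next
  case (step a q x)
  then obtain F where F: "finite F" "F \<subseteq> Q" "x \<in> gen_ideal A F" by blast
  have "a * q + x \<in> gen_ideal A (insert q F)"
    using step(1) gen_ideal_mono[OF F(3)] by (intro gen_ideal.step) auto
  then show ?case using F step(2) by (metis finite_insert insert_subset)
qed

definition poly_ring :: "'a::comm_ring_1 set \<Rightarrow> 'a poly set" where
  "poly_ring A = {f. \<forall>i. coeff f i \<in> A}"

lemma subring_of_poly_ring:
  assumes "subring_of A"
  shows "subring_of (poly_ring A)"
proof -
  have "coeff (f * g) i \<in> A" if "\<forall>i. coeff f i \<in> A" "\<forall>i. coeff g i \<in> A" for f g i
    unfolding coeff_mult using that by (intro subring_of_sum[OF assms] subring_ofD(5)[OF assms]) auto
  then show ?thesis using assms subring_ofD[OF assms]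
    by (simp add: subring_of_def poly_ring_def coeff_1)
qed

lemma monom_poly_ring: "0 \<in> A \<Longrightarrow> b \<in> A \<Longrightarrow> monom b n \<in> poly_ring A"
  by (simp add: poly_ring_def)

text \<open>Otherwise one can keep choosing elements \<open>g n\<close> of least degree outside the
  ideal of the earlier ones. Their leading coefficients generate a finitely generated ideal of A, so
  one of them is a combination of earlier ones, and cancelling it contradicts minimality.\<close>

theorem hilbert_basis:
  fixes A :: "'a::comm_ring_1 set"
  assumes A: "subring_of A" and N: "noetherian A"
  shows "noetherian (poly_ring A)"
  unfolding noetherian_def
proof (intro allI impI, rule ccontr)
  let ?X = "poly_ring A"
  note X = subring_of_poly_ring[OF A]
  fix P assume P: "P \<subseteq> ?X" and neg: "\<not> (\<exists>F\<subseteq>P. finite F \<and> P \<subseteq> gen_ideal ?X F)"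
  define I where "I = gen_ideal ?X P"
  have IX: "f \<in> ?X" if "f \<in> I" for f
    using that unfolding I_def
    by (induction rule: gen_ideal.induct) (use P X in \<open>auto intro!: subring_ofD(1,4,5)[OF X]\<close>)
  have ne: "\<exists>f. f \<in> I - gen_ideal ?X F" if F: "finite F" "F \<subseteq> I" for F
  proof (rule ccontr)
    assume "\<not> ?thesis"
    then have sub: "I \<subseteq> gen_ideal ?X F" by blast
    have "\<forall>f\<in>F. \<exists>G. finite G \<and> G \<subseteq> P \<and> f \<in> gen_ideal ?X G"
      using F gen_ideal_finite unfolding I_def by blast
    then obtain G where G: "\<And>f. f \<in> F \<Longrightarrow> finite (G f) \<and> G f \<subseteq> P \<and> f \<in> gen_ideal ?X (G f)" by metis
    define H where "H = (\<Union>f\<in>F. G f)"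
    have "F \<subseteq> gen_ideal ?X H"
    proof
      fix f assume "f \<in> F"
      then show "f \<in> gen_ideal ?X H" using G[of f] gen_ideal_mono[of f ?X "G f" H] by (auto simp: H_def)
    qed
    then have "P \<subseteq> gen_ideal ?X H"
      using sub gen_ideal_trans[OF X] gen_ideal_base[OF X, of _ P] unfolding I_def by blast
    moreover have "finite H" "H \<subseteq> P" using G F(1) by (auto simp: H_def)
    ultimately show False using neg by blast
  qed
  define S where "S f n = I - gen_ideal ?X (f ` {..<n})" for f :: "nat \<Rightarrow> 'a poly" and n :: nat
  have "\<exists>g. \<forall>n. g n \<in> S g n \<and> (\<forall>s\<in>S g n. degree (g n) \<le> degree s)"
  proof (rule dependent_wellorder_choice)
    fix r :: "'a poly" and f g :: "nat \<Rightarrow> 'a poly" and n assume "\<And>m. m < n \<Longrightarrow> f m = g m"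
    then have "f ` {..<n} = g ` {..<n}" by auto
    then show "(r \<in> S f n \<and> (\<forall>s\<in>S f n. degree r \<le> degree s)) =
        (r \<in> S g n \<and> (\<forall>s\<in>S g n. degree r \<le> degree s))" by (simp add: S_def)
  next
    fix n and f :: "nat \<Rightarrow> 'a poly"
    assume "\<And>m. m < n \<Longrightarrow> f m \<in> S f m \<and> (\<forall>s\<in>S f m. degree (f m) \<le> degree s)"
    then have "f ` {..<n} \<subseteq> I" by (auto simp: S_def)
    then obtain s where "s \<in> S f n" using ne[of "f ` {..<n}"] by (auto simp: S_def)
    then show "\<exists>r. r \<in> S f n \<and> (\<forall>s\<in>S f n. degree r \<le> degree s)"
      using ex_has_least_nat[of "\<lambda>r. r \<in> S f n" s degree] by blast
  qed
  then obtain g where g: "\<And>n. g n \<in> S g n" "\<And>n s. s \<in> S g n \<Longrightarrow> degree (g n) \<le> degree s" by blast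
  define a where "a n = lead_coeff (g n)" for n
  have "range a \<subseteq> A" using g(1) IX by (auto simp: a_def S_def poly_ring_def)
  then obtain F where F: "F \<subseteq> range a" "finite F" "range a \<subseteq> gen_ideal A F"
    using N unfolding noetherian_def by meson
  obtain C where C: "finite C" "F = a ` C" using finite_subset_image[OF F(2,1)] by blast
  obtain n where n: "C \<subseteq> {..<n}" using C(1) by (meson finite_nat_iff_bounded)
  define d where "d = degree (g n)"
  have deg: "degree (g i) \<le> d" if "i < n" for i
  proof -
    have "g ` {..<i} \<subseteq> g ` {..<n}" using that by auto
    then have "g n \<in> S g i" using g(1)[of n] gen_ideal_mono unfolding S_def by blast
    then show ?thesis using g(2) by (simp add: d_def)
  qed
  \<comment> \<open>A combination of earlier leading coefficients is realised at the single degree d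
    by shifting each \<open>g i\<close> with a monomial; no earlier degree exceeds d.\<close>
  have lift: "\<exists>h \<in> gen_ideal ?X (g ` {..<n}). degree h \<le> d \<and> coeff h d = x"
    if "x \<in> gen_ideal A (a ` {..<n})" for x
    using that
  proof (induction rule: gen_ideal.induct)
    case zero
    then show ?case by (intro bexI[of _ 0]) (auto simp: gen_ideal.zero)
  next
    case (step b q x)
    then obtain h i where h: "h \<in> gen_ideal ?X (g ` {..<n})" "degree h \<le> d" "coeff h d = x"
      and i: "i < n" "q = a i" by blast
    define h' where "h' = monom b (d - degree (g i)) * g i + h"
    have "h' \<in> gen_ideal ?X (g ` {..<n})" unfolding h'_def
      using h i step(1) A by (intro gen_ideal.step monom_poly_ring) (auto intro: subring_ofD)
    moreover have "degree (monom b (d - degree (g i)) * g i) \<le> d"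
      using degree_mult_le[of "monom b (d - degree (g i))" "g i"] degree_monom_le[of b "d - degree (g i)"]
        deg[OF i(1)] by linarith
    then have "degree h' \<le> d" unfolding h'_def using h(2) by (rule degree_add_le)
    moreover have "coeff h' d = b * q + x"
      using deg[OF i(1)] h(3) i(2) by (simp add: h'_def coeff_monom_mult a_def)
    ultimately show ?case by blast
  qed
  have "a n \<in> gen_ideal A (a ` {..<n})"
    using F(3) n gen_ideal_mono[of "a n" A F "a ` {..<n}"] unfolding C(2) by blast
  then obtain h where h: "h \<in> gen_ideal ?X (g ` {..<n})" "degree h \<le> d" "coeff h d = a n"
    using lift by blast
  \<comment> \<open>r lies outside the ideal of the earlier elements, so minimality gives it degree
    at least d. Its degree is at most d and its coefficient at d cancels, so r = 0, which lies in
    every ideal.\<close>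
  define r where "r = g n - h"
  have "g i \<in> I" for i using g(1)[of i] by (simp add: S_def)
  then have "h \<in> I" "g n \<in> I" using h(1) gen_ideal_trans[OF X, of h "g ` {..<n}" P] unfolding I_def by blast+
  then have "r \<in> I" unfolding r_def I_def using gen_ideal_diff[OF X] by blast
  moreover have rn: "r \<notin> gen_ideal ?X (g ` {..<n})"
  proof
    assume "r \<in> gen_ideal ?X (g ` {..<n})"
    from gen_ideal_add[OF this h(1)] show False using g(1)[of n] by (simp add: r_def S_def)
  qed
  ultimately have "d \<le> degree r" using g(2)[of r n] by (simp add: S_def d_def)
  moreover have "degree r \<le> d" unfolding r_def using h(2) by (intro degree_diff_le) (auto simp: d_def)
  moreover have "coeff r d = 0" using h(3) by (simp add: r_def a_def d_def)
  ultimately have "r = 0" by (metis antisym leading_coeff_0_iff)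
  then show False using rn gen_ideal.zero by blast
qed

text \<open>A[x] is the image of the polynomial ring under evaluation at x, and finite generating
  sets can be pushed forward from preimages.\<close>

lemma noetherian_adjoin:
  fixes A :: "'a::comm_ring_1 set"
  assumes "subring_of A" "noetherian A"
  shows "noetherian ((\<lambda>f. poly f x) ` poly_ring A)"
  unfolding noetherian_def
proof (intro allI impI)
  let ?e = "\<lambda>f. poly f x"
  fix P assume P: "P \<subseteq> ?e ` poly_ring A"
  define P' where "P' = {f \<in> poly_ring A. ?e f \<in> P}"
  have "\<exists>F\<subseteq>P'. finite F \<and> P' \<subseteq> gen_ideal (poly_ring A) F"
    using hilbert_basis[OF assms] unfolding noetherian_def by (auto simp: P'_def)
  then obtain F where F: "F \<subseteq> P'" "finite F" "P' \<subseteq> gen_ideal (poly_ring A) F" by blast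
  have e: "?e f \<in> gen_ideal (?e ` poly_ring A) (?e ` F)" if "f \<in> gen_ideal (poly_ring A) F" for f
    using that by (induction rule: gen_ideal.induct) (auto intro: gen_ideal.intros)
  have "P \<subseteq> gen_ideal (?e ` poly_ring A) (?e ` F)"
  proof
    fix p assume "p \<in> P"
    then obtain f where "f \<in> P'" "p = ?e f" using P by (auto simp: P'_def)
    then show "p \<in> gen_ideal (?e ` poly_ring A) (?e ` F)" using e F(3) by blast
  qed
  moreover have "?e ` F \<subseteq> P" using F(1) by (auto simp: P'_def)
  ultimately show "\<exists>F\<subseteq>P. finite F \<and> P \<subseteq> gen_ideal (?e ` poly_ring A) F" using F(2) by blast
qed

section \<open>Polynomial functions and their zero loci\<close>

lemma subring_of_poly_funs: "subring_of (poly_funs n :: ('k::comm_ring_1 list \<Rightarrow> 'k) set)"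
proof -
  have "- f \<in> poly_funs n" if "f \<in> poly_funs n" for f :: "'k list \<Rightarrow> 'k"
    using poly_funs.mult[OF poly_funs.const[of "- 1"] that] by (simp add: fun_Compl_def)
  then show ?thesis
    by (auto simp: subring_of_def zero_fun_def one_fun_def plus_fun_def times_fun_def
        intro: poly_funs.intros)
qed

lemma poly_funs_Suc_mono: "p \<in> poly_funs n \<Longrightarrow> p \<in> poly_funs (Suc n)"
  by (induction rule: poly_funs.induct) (auto intro: poly_funs.intros)

text \<open>Passing from n to n + 1 coordinates adjoins one function, the new coordinate; this
  reduces Noetherianity to one-variable polynomials.\<close>

lemma poly_funs_Suc:
  "(poly_funs (Suc n) :: ('k::comm_ring_1 list \<Rightarrow> 'k) set)
    = (\<lambda>f. poly f (\<lambda>v. v ! n)) ` poly_ring (poly_funs n)"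
proof (intro equalityI subsetI)
  let ?A = "poly_funs n :: ('k list \<Rightarrow> 'k) set"
  note A = subring_of_poly_funs[of n, where ?'k = 'k]
  note X = subring_of_poly_ring[OF A]
  have const: "[:f:] \<in> poly_ring ?A" if "f \<in> ?A" for f
    using that subring_ofD(1)[OF A] by (simp add: poly_ring_def coeff_pCons split: nat.split)
  fix p :: "'k list \<Rightarrow> 'k" assume "p \<in> poly_funs (Suc n)"
  then have "\<exists>f \<in> poly_ring ?A. p = poly f (\<lambda>v. v ! n)"
  proof induction
    case (const c)
    then show ?case by (intro bexI[of _ "[:\<lambda>v. c:]"] \<open>\<And>f. f \<in> ?A \<Longrightarrow> [:f:] \<in> poly_ring ?A\<close>)
        (auto intro: poly_funs.const)
  next
    case (coord i)
    show ?case
    proof (cases "i = n")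
      case True
      have "[:0, 1:] \<in> poly_ring ?A" using subring_ofD(1,2)[OF A]
        by (simp add: poly_ring_def coeff_pCons split: nat.split)
      then show ?thesis using True by (intro bexI[of _ "[:0, 1:]"]) auto
    next
      case False
      then have "(\<lambda>v. v ! i) \<in> ?A" using coord by (intro poly_funs.coord) auto
      from const[OF this] show ?thesis by (intro bexI[of _ "[:\<lambda>v. v ! i:]"]) auto
    qed
  next
    case (add p q)
    then obtain f g where "f \<in> poly_ring ?A" "g \<in> poly_ring ?A" "p = poly f (\<lambda>v. v ! n)"
      "q = poly g (\<lambda>v. v ! n)" by blast
    then show ?case using subring_ofD(4)[OF X, of f g]
      by (intro bexI[of _ "f + g"]) (auto simp: plus_fun_def)
  next
    case (mult p q)
    then obtain f g where "f \<in> poly_ring ?A" "g \<in> poly_ring ?A" "p = poly f (\<lambda>v. v ! n)"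
      "q = poly g (\<lambda>v. v ! n)" by blast
    then show ?case using subring_ofD(5)[OF X, of f g]
      by (intro bexI[of _ "f * g"]) (auto simp: times_fun_def)
  qed
  then show "p \<in> (\<lambda>f. poly f (\<lambda>v. v ! n)) ` poly_ring ?A" by blast
next
  fix p :: "'k list \<Rightarrow> 'k" assume "p \<in> (\<lambda>f. poly f (\<lambda>v. v ! n)) ` poly_ring (poly_funs n)"
  then obtain f where f: "f \<in> poly_ring (poly_funs n)" "p = poly f (\<lambda>v. v ! n)" by blast
  note B = subring_of_poly_funs[of "Suc n", where ?'k = 'k]
  have x: "(\<lambda>v. v ! n) \<in> (poly_funs (Suc n) :: ('k list \<Rightarrow> 'k) set)" by (intro poly_funs.coord) simp
  have "(\<lambda>v. v ! n) ^ i \<in> (poly_funs (Suc n) :: ('k list \<Rightarrow> 'k) set)" for i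
    by (induction i) (simp_all only: power_0 power_Suc subring_ofD(2)[OF B] subring_ofD(5)[OF B] x)
  then show "p \<in> poly_funs (Suc n)"
    unfolding f(2) poly_altdef using f(1) poly_funs_Suc_mono
    by (intro subring_of_sum[OF B] subring_ofD(5)[OF B]) (auto simp: poly_ring_def)
qed

lemma noetherian_poly_funs: "noetherian (poly_funs n :: ('k::field list \<Rightarrow> 'k) set)"
proof (induction n)
  case 0
  let ?A = "poly_funs 0 :: ('k list \<Rightarrow> 'k) set"
  have const: "\<exists>c. p = (\<lambda>_. c)" if "p \<in> ?A" for p
    using that by (induction rule: poly_funs.induct) auto
  show ?case unfolding noetherian_def
  proof (intro allI impI)
    fix P assume P: "P \<subseteq> ?A"
    show "\<exists>F\<subseteq>P. finite F \<and> P \<subseteq> gen_ideal ?A F"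
    proof (cases "P \<subseteq> {0}")
      case True
      then show ?thesis using gen_ideal.zero by (intro exI[of _ "{}"]) auto
    next
      case False
      then obtain p where p: "p \<in> P" "p \<noteq> 0" by blast
      then obtain c where c: "p = (\<lambda>_. c)" using const P by blast
      then have c0: "c \<noteq> 0" using p(2) by (auto simp: zero_fun_def)
      have "q \<in> gen_ideal ?A {p}" if q: "q \<in> P" for q
      proof -
        obtain b where b: "q = (\<lambda>_. b)" using const P q by blast
        have "(\<lambda>_. b / c) * p + 0 \<in> gen_ideal ?A {p}"
          by (intro gen_ideal.step gen_ideal.zero poly_funs.const) simp
        then show ?thesis using c0 by (simp add: b c times_fun_def)
      qed
      then show ?thesis using p(1) by (intro exI[of _ "{p}"]) auto
    qed
  qed
next
  case (Suc n)
  then show ?case unfolding poly_funs_Suc by (intro noetherian_adjoin subring_of_poly_funs)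
qed

lemma finite_zero_locus:
  fixes P :: "('k::field list \<Rightarrow> 'k) set"
  assumes "P \<subseteq> poly_funs n"
  obtains F where "finite F" "F \<subseteq> P" "\<And>v p. (\<forall>f\<in>F. f v = 0) \<Longrightarrow> p \<in> P \<Longrightarrow> p v = 0"
proof -
  obtain F where F: "F \<subseteq> P" "finite F" "P \<subseteq> gen_ideal (poly_funs n) F"
    using noetherian_poly_funs assms unfolding noetherian_def by meson
  have "p v = 0" if "\<forall>f\<in>F. f v = 0" "p \<in> gen_ideal (poly_funs n) F" for v p
    using that(2) by (induction rule: gen_ideal.induct) (use that(1) in auto)
  with F show ?thesis by (intro that[of F]) auto
qed

lemma zariski_closed_finite:
  assumes "zariski_closed n (Z :: 'k::field list set)"
  obtains F where "finite F" "F \<subseteq> poly_funs n" "Z = {v. length v = n \<and> (\<forall>p\<in>F. p v = 0)}"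
proof -
  obtain P where P: "P \<subseteq> poly_funs n" "Z = {v. length v = n \<and> (\<forall>p\<in>P. p v = 0)}"
    using assms by (auto simp: zariski_closed_def)
  obtain F where "finite F" "F \<subseteq> P" "\<And>v p. (\<forall>f\<in>F. f v = 0) \<Longrightarrow> p \<in> P \<Longrightarrow> p v = 0"
    using finite_zero_locus[OF P(1)] by metis
  then show ?thesis using P by (intro that[of F]) auto
qed

text \<open>Quasi-compactness: a regular function needs only finitely many quotients of polynomials.\<close>

lemma regular_on_finite:
  fixes f :: "'k::field list \<Rightarrow> 'k"
  assumes f: "regular_on n S f" and S: "\<And>v. v \<in> S \<Longrightarrow> length v = n"
  obtains T where "finite T" "T \<subseteq> poly_funs n \<times> poly_funs n \<times> poly_funs n"
    "\<And>v. v \<in> S \<Longrightarrow> \<exists>(h, p, q)\<in>T. h v \<noteq> 0"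
    "\<And>h p q v. (h, p, q) \<in> T \<Longrightarrow> v \<in> S \<Longrightarrow> h v \<noteq> 0 \<Longrightarrow> q v \<noteq> 0 \<and> f v = p v / q v"
proof -
  \<comment> \<open>A triple says that f equals p / q on the part of S where h does not vanish.
    Finitely many of these h have the same common zeros as all of them, hence still cover S.\<close>
  define T where "T = {(h, p, q). h \<in> poly_funs n \<and> p \<in> poly_funs n \<and> q \<in> poly_funs n \<and>
    (\<forall>v\<in>S. h v \<noteq> 0 \<longrightarrow> q v \<noteq> 0 \<and> f v = p v / q v)}"
  have cover: "\<exists>h\<in>fst ` T. h v \<noteq> 0" if v: "v \<in> S" for v
  proof -
    obtain U p q where U: "zariski_open_in n S U" "v \<in> U" "p \<in> poly_funs n" "q \<in> poly_funs n"
      "\<forall>u\<in>U. q u \<noteq> 0 \<and> f u = p u / q u" using f v unfolding regular_on_def by blast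
    obtain P where P: "P \<subseteq> poly_funs n" "U = S - {v. length v = n \<and> (\<forall>p\<in>P. p v = 0)}"
      using U(1) by (auto simp: zariski_open_in_def zariski_closed_def)
    obtain h where h: "h \<in> P" "h v \<noteq> 0" using U(2) P(2) S[OF v] by auto
    have "(h, p, q) \<in> T" using U P h by (auto simp: T_def)
    then show ?thesis using h(2) by force
  qed
  obtain F where F: "finite F" "F \<subseteq> fst ` T"
    "\<And>v p. (\<forall>f\<in>F. f v = 0) \<Longrightarrow> p \<in> fst ` T \<Longrightarrow> p v = 0"
  proof (rule finite_zero_locus)
    show "fst ` T \<subseteq> poly_funs n" by (auto simp: T_def)
  qed blast
  obtain T' where T': "T' \<subseteq> T" "finite T'" "F = fst ` T'" using finite_subset_image[OF F(1,2)] by blast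
  show ?thesis
  proof
    show "finite T'" "T' \<subseteq> poly_funs n \<times> poly_funs n \<times> poly_funs n" using T' by (auto simp: T_def)
    fix v assume "v \<in> S"
    then have "\<exists>h\<in>F. h v \<noteq> 0" using cover F(3) by blast
    then show "\<exists>(h, p, q)\<in>T'. h v \<noteq> 0" unfolding T'(3) by force
  next
    fix h p q v assume "(h, p, q) \<in> T'" "v \<in> S" "h v \<noteq> 0"
    then show "q v \<noteq> 0 \<and> f v = p v / q v" using T'(1) by (auto simp: T_def)
  qed
qed

section \<open>Coding algebraic groups by vectors\<close>

text \<open>Constants of K enter formulas as variables \<open>Inl\<close>, evaluated by
  \<open>id\<close>, so that the transfer can reinterpret them.\<close>

definition constructible :: "(('v \<Rightarrow> 'k::field) \<Rightarrow> bool) \<Rightarrow> bool" where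
  "constructible C \<longleftrightarrow> (\<exists>f. \<forall>e. holds {0} (case_sum id e) f \<longleftrightarrow> C e)"

lemma constructible_not: "constructible C \<Longrightarrow> constructible (\<lambda>e. \<not> C e)"
  unfolding constructible_def by (metis holds.simps(2))

lemma constructible_conj: "constructible C \<Longrightarrow> constructible C' \<Longrightarrow> constructible (\<lambda>e. C e \<and> C' e)"
  unfolding constructible_def by (metis holds.simps(3))

lemma constructible_ball:
  assumes "finite I" "\<And>i. i \<in> I \<Longrightarrow> constructible (C i)"
  shows "constructible (\<lambda>e. \<forall>i\<in>I. C i e)"
  using assms
proof (induction I)
  case empty
  show ?case unfolding constructible_def by (rule exI[of _ "Neg Falsum"]) simp
next
  case (insert i I)
  then have "constructible (\<lambda>e. C i e \<and> (\<forall>i\<in>I. C i e))" by (intro constructible_conj) auto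
  then show ?case by simp
qed

lemma constructible_bex:
  assumes "finite I" "\<And>i. i \<in> I \<Longrightarrow> constructible (C i)"
  shows "constructible (\<lambda>e. \<exists>i\<in>I. C i e)"
proof -
  have "constructible (\<lambda>e. \<not> (\<forall>i\<in>I. \<not> C i e))"
    by (intro constructible_not constructible_ball assms)
  then show ?thesis by simp
qed

lemma constructible_eq: "constructible (\<lambda>e. e v = c)"
  unfolding constructible_def
  by (rule exI[of _ "Zero (Plus (Vr (Inr v)) (Times (Cst (-1)) (Vr (Inl c))))"]) simp

lemma poly_funs_term:
  assumes "p \<in> poly_funs n"
  shows "\<exists>t. \<forall>e. tval (case_sum id e) t = p (map (e \<circ> s) [0..<n])"
  using assms
proof induction
  case (const c)
  show ?case by (rule exI[of _ "Vr (Inl c)"]) simp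
next
  case (coord i)
  then show ?case by (intro exI[of _ "Vr (Inr (s i))"]) simp
next
  case (add p q)
  then obtain t t' where "\<forall>e. tval (case_sum id e) t = p (map (e \<circ> s) [0..<n])"
    "\<forall>e. tval (case_sum id e) t' = q (map (e \<circ> s) [0..<n])" by blast
  then show ?case by (intro exI[of _ "Plus t t'"] allI) (simp only: tval.simps)
next
  case (mult p q)
  then obtain t t' where "\<forall>e. tval (case_sum id e) t = p (map (e \<circ> s) [0..<n])"
    "\<forall>e. tval (case_sum id e) t' = q (map (e \<circ> s) [0..<n])" by blast
  then show ?case by (intro exI[of _ "Times t t'"] allI) (simp only: tval.simps)
qed

lemma constructible_zero:
  assumes "p \<in> poly_funs n"
  shows "constructible (\<lambda>e. p (map (e \<circ> s) [0..<n]) = 0)"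
proof -
  obtain t where "\<forall>e. tval (case_sum id e) t = p (map (e \<circ> s) [0..<n])"
    using poly_funs_term[OF assms] by blast
  then show ?thesis unfolding constructible_def by (intro exI[of _ "Zero t"]) simp
qed

lemma constructible_closed:
  assumes "zariski_closed n Z"
  shows "constructible (\<lambda>e. map (e \<circ> s) [0..<n] \<in> Z)"
proof -
  obtain F where F: "finite F" "F \<subseteq> poly_funs n" "Z = {v. length v = n \<and> (\<forall>p\<in>F. p v = 0)}"
    by (rule zariski_closed_finite[OF assms])
  have "constructible (\<lambda>e. \<forall>p\<in>F. p (map (e \<circ> s) [0..<n]) = 0)"
    using F by (intro constructible_ball constructible_zero) auto
  then show ?thesis by (simp add: F(3))
qed

lemma constructible_open:
  assumes "zariski_open_in n V U" "constructible (\<lambda>e. map (e \<circ> s) [0..<n] \<in> V)"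
  shows "constructible (\<lambda>e. map (e \<circ> s) [0..<n] \<in> U)"
  using assms constructible_closed
  by (auto simp: zariski_open_in_def intro!: constructible_conj constructible_not)

text \<open>A triple \<open>(c, p, q)\<close> claims f = p / q on the part of C cut out by c. Pieces
  may overlap, since each of them yields f itself.\<close>

definition pieces :: "(('v \<Rightarrow> 'k::field) \<Rightarrow> bool) \<Rightarrow> (('v \<Rightarrow> 'k) \<Rightarrow> 'k) \<Rightarrow>
    (('k + 'v) form \<times> ('k + 'v) trm \<times> ('k + 'v) trm) set \<Rightarrow> bool" where
  "pieces C f T \<longleftrightarrow> finite T \<and>
     (\<forall>e. C e \<longrightarrow> (\<exists>(c, p, q)\<in>T. holds {0} (case_sum id e) c)) \<and>
     (\<forall>(c, p, q)\<in>T. \<forall>e. C e \<longrightarrow> holds {0} (case_sum id e) c \<longrightarrow>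
        tval (case_sum id e) q \<noteq> 0 \<and> f e = tval (case_sum id e) p / tval (case_sum id e) q)"

definition piecewise_rational :: "(('v \<Rightarrow> 'k::field) \<Rightarrow> bool) \<Rightarrow> (('v \<Rightarrow> 'k) \<Rightarrow> 'k) \<Rightarrow> bool" where
  "piecewise_rational C f \<longleftrightarrow> (\<exists>T. pieces C f T)"

lemma piecesD:
  assumes "pieces C f T"
  shows "finite T" "C e \<Longrightarrow> \<exists>(c, p, q)\<in>T. holds {0} (case_sum id e) c"
    "(c, p, q) \<in> T \<Longrightarrow> C e \<Longrightarrow> holds {0} (case_sum id e) c \<Longrightarrow>
       tval (case_sum id e) q \<noteq> 0 \<and> f e = tval (case_sum id e) p / tval (case_sum id e) q"
  using assms unfolding pieces_def by blast+

lemma piecewise_rational_const: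
  assumes "\<And>e. C e \<Longrightarrow> f e = c"
  shows "piecewise_rational C f"
  unfolding piecewise_rational_def pieces_def
  by (rule exI[of _ "{(Neg Falsum, Vr (Inl c), Cst 1)}"]) (simp add: assms)

lemma piecewise_rational_cases:
  assumes I: "finite I" and B: "\<And>i. i \<in> I \<Longrightarrow> constructible (B i)"
    and cover: "\<And>e. C e \<Longrightarrow> \<exists>i\<in>I. B i e"
    and f: "\<And>i. i \<in> I \<Longrightarrow> piecewise_rational (\<lambda>e. C e \<and> B i e) f"
  shows "piecewise_rational C f"
proof -
  have "\<forall>i\<in>I. \<exists>f. \<forall>e. holds {0} (case_sum id e) f \<longleftrightarrow> B i e"
    using B unfolding constructible_def by blast
  from bchoice[OF this] obtain b where
    b: "\<And>i e. i \<in> I \<Longrightarrow> holds {0} (case_sum id e) (b i) \<longleftrightarrow> B i e" by blast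
  have "\<forall>i\<in>I. \<exists>T. pieces (\<lambda>e. C e \<and> B i e) f T"
    using f unfolding piecewise_rational_def by blast
  from bchoice[OF this] obtain T where "\<forall>i\<in>I. pieces (\<lambda>e. C e \<and> B i e) f (T i)" by blast
  then have T: "i \<in> I \<Longrightarrow> pieces (\<lambda>e. C e \<and> B i e) f (T i)" for i by blast
  define T' where "T' = (\<Union>i\<in>I. (\<lambda>(c, p, q). (Conj (b i) c, p, q)) ` T i)"
  have "finite T'" using I piecesD(1)[OF T] by (auto simp: T'_def)
  moreover have "\<exists>(c, p, q)\<in>T'. holds {0} (case_sum id e) c" if e: "C e" for e
  proof -
    obtain i where i: "i \<in> I" "B i e" using cover[OF e] by blast
    then obtain c p q where "(c, p, q) \<in> T i" "holds {0} (case_sum id e) c"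
      using piecesD(2)[OF T[OF i(1)], of e] e by blast
    then show ?thesis using i b[OF i(1), of e] by (force simp: T'_def)
  qed
  moreover have "tval (case_sum id e) q \<noteq> 0 \<and> f e = tval (case_sum id e) p / tval (case_sum id e) q"
    if e: "(c, p, q) \<in> T'" "C e" "holds {0} (case_sum id e) c" for c p q e
  proof -
    obtain i c' where i: "i \<in> I" "(c', p, q) \<in> T i" "c = Conj (b i) c'" using e(1) by (auto simp: T'_def)
    then show ?thesis using piecesD(3)[OF T[OF i(1)] i(2), of e] b[OF i(1), of e] e by simp
  qed
  ultimately show ?thesis unfolding piecewise_rational_def pieces_def by (intro exI[of _ T']) blast
qed

lemma piecewise_rational_regular:
  fixes C :: "('v \<Rightarrow> 'k::field) \<Rightarrow> bool"
  assumes g: "regular_on n S g" and S: "\<And>v. v \<in> S \<Longrightarrow> length v = n"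
    and f: "\<And>e. C e \<Longrightarrow> map (e \<circ> s) [0..<n] \<in> S \<and> f e = g (map (e \<circ> s) [0..<n])"
  shows "piecewise_rational C f"
proof -
  obtain T where T: "finite T" "T \<subseteq> poly_funs n \<times> poly_funs n \<times> poly_funs n"
    "\<And>v. v \<in> S \<Longrightarrow> \<exists>(h, p, q)\<in>T. h v \<noteq> 0"
    "\<And>h p q v. (h, p, q) \<in> T \<Longrightarrow> v \<in> S \<Longrightarrow> h v \<noteq> 0 \<Longrightarrow> q v \<noteq> 0 \<and> g v = p v / q v"
    by (rule regular_on_finite[OF g S]; blast)
  have "\<forall>p\<in>(poly_funs n :: ('k list \<Rightarrow> 'k) set). \<exists>t. \<forall>e. tval (case_sum id e) t = p (map (e \<circ> s) [0..<n])"
    using poly_funs_term by blast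
  from bchoice[OF this] obtain t where
    t: "\<And>p e. p \<in> (poly_funs n :: ('k list \<Rightarrow> 'k) set) \<Longrightarrow> tval (case_sum id e) (t p) = p (map (e \<circ> s) [0..<n])" by blast
  define T' where "T' = (\<lambda>(h, p, q). (Neg (Zero (t h)), t p, t q)) ` T"
  have "finite T'" using T(1) by (simp add: T'_def)
  moreover have "\<exists>(c, p, q)\<in>T'. holds {0} (case_sum id e) c" if e: "C e" for e
  proof -
    obtain h p q where "(h, p, q) \<in> T" "h (map (e \<circ> s) [0..<n]) \<noteq> 0" using T(3) f[OF e] by blast
    then show ?thesis using T(2) t[of h e] by (force simp: T'_def)
  qed
  moreover have "tval (case_sum id e) q' \<noteq> 0 \<and> f e = tval (case_sum id e) p' / tval (case_sum id e) q'"
    if e: "(c, p', q') \<in> T'" "C e" "holds {0} (case_sum id e) c" for c p' q' e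
  proof -
    obtain h p q where h: "(h, p, q) \<in> T" "c = Neg (Zero (t h))" "p' = t p" "q' = t q"
      using e(1) by (auto simp: T'_def)
    then have "h \<in> poly_funs n" "p \<in> poly_funs n" "q \<in> poly_funs n" using T(2) by auto
    then show ?thesis using T(4)[OF h(1)] f[OF e(2)] e(3) t by (simp add: h)
  qed
  ultimately show ?thesis unfolding piecewise_rational_def pieces_def by (intro exI[of _ T']) blast
qed

text \<open>Numbering the charts gives each point a canonical one, the first that contains it. The
  injection \<alpha> supplies distinct field elements by which a vector can record this
  number.\<close>

locale enumerated_atlas =
  fixes A :: "('g, 'k::field) chart set" and G :: "('g, 'b) monoid_scheme" (structure)
    and cs :: "nat \<Rightarrow> ('g, 'k) chart" and m :: nat and \<alpha> :: "nat \<Rightarrow> 'k"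
  assumes alg: "algebraic_group A G"
    and A: "A = cs ` {..<m}"
    and inj_\<alpha>: "inj \<alpha>"
begin

sublocale group G using alg by (simp add: algebraic_group_def)

lemma carrier_eq: "carrier G = (\<Union>i<m. patch (cs i))"
  using alg by (auto simp: algebraic_group_def variety_def prevariety_def A)

lemma inj_coords: "i < m \<Longrightarrow> inj_on (coords (cs i)) (patch (cs i))"
  and closed_coords: "i < m \<Longrightarrow> zariski_closed (dim (cs i)) (coords (cs i) ` patch (cs i))"
  using alg by (auto simp: algebraic_group_def variety_def prevariety_def affine_chart_def A)

lemma length_coords: "i < m \<Longrightarrow> g \<in> patch (cs i) \<Longrightarrow> length (coords (cs i) g) = dim (cs i)"
  using closed_coords[of i] by (auto simp: zariski_closed_def)

definition overlap :: "nat \<Rightarrow> nat \<Rightarrow> 'k list set" where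
  "overlap i j = coords (cs i) ` {x \<in> patch (cs i). x \<in> patch (cs j)}"

lemma overlap_open: "i < m \<Longrightarrow> j < m \<Longrightarrow>
    zariski_open_in (dim (cs i)) (coords (cs i) ` patch (cs i)) (overlap i j)"
  using alg
  by (auto simp: algebraic_group_def variety_def prevariety_def regular_in_charts_def Let_def A overlap_def)

definition mult_dom :: "nat \<Rightarrow> nat \<Rightarrow> nat \<Rightarrow> 'k list set" where
  "mult_dom i j l = coords (prod_chart (cs i) (cs j)) `
     {x \<in> patch (prod_chart (cs i) (cs j)). (\<lambda>(x, y). x \<otimes> y) x \<in> patch (cs l)}"

lemma mult_regular_in_charts:
  "i < m \<Longrightarrow> j < m \<Longrightarrow> l < m \<Longrightarrow>
    regular_in_charts (prod_chart (cs i) (cs j)) (cs l) (\<lambda>(x, y). x \<otimes> y)"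
  using alg by (auto simp: algebraic_group_def morphism_def prod_atlas_def A)

lemma mult_dom_open: "i < m \<Longrightarrow> j < m \<Longrightarrow> l < m \<Longrightarrow>
    zariski_open_in (dim (cs i) + dim (cs j))
      (coords (prod_chart (cs i) (cs j)) ` patch (prod_chart (cs i) (cs j))) (mult_dom i j l)"
  using mult_regular_in_charts[of i j l]
  by (simp add: regular_in_charts_def Let_def mult_dom_def) (simp add: prod_chart_def)

lemma mult_regular: "i < m \<Longrightarrow> j < m \<Longrightarrow> l < m \<Longrightarrow> k < dim (cs l) \<Longrightarrow>
    regular_on (dim (cs i) + dim (cs j)) (mult_dom i j l)
      (\<lambda>v. coords (cs l) ((\<lambda>(x, y). x \<otimes> y) (inv_into (patch (prod_chart (cs i) (cs j)))
        (coords (prod_chart (cs i) (cs j))) v)) ! k)"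
  using mult_regular_in_charts[of i j l]
  by (simp add: regular_in_charts_def Let_def mult_dom_def) (simp add: prod_chart_def)

lemma inj_prod_chart:
  assumes "i < m" "j < m"
  shows "inj_on (coords (prod_chart (cs i) (cs j))) (patch (prod_chart (cs i) (cs j)))"
proof (rule inj_onI)
  fix z z' assume z: "z \<in> patch (prod_chart (cs i) (cs j))" "z' \<in> patch (prod_chart (cs i) (cs j))"
    and eq: "coords (prod_chart (cs i) (cs j)) z = coords (prod_chart (cs i) (cs j)) z'"
  obtain x y x' y' where xy: "z = (x, y)" "z' = (x', y')" by (metis surj_pair)
  then show "z = z'" using z eq inj_coords[OF assms(1)] inj_coords[OF assms(2)]
      length_coords[OF assms(1)] by (auto simp: prod_chart_def dest: inj_onD)
qed

definition idx :: "'g \<Rightarrow> nat" where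
  "idx g = (LEAST i. i < m \<and> g \<in> patch (cs i))"

lemma idx:
  assumes "g \<in> carrier G"
  shows "idx g < m" "g \<in> patch (cs (idx g))"
proof -
  obtain i where "i < m \<and> g \<in> patch (cs i)" using assms by (auto simp: carrier_eq)
  from LeastI[of "\<lambda>i. i < m \<and> g \<in> patch (cs i)", OF this]
  show "idx g < m" "g \<in> patch (cs (idx g))" by (auto simp: idx_def)
qed

lemma idx_eq_iff:
  assumes "i < m" "g \<in> carrier G"
  shows "idx g = i \<longleftrightarrow> g \<in> patch (cs i) \<and> (\<forall>j<i. g \<notin> patch (cs j))"
proof
  assume "idx g = i"
  then show "g \<in> patch (cs i) \<and> (\<forall>j<i. g \<notin> patch (cs j))"
    using idx[OF assms(2)] assms(1) not_less_Least[of _ "\<lambda>i. i < m \<and> g \<in> patch (cs i)"]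
    by (auto simp: idx_def)
next
  assume "g \<in> patch (cs i) \<and> (\<forall>j<i. g \<notin> patch (cs j))"
  then show "idx g = i" unfolding idx_def using assms(1)
    by (intro Least_equality) (auto simp: not_less[symmetric])
qed

text \<open>One entry for the chart number, plus a crude common bound for the dimensions, so that
  all codes have the same length.\<close>

definition N :: nat where
  "N = Suc (\<Sum>i<m. dim (cs i))"

lemma dim_less_N: "i < m \<Longrightarrow> dim (cs i) < N"
  unfolding N_def less_Suc_eq_le by (rule member_le_sum[of i "{..<m}" "\<lambda>i. dim (cs i)"]) auto

text \<open>
  An element is coded by a constant naming the first chart whose patch contains it, followed by its
  coordinates in this chart and by zeros.
\<close>

definition code :: "'g \<Rightarrow> nat \<Rightarrow> 'k" where
  "code g k = (if k = 0 then \<alpha> (idx g)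
     else if k \<le> dim (cs (idx g)) then coords (cs (idx g)) g ! (k - 1) else 0)"

definition codes :: "(nat \<Rightarrow> 'k) \<Rightarrow> 'g \<Rightarrow> bool" where
  "codes u g \<longleftrightarrow> g \<in> carrier G \<and> (\<forall>k<N. u k = code g k)"

lemma codes_0: "codes u g \<Longrightarrow> u 0 = \<alpha> (idx g)"
  by (auto simp: codes_def code_def N_def)

lemma codes_coords:
  assumes "codes u g"
  shows "map (u \<circ> Suc) [0..<dim (cs (idx g))] = coords (cs (idx g)) g"
proof -
  have g: "g \<in> carrier G" using assms by (simp add: codes_def)
  show ?thesis
  proof (rule nth_equalityI)
    fix k assume "k < length (map (u \<circ> Suc) [0..<dim (cs (idx g))])"
    then show "map (u \<circ> Suc) [0..<dim (cs (idx g))] ! k = coords (cs (idx g)) g ! k"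
      using assms dim_less_N[OF idx(1)[OF g]] by (auto simp: codes_def code_def)
  qed (use idx[OF g] length_coords in auto)
qed

lemma codes_inj: "codes u g \<Longrightarrow> codes u h \<Longrightarrow> g = h"
proof -
  assume gh: "codes u g" "codes u h"
  then have i: "idx g = idx h" using codes_0 inj_\<alpha> by (metis injD)
  have "g \<in> carrier G" "h \<in> carrier G" using gh by (auto simp: codes_def)
  moreover have "coords (cs (idx g)) g = coords (cs (idx g)) h"
    using codes_coords[OF gh(1)] codes_coords[OF gh(2)] i by simp
  ultimately show "g = h" using inj_coords idx i by (metis inj_onD)
qed

text \<open>The right-hand side is built from visibly constructible conditions: the chart number,
  membership in the closed image of the patch, avoidance of the overlaps with earlier charts, and
  the padding.\<close>

lemma ex_codes_iff:
  "(\<exists>g. codes u g) \<longleftrightarrow> (\<exists>i\<in>{..<m}. u 0 = \<alpha> i \<and>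
     map (u \<circ> Suc) [0..<dim (cs i)] \<in> coords (cs i) ` patch (cs i) \<and>
     (\<forall>j\<in>{..<i}. map (u \<circ> Suc) [0..<dim (cs i)] \<notin> overlap i j) \<and>
     (\<forall>k\<in>{dim (cs i)<..<N}. u k = 0))" (is "_ \<longleftrightarrow> ?R")
proof
  assume "\<exists>g. codes u g"
  then obtain g where g: "codes u g" by blast
  then have gG: "g \<in> carrier G" by (simp add: codes_def)
  let ?i = "idx g"
  have i: "?i < m" "g \<in> patch (cs ?i)" using idx[OF gG] by auto
  have "coords (cs ?i) g \<notin> overlap ?i j" if "j < ?i" for j
  proof
    assume "coords (cs ?i) g \<in> overlap ?i j"
    then obtain x where "coords (cs ?i) x = coords (cs ?i) g" "x \<in> patch (cs ?i)" "x \<in> patch (cs j)"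
      by (auto simp: overlap_def)
    then have "g \<in> patch (cs j)" using inj_coords[OF i(1)] i(2) by (metis inj_onD)
    then show False using idx_eq_iff[OF i(1) gG] that by blast
  qed
  moreover have "u k = 0" if "k \<in> {dim (cs ?i)<..<N}" for k
    using g that by (auto simp: codes_def code_def)
  ultimately show ?R using codes_coords[OF g] codes_0[OF g] i by (intro bexI[of _ ?i]) auto
next
  assume ?R
  then obtain i g where i: "i < m" "u 0 = \<alpha> i"
    and g: "g \<in> patch (cs i)" "map (u \<circ> Suc) [0..<dim (cs i)] = coords (cs i) g"
    and n: "\<And>j. j < i \<Longrightarrow> coords (cs i) g \<notin> overlap i j" "\<And>k. k \<in> {dim (cs i)<..<N} \<Longrightarrow> u k = 0"
    by (auto simp: image_iff)
  have gG: "g \<in> carrier G" using g i by (auto simp: carrier_eq)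
  have "g \<notin> patch (cs j)" if "j < i" for j using n(1)[OF that] g(1) by (auto simp: overlap_def)
  then have ig: "idx g = i" using idx_eq_iff[OF i(1) gG] g(1) by blast
  have "u k = code g k" if "k < N" for k
  proof -
    consider "k = 0" | "k \<noteq> 0" "k \<le> dim (cs i)" | "k > dim (cs i)" by linarith
    then show ?thesis
    proof cases
      case 2
      then have "map (u \<circ> Suc) [0..<dim (cs i)] ! (k - 1) = u k" by (subst nth_map) auto
      then show ?thesis using 2 by (simp add: code_def ig g(2))
    qed (use i n(2) that in \<open>auto simp: code_def ig\<close>)
  qed
  then show "\<exists>g. codes u g" using gG by (auto simp: codes_def)
qed

lemma constructible_overlap:
  assumes "i < m" "j < m"
  shows "constructible (\<lambda>e. map (e \<circ> s) [0..<dim (cs i)] \<in> overlap i j)"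
  by (rule constructible_open[OF overlap_open[OF assms] constructible_closed[OF closed_coords[OF assms(1)]]])

lemma constructible_codes: "constructible (\<lambda>u. \<exists>g. codes u g)"
  unfolding ex_codes_iff
  by (intro constructible_bex constructible_conj constructible_ball constructible_not
      constructible_eq constructible_overlap constructible_closed closed_coords) auto

lemma map_append_upt:
  "map (f \<circ> (\<lambda>k. if k < a then g k else h (k - a))) [0..<a + b] = map (f \<circ> g) [0..<a] @ map (f \<circ> h) [0..<b]"
  by (rule nth_equalityI) (auto simp: nth_append)

definition decode :: "(nat \<Rightarrow> 'k) \<Rightarrow> 'g" where
  "decode u = (THE g. codes u g)"

lemma decode: "codes u g \<Longrightarrow> decode u = g"
  unfolding decode_def using codes_inj by blast

text \<open>Cut the domain by the canonical charts of both factors and of the product. These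
  finitely many parts are constructible, and on each the entry is constant or a regular function,
  for which finitely many quotients suffice.\<close>

lemma mult_piecewise_rational:
  assumes "k < N"
  shows "piecewise_rational (\<lambda>e :: bool \<times> nat \<Rightarrow> 'k.
      (\<exists>g. codes (\<lambda>k. e (False, k)) g) \<and> (\<exists>h. codes (\<lambda>k. e (True, k)) h))
    (\<lambda>e. code (decode (\<lambda>k. e (False, k)) \<otimes> decode (\<lambda>k. e (True, k))) k)"
proof -
  \<comment> \<open>Tells which variable holds the k-th coordinate of a pair in a product chart. The
    \<open>Suc\<close> skips entry 0, which holds the chart number.\<close>
  define s where "s i = (\<lambda>k. if k < dim (cs i) then (False, Suc k) else (True, Suc (k - dim (cs i))))" for i
  define vec where "vec i j e = map (e \<circ> s i) [0..<dim (cs i) + dim (cs j)]"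
    for i j and e :: "bool \<times> nat \<Rightarrow> 'k"
  let ?C = "\<lambda>e :: bool \<times> nat \<Rightarrow> 'k.
      (\<exists>g. codes (\<lambda>k. e (False, k)) g) \<and> (\<exists>h. codes (\<lambda>k. e (True, k)) h)"
  let ?f = "\<lambda>e :: bool \<times> nat \<Rightarrow> 'k. code (decode (\<lambda>k. e (False, k)) \<otimes> decode (\<lambda>k. e (True, k))) k"
  let ?P = "\<lambda>i j. prod_chart (cs i) (cs j)"
  \<comment> \<open>i and j are the charts of the factors; the last clause makes l the first chart
    containing the product.\<close>
  let ?B = "\<lambda>(i, j, l) e. e (False, 0) = \<alpha> i \<and> e (True, 0) = \<alpha> j \<and> vec i j e \<in> mult_dom i j l \<and>
     (\<forall>l'\<in>{..<l}. vec i j e \<notin> mult_dom i j l')"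
  have vec: "vec i j e = map ((\<lambda>k. e (False, k)) \<circ> Suc) [0..<dim (cs i)] @
      map ((\<lambda>k. e (True, k)) \<circ> Suc) [0..<dim (cs j)]" for i j e
    unfolding vec_def s_def
    using map_append_upt[of e "dim (cs i)" "\<lambda>k. (False, Suc k)" "\<lambda>k. (True, Suc k)" "dim (cs j)"]
    by (simp only: comp_def)
  have vec_coords: "vec (idx g) (idx h) e = coords (?P (idx g) (idx h)) (g, h)"
    "(g, h) \<in> patch (?P (idx g) (idx h))"
    if "codes (\<lambda>k. e (False, k)) g" "codes (\<lambda>k. e (True, k)) h" for e g h
  proof -
    have "g \<in> carrier G" "h \<in> carrier G" using that by (simp_all add: codes_def)
    then show "(g, h) \<in> patch (?P (idx g) (idx h))" using idx(2) by (simp add: prod_chart_def)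
    show "vec (idx g) (idx h) e = coords (?P (idx g) (idx h)) (g, h)"
      unfolding vec codes_coords[OF that(1)] codes_coords[OF that(2)] by (simp add: prod_chart_def)
  qed
  have mem: "vec (idx g) (idx h) e \<in> mult_dom (idx g) (idx h) l \<longleftrightarrow> g \<otimes> h \<in> patch (cs l)"
    if "codes (\<lambda>k. e (False, k)) g" "codes (\<lambda>k. e (True, k)) h" "l < m" for e g h l
  proof -
    have "g \<in> carrier G" "h \<in> carrier G" using that by (simp_all add: codes_def)
    then have "inj_on (coords (?P (idx g) (idx h))) (patch (?P (idx g) (idx h)))"
      using idx by (intro inj_prod_chart)
    then show ?thesis unfolding mult_dom_def vec_coords(1)[OF that(1,2)]
      by (subst inj_on_image_mem_iff[OF _ vec_coords(2)[OF that(1,2)]])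
        (use vec_coords(2)[OF that(1,2)] in auto)
  qed
  have B_iff: "?B (i, j, l) e \<longleftrightarrow> i = idx g \<and> j = idx h \<and> l = idx (g \<otimes> h)"
    if "codes (\<lambda>k. e (False, k)) g" "codes (\<lambda>k. e (True, k)) h" "l < m" for e g h i j l
  proof -
    have gh: "g \<otimes> h \<in> carrier G" using that by (auto simp: codes_def)
    have "e (False, 0) = \<alpha> i \<longleftrightarrow> i = idx g" "e (True, 0) = \<alpha> j \<longleftrightarrow> j = idx h"
      using codes_0[OF that(1)] codes_0[OF that(2)] inj_\<alpha> by (auto dest: injD)
    moreover have "vec (idx g) (idx h) e \<in> mult_dom (idx g) (idx h) l \<and>
        (\<forall>l'\<in>{..<l}. vec (idx g) (idx h) e \<notin> mult_dom (idx g) (idx h) l') \<longleftrightarrow> idx (g \<otimes> h) = l"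
      unfolding idx_eq_iff[OF that(3) gh] using mem[OF that(1,2)] that(3) by fastforce
    ultimately show ?thesis unfolding prod.case by blast
  qed
  show ?thesis
  proof (rule piecewise_rational_cases[where I = "{..<m} \<times> {..<m} \<times> {..<m}" and B = ?B])
    fix x assume x: "x \<in> {..<m} \<times> {..<m} \<times> {..<m}"
    then obtain i j l where ijl: "x = (i, j, l)" "i < m" "j < m" "l < m" by auto
    have cd: "constructible (\<lambda>e. vec i j e \<in> mult_dom i j l')" if "l' < m" for l'
    proof -
      let ?V = "coords (?P i j) ` patch (?P i j)"
      have app: "u @ v \<in> ?V \<longleftrightarrow> u \<in> coords (cs i) ` patch (cs i) \<and> v \<in> coords (cs j) ` patch (cs j)"
        if "length u = dim (cs i)" for u v
        using that length_coords ijl(2) by (force simp: prod_chart_def)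
      have "constructible (\<lambda>e. vec i j e \<in> ?V)"
      proof -
        have "vec i j e \<in> ?V \<longleftrightarrow> map (e \<circ> (\<lambda>k. (False, Suc k))) [0..<dim (cs i)] \<in> coords (cs i) ` patch (cs i) \<and>
          map (e \<circ> (\<lambda>k. (True, Suc k))) [0..<dim (cs j)] \<in> coords (cs j) ` patch (cs j)" for e
          unfolding vec by (subst app) (auto simp: comp_def)
        then show ?thesis using closed_coords ijl
          by (simp only:) (intro constructible_conj constructible_closed; simp)
      qed
      then show ?thesis unfolding vec_def by (rule constructible_open[OF mult_dom_open[OF ijl(2,3) that]])
    qed
    show "constructible (?B x)" unfolding ijl(1) prod.case
      using cd ijl by (intro constructible_conj constructible_ball constructible_not constructible_eq) auto
    show "piecewise_rational (\<lambda>e. ?C e \<and> ?B x e) ?f"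
    proof -
      have D: "\<exists>g h. codes (\<lambda>k. e (False, k)) g \<and> codes (\<lambda>k. e (True, k)) h \<and> i = idx g \<and> j = idx h \<and>
          l = idx (g \<otimes> h) \<and> ?f e = code (g \<otimes> h) k" if e: "?C e \<and> ?B x e" for e
      proof -
        obtain g h where gh: "codes (\<lambda>k. e (False, k)) g" "codes (\<lambda>k. e (True, k)) h" using e by blast
        have "?B (i, j, l) e" using e unfolding ijl(1) by blast
        then have "i = idx g \<and> j = idx h \<and> l = idx (g \<otimes> h)" using B_iff[OF gh ijl(4)] by blast
        moreover have "?f e = code (g \<otimes> h) k" unfolding decode[OF gh(1)] decode[OF gh(2)] ..
        ultimately show ?thesis using gh by blast
      qed
      \<comment> \<open>Entry 0 is the chart number and entries beyond the dimension are padding,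
        both constant here. The others are coordinates of the product, with index shifted by
        one.\<close>
      consider "k = 0" | "k > dim (cs l)" | "k \<noteq> 0" "k \<le> dim (cs l)" by linarith
      then show ?thesis
      proof cases
        case 1
        have "?f e = \<alpha> l" if "?C e \<and> ?B x e" for e using D[OF that] 1 by (auto simp: code_def)
        then show ?thesis by (rule piecewise_rational_const)
      next
        case 2
        then have "?f e = 0" if "?C e \<and> ?B x e" for e using D[OF that] by (auto simp: code_def)
        then show ?thesis by (rule piecewise_rational_const)
      next
        case 3
        then have "k - 1 < dim (cs l)" by simp
        note reg = mult_regular[OF ijl(2-4) this]
        show ?thesis
        proof (rule piecewise_rational_regular[OF reg])
          fix v assume "v \<in> mult_dom i j l"
          then show "length v = dim (cs i) + dim (cs j)"
            using length_coords ijl by (auto simp: mult_dom_def prod_chart_def)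
        next
          fix e :: "bool \<times> nat \<Rightarrow> 'k" assume e: "?C e \<and> ?B x e"
          then obtain g h where gh: "codes (\<lambda>k. e (False, k)) g" "codes (\<lambda>k. e (True, k)) h"
            "i = idx g" "j = idx h" "l = idx (g \<otimes> h)" "?f e = code (g \<otimes> h) k" using D by blast
          have "inv_into (patch (?P i j)) (coords (?P i j)) (vec i j e) = (g, h)"
            using vec_coords[OF gh(1,2)] inj_prod_chart[OF ijl(2,3)] gh(3,4) by (metis inv_into_f_f)
          moreover have "vec i j e \<in> mult_dom i j l" using e ijl(1) by auto
          ultimately show "map (e \<circ> s i) [0..<dim (cs i) + dim (cs j)] \<in> mult_dom i j l \<and>
            ?f e = coords (cs l) ((\<lambda>(x, y). x \<otimes> y) (inv_into (patch (?P i j))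
              (coords (?P i j)) (map (e \<circ> s i) [0..<dim (cs i) + dim (cs j)]))) ! (k - 1)"
            using gh(5,6) 3 unfolding vec_def[symmetric] by (simp add: code_def)
        qed
      qed
    qed
  next
    fix e :: "bool \<times> nat \<Rightarrow> 'k" assume "?C e"
    then obtain g h where gh: "codes (\<lambda>k. e (False, k)) g" "codes (\<lambda>k. e (True, k)) h" by blast
    then have "idx g < m" "idx h < m" "idx (g \<otimes> h) < m" using idx(1) by (auto simp: codes_def)
    then show "\<exists>x\<in>{..<m} \<times> {..<m} \<times> {..<m}. ?B x e"
      using B_iff[OF gh, of "idx (g \<otimes> h)" "idx g" "idx h"]
      by (intro bexI[of _ "(idx g, idx h, idx (g \<otimes> h))"]) auto
  qed simp
qed

end

theorem algebraic_group_code: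
  fixes G :: "('g, 'b) monoid_scheme" and A :: "('g, 'k::field) chart set"
  assumes "algebraic_group A G" "infinite (UNIV :: 'k set)"
  obtains N :: nat and code :: "'g \<Rightarrow> nat \<Rightarrow> 'k" and D :: "('k + nat) form"
    and T :: "nat \<Rightarrow> (('k + bool \<times> nat) form \<times> ('k + bool \<times> nat) trm \<times> ('k + bool \<times> nat) trm) set"
  where "\<And>g h. g \<in> carrier G \<Longrightarrow> h \<in> carrier G \<Longrightarrow> (\<forall>k<N. code g k = code h k) \<Longrightarrow> g = h"
    "\<And>u. holds {0} (case_sum id u) D \<longleftrightarrow> (\<exists>g\<in>carrier G. \<forall>k<N. u k = code g k)"
    "\<And>k. finite (T k)"
    "\<And>k e g h. k < N \<Longrightarrow> g \<in> carrier G \<Longrightarrow> h \<in> carrier G \<Longrightarrow> (\<forall>k<N. e (False, k) = code g k) \<Longrightarrow>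
       (\<forall>k<N. e (True, k) = code h k) \<Longrightarrow> \<exists>(c, p, q)\<in>T k. holds {0} (case_sum id e) c"
    "\<And>k e g h c p q. k < N \<Longrightarrow> g \<in> carrier G \<Longrightarrow> h \<in> carrier G \<Longrightarrow> (\<forall>k<N. e (False, k) = code g k) \<Longrightarrow>
       (\<forall>k<N. e (True, k) = code h k) \<Longrightarrow> (c, p, q) \<in> T k \<Longrightarrow> holds {0} (case_sum id e) c \<Longrightarrow>
       tval (case_sum id e) q \<noteq> 0 \<and>
       code (g \<otimes>\<^bsub>G\<^esub> h) k = tval (case_sum id e) p / tval (case_sum id e) q"
proof -
  have "finite A" using assms(1) by (auto simp: algebraic_group_def variety_def prevariety_def)
  then obtain xs where xs: "set xs = A" using finite_list by blast
  obtain \<alpha> :: "nat \<Rightarrow> 'k" where \<alpha>: "inj \<alpha>" using infinite_countable_subset[OF assms(2)] by blast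
  have nth: "A = (!) xs ` {..<length xs}" using xs by (auto simp: in_set_conv_nth)
  interpret enumerated_atlas A G "(!) xs" "length xs" \<alpha>
    using assms(1) \<alpha> nth by unfold_locales
  obtain D where D: "\<And>u. holds {0} (case_sum id u) D \<longleftrightarrow> (\<exists>g. codes u g)"
    using constructible_codes unfolding constructible_def by blast
  have "\<forall>k\<in>{..<N}. \<exists>T. pieces (\<lambda>e :: bool \<times> nat \<Rightarrow> 'k.
      (\<exists>g. codes (\<lambda>k. e (False, k)) g) \<and> (\<exists>h. codes (\<lambda>k. e (True, k)) h))
    (\<lambda>e. code (decode (\<lambda>k. e (False, k)) \<otimes>\<^bsub>G\<^esub> decode (\<lambda>k. e (True, k))) k) T"
    by (intro ballI mult_piecewise_rational[unfolded piecewise_rational_def]) simp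
  from bchoice[OF this] obtain T where T: "\<forall>k\<in>{..<N}. pieces (\<lambda>e :: bool \<times> nat \<Rightarrow> 'k.
      (\<exists>g. codes (\<lambda>k. e (False, k)) g) \<and> (\<exists>h. codes (\<lambda>k. e (True, k)) h))
    (\<lambda>e. code (decode (\<lambda>k. e (False, k)) \<otimes>\<^bsub>G\<^esub> decode (\<lambda>k. e (True, k))) k) (T k)" ..
  have TN: "k < N \<Longrightarrow> pieces (\<lambda>e :: bool \<times> nat \<Rightarrow> 'k.
      (\<exists>g. codes (\<lambda>k. e (False, k)) g) \<and> (\<exists>h. codes (\<lambda>k. e (True, k)) h))
    (\<lambda>e. code (decode (\<lambda>k. e (False, k)) \<otimes>\<^bsub>G\<^esub> decode (\<lambda>k. e (True, k))) k) (T k)" for k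
    using T by blast
  show ?thesis
  \<comment> \<open>The chosen \<open>T k\<close> is controlled only for k below N; the empty set
    elsewhere makes finiteness unconditional.\<close>
  proof (rule that[of N code D "\<lambda>k. if k < N then T k else {}"])
    fix g h assume "g \<in> carrier G" "h \<in> carrier G" "\<forall>k<N. code g k = code h k"
    then show "g = h" using codes_inj[of "code g" g h] by (simp add: codes_def)
  next
    fix u show "holds {0} (case_sum id u) D \<longleftrightarrow> (\<exists>g\<in>carrier G. \<forall>k<N. u k = code g k)"
      unfolding D by (auto simp: codes_def)
  next
    fix k show "finite (if k < N then T k else {})" using piecesD(1)[OF TN[of k]] by auto
  next
    fix k e g h
    assume "k < N" "g \<in> carrier G" "h \<in> carrier G"
      "\<forall>k<N. e (False, k) = code g k" "\<forall>k<N. e (True, k) = code h k"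
    then have "codes (\<lambda>k. e (False, k)) g" "codes (\<lambda>k. e (True, k)) h" by (auto simp: codes_def)
    then show "\<exists>(c, p, q)\<in>(if k < N then T k else {}). holds {0} (case_sum id e) c"
      using piecesD(2)[OF TN[OF \<open>k < N\<close>], of e] \<open>k < N\<close> by (simp only: if_True) blast
  next
    fix k e g h c p q
    assume *: "k < N" "g \<in> carrier G" "h \<in> carrier G"
      "\<forall>k<N. e (False, k) = code g k" "\<forall>k<N. e (True, k) = code h k"
      "(c, p, q) \<in> (if k < N then T k else {})" "holds {0} (case_sum id e) c"
    have gh: "codes (\<lambda>k. e (False, k)) g" "codes (\<lambda>k. e (True, k)) h" using * by (auto simp: codes_def)
    have "(c, p, q) \<in> T k" using * by simp
    from piecesD(3)[OF TN[OF *(1)] this _ *(7)] gh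
    show "tval (case_sum id e) q \<noteq> 0 \<and>
       code (g \<otimes>\<^bsub>G\<^esub> h) k = tval (case_sum id e) p / tval (case_sum id e) q"
      unfolding decode[OF gh(1)] decode[OF gh(2)] by blast
  qed
qed

section \<open>The finite quotient\<close>

instance symbol :: countable
  by countable_datatype

lemma tval_mem:
  "subring_of S \<Longrightarrow> (\<And>x. x \<in> set_trm t \<Longrightarrow> e x \<in> S) \<Longrightarrow> tval e t \<in> S"
proof (induction t)
  case (Cst c)
  have "of_nat n \<in> S" for n using Cst(1) by (induction n) (auto intro: subring_ofD)
  then have "of_int c \<in> S" using Cst(1)
    by (cases c rule: int_cases2) (auto intro: subring_ofD)
  then show ?case by simp
qed (auto intro: subring_ofD)

text \<open>Take a ring with finitely generated additive group containing X. It has finitely many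
  classes modulo p, and p lies in M, so finitely many modulo M.\<close>

lemma ex_order:
  fixes M :: "algint set"
  assumes M: "residually_closed M" and p: "p > 0" "of_int p \<in> M" and X: "finite X"
  obtains S T where "X \<subseteq> S" "subring_of S" "finite T" "T \<subseteq> S" "\<And>x. x \<in> S \<Longrightarrow> \<exists>t\<in>T. x - t \<in> M"
proof -
  obtain R where R: "finite_order R" "Rep_algint ` X \<subseteq> R" using finite_order_superset[OF X] by blast
  define S where "S = {x. Rep_algint x \<in> R}"
  have Abs: "Rep_algint (Abs_algint z) = z" if "z \<in> R" for z
    using that R(1) by (intro Abs_algint_inverse) auto
  obtain T where T: "finite T" "T \<subseteq> R" "\<And>x. x \<in> R \<Longrightarrow> \<exists>t\<in>T. \<exists>s\<in>R. x - t = of_int p * s"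
    using finite_order_residues[OF R(1) p(1)] by blast
  show ?thesis
  proof (rule that[of S "Abs_algint ` T"])
    show "X \<subseteq> S" using R(2) by (auto simp: S_def)
    show "subring_of S" using finite_order_ring[OF R(1)]
      by (auto simp: subring_of_def S_def zero_algint.rep_eq one_algint.rep_eq plus_algint.rep_eq
          times_algint.rep_eq uminus_algint.rep_eq)
    show "finite (Abs_algint ` T)" using T(1) by simp
    show "Abs_algint ` T \<subseteq> S" using T(2) Abs by (auto simp: S_def)
    fix x assume "x \<in> S"
    then obtain t s where ts: "t \<in> T" "s \<in> R" "Rep_algint x - t = of_int p * s"
      using T(3)[of "Rep_algint x"] by (auto simp: S_def)
    have "Rep_algint (x - Abs_algint t) = Rep_algint (of_int p * Abs_algint s)"
      using ts T(2) Abs by (simp add: Rep_algint_minus times_algint.rep_eq Rep_algint_of_int subset_iff)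
    then have "x - Abs_algint t = of_int p * Abs_algint s" by (simp only: Rep_algint_inject)
    then have "x - Abs_algint t \<in> M" using residually_closed.mult_mem'[OF M p(2)] by simp
    then show "\<exists>t\<in>Abs_algint ` T. x - t \<in> M" using ts(1) by blast
  qed
qed

definition pair_env :: "(nat \<Rightarrow> 'r) \<Rightarrow> (nat \<Rightarrow> 'r) \<Rightarrow> bool \<times> nat \<Rightarrow> 'r" where
  "pair_env u v = (\<lambda>(b, k). if b then v k else u k)"

text \<open>All that is kept of the algebraic group; the geometry ends here. The pieces are lists
  because formulas are assembled from them.\<close>

locale coded_group = group G for G :: "('g, 'b) monoid_scheme" (structure) +
  fixes N :: nat and code :: "'g \<Rightarrow> nat \<Rightarrow> 'k::alg_closed_field" and D :: "('k + nat) form"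
    and T :: "nat \<Rightarrow> (('k + bool \<times> nat) form \<times> ('k + bool \<times> nat) trm \<times> ('k + bool \<times> nat) trm) list"
  assumes code_inj: "\<And>g h. g \<in> carrier G \<Longrightarrow> h \<in> carrier G \<Longrightarrow> (\<forall>k<N. code g k = code h k) \<Longrightarrow> g = h"
    and D: "\<And>u. holds {0} (case_sum id u) D \<longleftrightarrow> (\<exists>g\<in>carrier G. \<forall>k<N. u k = code g k)"
    and T_cover: "\<And>k e g h. k < N \<Longrightarrow> g \<in> carrier G \<Longrightarrow> h \<in> carrier G \<Longrightarrow>
       (\<forall>k<N. e (False, k) = code g k) \<Longrightarrow> (\<forall>k<N. e (True, k) = code h k) \<Longrightarrow>
       \<exists>(c, p, q)\<in>set (T k). holds {0} (case_sum id e) c"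
    and T_quotient: "\<And>k e g h c p q. k < N \<Longrightarrow> g \<in> carrier G \<Longrightarrow> h \<in> carrier G \<Longrightarrow>
       (\<forall>k<N. e (False, k) = code g k) \<Longrightarrow> (\<forall>k<N. e (True, k) = code h k) \<Longrightarrow>
       (c, p, q) \<in> set (T k) \<Longrightarrow> holds {0} (case_sum id e) c \<Longrightarrow>
       tval (case_sum id e) q \<noteq> 0 \<and>
       code (g \<otimes> h) k = tval (case_sum id e) p / tval (case_sum id e) q"
begin

definition dom :: "'r::comm_ring_1 set \<Rightarrow> ('k \<Rightarrow> 'r) \<Rightarrow> (nat \<Rightarrow> 'r) \<Rightarrow> bool" where
  "dom M c u \<longleftrightarrow> holds M (case_sum c u) D"

text \<open>Some piece applies with a denominator invertible modulo M. Demanding this for all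
  vectors in the domain is a universal statement, whereas demanding a product is not.\<close>

definition mul_defined :: "'r::comm_ring_1 set \<Rightarrow> ('k \<Rightarrow> 'r) \<Rightarrow> nat \<Rightarrow> (nat \<Rightarrow> 'r) \<Rightarrow> (nat \<Rightarrow> 'r) \<Rightarrow> bool" where
  "mul_defined M c k u v \<longleftrightarrow> (\<exists>(f, p, q)\<in>set (T k). holds M (case_sum c (pair_env u v)) f \<and>
     tval (case_sum c (pair_env u v)) q \<notin> M)"

text \<open>The quotient p / q is described without division, by q x = p modulo M. That different
  applicable pieces agree after reinterpretation is not built in but is one of the transferred
  axioms.\<close>

definition mul_coord :: "'r::comm_ring_1 set \<Rightarrow> ('k \<Rightarrow> 'r) \<Rightarrow> nat \<Rightarrow> (nat \<Rightarrow> 'r) \<Rightarrow> (nat \<Rightarrow> 'r) \<Rightarrow> 'r \<Rightarrow> bool" where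
  "mul_coord M c k u v x \<longleftrightarrow> (\<exists>(f, p, q)\<in>set (T k). holds M (case_sum c (pair_env u v)) f \<and>
     tval (case_sum c (pair_env u v)) q \<notin> M \<and>
     tval (case_sum c (pair_env u v)) q * x - tval (case_sum c (pair_env u v)) p \<in> M)"

definition mul :: "'r::comm_ring_1 set \<Rightarrow> ('k \<Rightarrow> 'r) \<Rightarrow> (nat \<Rightarrow> 'r) \<Rightarrow> (nat \<Rightarrow> 'r) \<Rightarrow> (nat \<Rightarrow> 'r) \<Rightarrow> bool" where
  "mul M c u v w \<longleftrightarrow> dom M c u \<and> dom M c v \<and> (\<forall>k<N. mul_coord M c k u v (w k))"

definition eqv :: "'r::comm_ring_1 set \<Rightarrow> (nat \<Rightarrow> 'r) \<Rightarrow> (nat \<Rightarrow> 'r) \<Rightarrow> bool" where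
  "eqv M u v \<longleftrightarrow> (\<forall>k<N. u k - v k \<in> M)"

definition names :: "'r::comm_ring_1 set \<Rightarrow> ('k \<Rightarrow> 'r) \<Rightarrow> (nat \<Rightarrow> 'r) \<Rightarrow> 'g \<Rightarrow> bool" where
  "names M c u g \<longleftrightarrow> (\<forall>k<N. u k - c (code g k) \<in> M)"

text \<open>In the formulas below the variable (t, k) is the k-th coordinate of the t-th vector.\<close>

definition ren :: "nat \<Rightarrow> nat \<Rightarrow> 'k + bool \<times> nat \<Rightarrow> 'k + nat \<times> nat" where
  "ren s t = map_sum id (\<lambda>(b, k). (if b then t else s, k))"

definition Dom :: "nat \<Rightarrow> ('k + nat \<times> nat) form" where
  "Dom t = map_form (map_sum id (Pair t)) D"

definition Minus :: "'x trm \<Rightarrow> 'x trm \<Rightarrow> 'x trm" where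
  "Minus s t = Plus s (Times (Cst (-1)) t)"

definition Mul_defined :: "nat \<Rightarrow> nat \<Rightarrow> nat \<Rightarrow> ('k + nat \<times> nat) form" where
  "Mul_defined k s t = Disjs (map (\<lambda>(f, p, q).
     Conj (map_form (ren s t) f) (Neg (Zero (map_trm (ren s t) q)))) (T k))"

definition Mul_coord :: "nat \<Rightarrow> nat \<Rightarrow> nat \<Rightarrow> nat \<Rightarrow> ('k + nat \<times> nat) form" where
  "Mul_coord k s t r = Disjs (map (\<lambda>(f, p, q).
     Conj (map_form (ren s t) f) (Conj (Neg (Zero (map_trm (ren s t) q)))
       (Zero (Minus (Times (map_trm (ren s t) q) (Vr (Inr (r, k)))) (map_trm (ren s t) p))))) (T k))"

definition Mul :: "nat \<Rightarrow> nat \<Rightarrow> nat \<Rightarrow> ('k + nat \<times> nat) form" where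
  "Mul s t r = Conj (Dom s) (Conj (Dom t) (Conjs (map (\<lambda>k. Mul_coord k s t r) [0..<N])))"

definition Eqv :: "nat \<Rightarrow> nat \<Rightarrow> ('k + nat \<times> nat) form" where
  "Eqv s t = Conjs (map (\<lambda>k. Zero (Minus (Vr (Inr (s, k))) (Vr (Inr (t, k))))) [0..<N])"

definition Names :: "nat \<Rightarrow> 'g \<Rightarrow> ('k + nat \<times> nat) form" where
  "Names t g = Conjs (map (\<lambda>k. Zero (Minus (Vr (Inr (t, k))) (Vr (Inl (code g k))))) [0..<N])"

abbreviation Imp :: "'x form \<Rightarrow> 'x form \<Rightarrow> 'x form" where
  "Imp f g \<equiv> Neg (Conj f (Neg g))"

lemma tval_Minus: "tval e (Minus s t) = tval e s - tval e t"
  by (simp add: Minus_def)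

lemma env_ren: "case_sum c e \<circ> ren s t = case_sum c (pair_env (\<lambda>k. e (s, k)) (\<lambda>k. e (t, k)))"
  by (auto simp: fun_eq_iff ren_def pair_env_def split: sum.split)

context
  fixes M :: "'r::comm_ring_1 set" and c :: "'k \<Rightarrow> 'r" and e :: "nat \<times> nat \<Rightarrow> 'r"
  assumes one: "1 \<notin> M"
begin

lemma holds_Dom: "holds M (case_sum c e) (Dom t) \<longleftrightarrow> dom M c (\<lambda>k. e (t, k))"
proof -
  have "case_sum c e \<circ> map_sum id (Pair t) = case_sum c (\<lambda>k. e (t, k))"
    by (auto simp: fun_eq_iff split: sum.split)
  then show ?thesis by (simp only: Dom_def dom_def holds_map)
qed

lemma holds_Mul_defined: "holds M (case_sum c e) (Mul_defined k s t) \<longleftrightarrow>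
    mul_defined M c k (\<lambda>k. e (s, k)) (\<lambda>k. e (t, k))"
  using one by (simp add: Mul_defined_def mul_defined_def holds_map tval_map env_ren split_beta)

lemma holds_Mul_coord: "holds M (case_sum c e) (Mul_coord k s t r) \<longleftrightarrow>
    mul_coord M c k (\<lambda>k. e (s, k)) (\<lambda>k. e (t, k)) (e (r, k))"
  using one by (simp add: Mul_coord_def mul_coord_def holds_map tval_map env_ren tval_Minus split_beta)

lemma holds_Mul: "holds M (case_sum c e) (Mul s t r) \<longleftrightarrow>
    mul M c (\<lambda>k. e (s, k)) (\<lambda>k. e (t, k)) (\<lambda>k. e (r, k))"
  using one by (auto simp: Mul_def mul_def holds_Dom holds_Mul_coord)

lemma holds_Eqv: "holds M (case_sum c e) (Eqv s t) \<longleftrightarrow> eqv M (\<lambda>k. e (s, k)) (\<lambda>k. e (t, k))"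
  using one by (auto simp: Eqv_def eqv_def tval_Minus)

lemma holds_Names: "holds M (case_sum c e) (Names t g) \<longleftrightarrow> names M c (\<lambda>k. e (t, k)) g"
  using one by (auto simp: Names_def names_def tval_Minus)

end

text \<open>In order: products are defined, stay in the domain and are unique; associativity; left
  unit; right cancellation; named elements lie in the domain. Right cancellation stands in for
  inverses, whose existence is not universal but follows from it in a finite model.\<close>

definition group_law :: "'g list \<Rightarrow> ('k + nat \<times> nat) form" where
  "group_law gs = Conjs [
     Imp (Conj (Dom 0) (Dom 1)) (Conjs (map (\<lambda>k. Mul_defined k 0 1) [0..<N])),
     Imp (Mul 0 1 2) (Dom 2),
     Imp (Conj (Mul 0 1 2) (Mul 0 1 3)) (Eqv 2 3),
     Imp (Conjs [Mul 0 1 3, Mul 3 2 4, Mul 1 2 5, Mul 0 5 6]) (Eqv 4 6),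
     Imp (Conj (Names 0 \<one>) (Mul 0 1 2)) (Eqv 1 2),
     Imp (Conj (Mul 0 2 3) (Mul 1 2 3)) (Eqv 0 1),
     Conjs (map (\<lambda>g. Imp (Names 0 g) (Dom 0)) gs)]"

definition blk :: "word \<Rightarrow> nat" where
  "blk = to_nat"

text \<open>The t-th vector is the value of the word with number t, for all suffixes of the system.\<close>

definition solution :: "nat \<Rightarrow> nat \<Rightarrow> word list \<Rightarrow> (nat \<Rightarrow> 'g) \<Rightarrow> ('k + nat \<times> nat) form" where
  "solution r l ws a = Conjs (
     Names (blk []) \<one> #
     map (\<lambda>i. Names (blk [(Const i, True)]) (a i)) [0..<r] @
     map (\<lambda>s. Mul (blk [(s, True)]) (blk [(s, False)]) (blk [])) (map Const [0..<r] @ map Var [0..<l]) @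
     map (\<lambda>w. Mul (blk [hd w]) (blk (tl w)) (blk w)) (filter (\<lambda>w. w \<noteq> []) (concat (map suffixes ws))) @
     map (\<lambda>w. Names (blk w) \<one>) ws)"

lemma holds_solution:
  assumes "1 \<notin> M"
  shows "holds M (case_sum c e) (solution r l ws a) \<longleftrightarrow>
    names M c (\<lambda>k. e (blk [], k)) \<one> \<and>
    (\<forall>i<r. names M c (\<lambda>k. e (blk [(Const i, True)], k)) (a i)) \<and>
    (\<forall>s\<in>symbols r l. mul M c (\<lambda>k. e (blk [(s, True)], k)) (\<lambda>k. e (blk [(s, False)], k)) (\<lambda>k. e (blk [], k))) \<and>
    (\<forall>v w x. v \<in> set ws \<longrightarrow> suffix (x # w) v \<longrightarrow>
       mul M c (\<lambda>k. e (blk [x], k)) (\<lambda>k. e (blk w, k)) (\<lambda>k. e (blk (x # w), k))) \<and>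
    (\<forall>w\<in>set ws. names M c (\<lambda>k. e (blk w, k)) \<one>)"
proof -
  have "(\<forall>w\<in>set (filter (\<lambda>w. w \<noteq> []) (concat (map suffixes ws))). P (hd w) (tl w) w) \<longleftrightarrow>
    (\<forall>v w x. v \<in> set ws \<longrightarrow> suffix (x # w) v \<longrightarrow> P x w (x # w))" for P
    by (auto simp: neq_Nil_conv)
  note suf = this
  have sym: "(\<forall>s\<in>set (map Const [0..<r] @ map Var [0..<l]). P s) \<longleftrightarrow> (\<forall>s\<in>symbols r l. P s)" for P
    by (auto simp: symbols_def)
  show ?thesis
    unfolding solution_def holds_Conjs[OF assms] set_append set_simps ball_simps ball_Un set_map
      holds_Names[OF assms] holds_Mul[OF assms] suf sym[unfolded set_append set_map ball_Un, symmetric]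
    by (auto simp: suf[unfolded set_filter set_concat set_map]) (auto simp: neq_Nil_conv)
qed

subsection \<open>The formulas in the group itself\<close>

definition codes :: "(nat \<Rightarrow> 'k) \<Rightarrow> 'g \<Rightarrow> bool" where
  "codes u g \<longleftrightarrow> g \<in> carrier G \<and> (\<forall>k<N. u k = code g k)"

lemma codes_unique: "codes u g \<Longrightarrow> codes u h \<Longrightarrow> g = h"
  using code_inj by (auto simp: codes_def)

lemma dom_iff: "dom {0} id u \<longleftrightarrow> (\<exists>g. codes u g)"
  by (auto simp: dom_def D codes_def)

lemma names_iff: "g \<in> carrier G \<Longrightarrow> names {0} id u g \<longleftrightarrow> codes u g"
  by (auto simp: names_def codes_def)

lemma eqv_iff: "eqv {0} u v \<longleftrightarrow> (\<forall>k<N. u k = v k)"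
  by (auto simp: eqv_def)

lemma mul_defined_codes:
  assumes "codes u g" "codes v h" "k < N"
  shows "mul_defined {0} id k u v"
proof -
  have gh: "g \<in> carrier G" "h \<in> carrier G" "\<forall>k<N. pair_env u v (False, k) = code g k"
    "\<forall>k<N. pair_env u v (True, k) = code h k" using assms by (auto simp: codes_def pair_env_def)
  obtain f p q where "(f, p, q) \<in> set (T k)" "holds {0} (case_sum id (pair_env u v)) f"
    using T_cover[OF assms(3) gh] by blast
  then show ?thesis using T_quotient[OF assms(3) gh] unfolding mul_defined_def by fastforce
qed

lemma mul_coord_codes:
  assumes "codes u g" "codes v h" "k < N"
  shows "mul_coord {0} id k u v x \<longleftrightarrow> x = code (g \<otimes> h) k"
proof -
  have gh: "g \<in> carrier G" "h \<in> carrier G" "\<forall>k<N. pair_env u v (False, k) = code g k"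
    "\<forall>k<N. pair_env u v (True, k) = code h k" using assms by (auto simp: codes_def pair_env_def)
  let ?e = "case_sum id (pair_env u v)"
  have *: "tval ?e q \<noteq> 0 \<and> (tval ?e q * x - tval ?e p = 0 \<longleftrightarrow> x = code (g \<otimes> h) k)"
    if "(f, p, q) \<in> set (T k)" "holds {0} ?e f" for f p q
    using T_quotient[OF assms(3) gh that] by (auto simp: field_simps)
  obtain f p q where "(f, p, q) \<in> set (T k)" "holds {0} ?e f"
    using T_cover[OF assms(3) gh] by blast
  then show ?thesis using * unfolding mul_coord_def singleton_iff by blast
qed

lemma mul_iff: "mul {0} id u v w \<longleftrightarrow> (\<exists>g h. codes u g \<and> codes v h \<and> codes w (g \<otimes> h))"
proof
  assume m: "mul {0} id u v w"
  then obtain g h where gh: "codes u g" "codes v h" unfolding mul_def dom_iff by blast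
  then have "codes w (g \<otimes> h)"
    using m mul_coord_codes[OF gh] unfolding mul_def by (simp add: codes_def)
  with gh show "\<exists>g h. codes u g \<and> codes v h \<and> codes w (g \<otimes> h)" by blast
next
  assume "\<exists>g h. codes u g \<and> codes v h \<and> codes w (g \<otimes> h)"
  then obtain g h where gh: "codes u g" "codes v h" "codes w (g \<otimes> h)" by blast
  then have "mul_coord {0} id k u v (w k)" if "k < N" for k
    unfolding mul_coord_codes[OF gh(1,2) that] using gh(3) that by (simp add: codes_def)
  with gh(1,2) show "mul {0} id u v w" unfolding mul_def dom_iff by blast
qed

lemma group_law_holds:
  assumes "set gs \<subseteq> carrier G"
  shows "holds {0} (case_sum id e) (group_law gs)"
proof -
  have one: "(1::'k) \<notin> {0}" by simp
  have eqvI: "eqv {0} u v" if "codes u g" "codes v g" for u v g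
    using that by (auto simp: eqv_iff codes_def)
  have G: "g \<in> carrier G" if "codes u g" for u g using that by (simp add: codes_def)
  have assoc: "eqv {0} y y'" if m: "mul {0} id u v x" "mul {0} id x w y" "mul {0} id v w z" "mul {0} id u z y'"
    for u v w x y z y'
  proof -
    obtain g h where gh: "codes u g" "codes v h" "codes x (g \<otimes> h)" using m(1) mul_iff by blast
    obtain i where i: "codes w i" "codes y (g \<otimes> h \<otimes> i)" using m(2) gh(3) codes_unique unfolding mul_iff by metis
    have "codes z (h \<otimes> i)" using m(3) gh(2) i(1) codes_unique unfolding mul_iff by metis
    then have "codes y' (g \<otimes> (h \<otimes> i))" using m(4) gh(1) codes_unique unfolding mul_iff by metis
    then show ?thesis using i gh eqvI G m_assoc by metis
  qed
  have unit: "eqv {0} v w" if m: "names {0} id u \<one>" "mul {0} id u v w" for u v w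
  proof -
    have "codes u \<one>" using m(1) names_iff by simp
    then obtain h where "codes v h" "codes w (\<one> \<otimes> h)" using m(2) codes_unique unfolding mul_iff by metis
    then show ?thesis using eqvI G by (metis l_one)
  qed
  have cancel: "eqv {0} u v" if m: "mul {0} id u x z" "mul {0} id v x z" for u v x z
  proof -
    obtain g h where gh: "codes u g" "codes x h" "codes z (g \<otimes> h)" using m(1) mul_iff by blast
    obtain g' where g': "codes v g'" "codes z (g' \<otimes> h)" using m(2) gh(2) codes_unique unfolding mul_iff by metis
    then have "g = g'" using gh codes_unique G by (metis right_cancel)
    then show ?thesis using eqvI gh(1) g'(1) by blast
  qed
  have uniq: "eqv {0} w w'" if "mul {0} id u v w" "mul {0} id u v w'" for u v w w'
    using that codes_unique eqvI unfolding mul_iff by metis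
  have defined: "\<forall>k\<in>{0..<N}. mul_defined {0} id k u v" if "dom {0} id u" "dom {0} id v" for u v
    using that mul_defined_codes by (auto simp: dom_iff)
  have closed: "dom {0} id w" if "mul {0} id u v w" for u v w
    using that unfolding mul_iff dom_iff by blast
  have const: "dom {0} id u" if "g \<in> set gs" "names {0} id u g" for u g
    using that assms names_iff unfolding dom_iff by blast
  define E where "E t = (\<lambda>k. e (t, k))" for t
  show ?thesis
    unfolding group_law_def
    by (simp only: holds_Conjs[OF one] list.set set_map ball_simps holds.simps not_not simp_thms set_upt
        holds_Names[OF one, where e = e, folded E_def] holds_Mul[OF one, where e = e, folded E_def] holds_Dom[OF one, where e = e, folded E_def]
        holds_Eqv[OF one, where e = e, folded E_def] holds_Mul_defined[OF one, where e = e, folded E_def])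
      (use defined[of "E 0" "E 1"] closed[of "E 0" "E 1" "E 2"] uniq[of "E 0" "E 1" "E 2" "E 3"]
        assoc[of "E 0" "E 1" "E 3" "E 2" "E 4" "E 5" "E 6"] unit[of "E 0" "E 1" "E 2"]
        cancel[of "E 0" "E 2" "E 3" "E 1"] const[of _ "E 0"] in blast)
qed

text \<open>The one-letter words yield the values of the variables, and the relation between a
  letter and its inverse forces inverse letters to code inverses. Induction along suffixes then
  computes each word from its end.\<close>

lemma solution_solves:
  assumes ws: "\<And>w. w \<in> set ws \<Longrightarrow> fst ` set w \<subseteq> symbols r l" and a: "a \<in> {..<r} \<rightarrow> carrier G"
    and sol: "holds {0} (case_sum id e) (solution r l ws a)"
  shows "\<exists>x\<in>{..<l} \<rightarrow> carrier G. \<forall>w\<in>set ws. word_value G a x w = \<one>"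
proof -
  have one: "(1::'k) \<notin> {0}" by simp
  define E where "E w = (\<lambda>k. e (blk w, k))" for w
  have E: "names {0} id (E []) \<one>" "\<And>i. i < r \<Longrightarrow> names {0} id (E [(Const i, True)]) (a i)"
    "\<And>s. s \<in> symbols r l \<Longrightarrow> mul {0} id (E [(s, True)]) (E [(s, False)]) (E [])"
    "\<And>v w x. v \<in> set ws \<Longrightarrow> suffix (x # w) v \<Longrightarrow> mul {0} id (E [x]) (E w) (E (x # w))"
    "\<And>w. w \<in> set ws \<Longrightarrow> names {0} id (E w) \<one>"
    using sol unfolding holds_solution[OF one] E_def by blast+
  have "\<exists>g. codes (E [(s, True)]) g" if "s \<in> symbols r l" for s
    using E(3)[OF that] mul_iff by blast
  then obtain val where val: "\<And>s. s \<in> symbols r l \<Longrightarrow> codes (E [(s, True)]) (val s)" by metis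
  define x where "x j = val (Var j)" for j
  have nil: "codes (E []) \<one>" using E(1) names_iff by simp
  have sv: "val s = symbol_value a x s" if "s \<in> symbols r l" for s
  proof (cases s)
    case (Const i)
    then have "i < r" using that by (auto simp: symbols_def)
    then have "codes (E [(s, True)]) (a i)" using E(2) a names_iff Const by auto
    then show ?thesis using val[OF that] codes_unique Const by simp
  qed (simp add: x_def)
  have inv: "codes (E [(s, False)]) (inv (val s))" if s: "s \<in> symbols r l" for s
  proof -
    obtain h where h: "codes (E [(s, False)]) h" "codes (E []) (val s \<otimes> h)"
      using E(3)[OF s] val[OF s] codes_unique unfolding mul_iff by metis
    then have "val s \<otimes> h = \<one>" using nil codes_unique by blast
    moreover have "val s \<in> carrier G" "h \<in> carrier G" using val[OF s] h by (auto simp: codes_def)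
    ultimately show ?thesis using h(1) inv_equality inv_comm by metis
  qed
  have word_val: "codes (E w) (word_value G a x w)" if "v \<in> set ws" "suffix w v" for w v
    using that(2)
  proof (induction w)
    case Nil
    then show ?case using nil by simp
  next
    case (Cons y w)
    obtain s b where y: "y = (s, b)" by force
    have s: "s \<in> symbols r l" using ws[OF that(1)] set_mono_suffix[OF Cons.prems] y by force
    have "codes (E w) (word_value G a x w)" using Cons suffix_ConsD by metis
    moreover have "codes (E [y]) (if b then symbol_value a x s else inv (symbol_value a x s))"
      using val[OF s] inv[OF s] sv[OF s] y by auto
    ultimately show ?case using E(4)[OF that(1) Cons.prems] codes_unique unfolding mul_iff y word_value.simps
      by metis
  qed
  have "word_value G a x w = \<one>" if "w \<in> set ws" for w
    using word_val[OF that suffix_order.refl] E(5)[OF that] names_iff codes_unique by blast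
  moreover have "x \<in> {..<l} \<rightarrow> carrier G"
    using val by (auto simp: x_def symbols_def codes_def)
  ultimately show ?thesis by blast
qed

subsection \<open>The formulas over a finite residue field\<close>

text \<open>The finite group consists of the vectors in the domain with entries among
  representatives of S modulo M. A solution in it gives values to all suffixes and thereby an
  assignment satisfying the formula that none satisfies.\<close>

lemma finite_model_False:
  fixes M :: "algint set" and c :: "'k \<Rightarrow> algint"
  assumes M: "residually_closed M" and p: "p > 0" "of_int p \<in> M"
    and ws: "\<And>w. w \<in> set ws \<Longrightarrow> fst ` set w \<subseteq> symbols r l" and a: "a \<in> {..<r} \<rightarrow> carrier G"
    and gs: "\<one> \<in> set gs" "a ` {..<r} \<subseteq> set gs"
    and ax: "\<And>e. holds M (case_sum c e) (group_law gs)"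
    and no_sol: "\<And>e. \<not> holds M (case_sum c e) (solution r l ws a)"
    and solvable: "\<And>H :: (nat \<Rightarrow> algint) monoid. group H \<Longrightarrow> finite (carrier H) \<Longrightarrow> solvable_in (r, l, ws) H"
  shows False
proof -
  interpret M: residually_closed M by fact
  note one = M.one_notin
  \<comment> \<open>The axioms hold under every assignment; each is used by listing the vectors
    concerned, the t-th entry of the list being vector t.\<close>
  have cover: "mul_defined M c k u v" if "dom M c u" "dom M c v" "k < N" for k u v
    using ax[of "\<lambda>(t, k). ([u, v] ! t) k"] that unfolding group_law_def
    by (simp add: holds_Dom[OF one] holds_Mul_defined[OF one])
  have dom_mul: "dom M c w" if "mul M c u v w" for u v w
    using ax[of "\<lambda>(t, k). ([u, v, w] ! t) k"] that unfolding group_law_def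
    by (simp add: holds_Dom[OF one] holds_Mul[OF one] eval_nat_numeral)
  have mul_unique: "eqv M w w'" if "mul M c u v w" "mul M c u v w'" for u v w w'
    using ax[of "\<lambda>(t, k). ([u, v, w, w'] ! t) k"] that unfolding group_law_def
    by (simp add: holds_Eqv[OF one] holds_Mul[OF one] eval_nat_numeral)
  have mul_assoc: "eqv M y y'" if "mul M c u v x" "mul M c x w y" "mul M c v w z" "mul M c u z y'"
    for u v w x y z y'
    using ax[of "\<lambda>(t, k). ([u, v, w, x, y, z, y'] ! t) k"] that unfolding group_law_def
    by (simp add: holds_Eqv[OF one] holds_Mul[OF one] eval_nat_numeral)
  have mul_unit: "eqv M v w" if "names M c u \<one>" "mul M c u v w" for u v w
    using ax[of "\<lambda>(t, k). ([u, v, w] ! t) k"] that unfolding group_law_def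
    by (simp add: holds_Eqv[OF one] holds_Names[OF one] holds_Mul[OF one] eval_nat_numeral)
  have mul_cancel: "eqv M u v" if "mul M c u x z" "mul M c v x z" for u v x z
    using ax[of "\<lambda>(t, k). ([u, v, x, z] ! t) k"] that unfolding group_law_def
    by (simp add: holds_Eqv[OF one] holds_Mul[OF one] eval_nat_numeral)
  have dom_names: "dom M c u" if "names M c u g" "g \<in> set gs" for u g
    using ax[of "\<lambda>(t, k). u k"] that unfolding group_law_def
    by (simp add: holds_Dom[OF one] holds_Names[OF one]) blast

  define vars where "vars = (\<Union>k<N. \<Union>(f, p, q)\<in>set (T k). set_trm p \<union> set_trm q)"
  \<comment> \<open>S has to contain the constants from which coordinates of products are computed,
    and the codes of the named elements.\<close>
  define X where "X = c ` (Inl -` vars \<union> (\<Union>g\<in>set gs. code g ` {..<N}))"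
  have "finite vars" by (auto simp: vars_def)
  then have "finite X" by (auto simp: X_def intro!: finite_vimageI)
  then obtain S T0 where S: "X \<subseteq> S" "subring_of S" and T0: "finite T0" "T0 \<subseteq> S"
    "\<And>x. x \<in> S \<Longrightarrow> \<exists>t\<in>T0. x - t \<in> M"
    using ex_order[OF M p] by metis
  define \<rho> where "\<rho> x = (SOME t. t \<in> T0 \<and> x - t \<in> M)" for x
  have \<rho>: "\<rho> x \<in> T0" "x - \<rho> x \<in> M" if "x \<in> S" for x
    using T0(3)[OF that] someI_ex[of "\<lambda>t. t \<in> T0 \<and> x - t \<in> M"] by (auto simp: \<rho>_def)
  \<comment> \<open>Congruent elements give \<open>SOME\<close> the same predicate, so it picks the
    same representative.\<close>
  have \<rho>_cong: "\<rho> x = \<rho> y" if "x - y \<in> M" for x y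
  proof -
    have "x - t \<in> M \<longleftrightarrow> y - t \<in> M" for t using that by (intro M.mem_cong) simp
    then show ?thesis by (simp add: \<rho>_def)
  qed
  define F where "F = \<rho> ` S"
  have FS: "F \<subseteq> S" and finF: "finite F"
    using \<rho>(1) T0 by (auto simp: F_def intro: finite_subset[of _ T0])
  have trans: "x - z \<in> M" if "x - y \<in> M" "y - z \<in> M" for x y z
    using M.add_mem[OF that] by simp
  have sym: "y - x \<in> M" if "x - y \<in> M" for x y using M.minus_mem[OF that] by simp
  have F_eq: "x = y" if xy: "x \<in> F" "y \<in> F" "x - y \<in> M" for x y
  proof -
    obtain x' y' where x': "x = \<rho> x'" "x' \<in> S" "y = \<rho> y'" "y' \<in> S" using xy by (auto simp: F_def)
    then have "x' - y' \<in> M" using \<rho>(2) xy(3) trans sym by metis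
    then show ?thesis using \<rho>_cong x' by simp
  qed
  \<comment> \<open>S modulo M is a finite integral domain: multiplication by q permutes the
    representatives, so the class of 1 is attained.\<close>
  have inverse: "\<exists>b\<in>S. q * b - 1 \<in> M" if q: "q \<in> S" "q \<notin> M" for q
  proof -
    have qS: "q * x \<in> S" if "x \<in> F" for x using that q FS S(2) subring_ofD(5) by blast
    have "inj_on (\<lambda>x. \<rho> (q * x)) F"
    proof (rule inj_onI)
      fix x y assume xy: "x \<in> F" "y \<in> F" "\<rho> (q * x) = \<rho> (q * y)"
      then have "q * x - q * y \<in> M" using \<rho>(2)[OF qS] trans sym by metis
      then have "q * (x - y) \<in> M" by (simp add: right_diff_distrib)
      then show "x = y" using xy q(2) F_eq M.prime_mem by blast
    qed
    moreover have "(\<lambda>x. \<rho> (q * x)) ` F \<subseteq> F" using qS by (auto simp: F_def)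
    ultimately have "(\<lambda>x. \<rho> (q * x)) ` F = F" by (intro endo_inj_surj finF)
    moreover have S1: "1 \<in> S" using S(2) subring_ofD(2) by blast
    then have "\<rho> 1 \<in> F" by (simp add: F_def)
    ultimately obtain b where b: "b \<in> F" "\<rho> (q * b) = \<rho> 1" by (metis imageE)
    then have "q * b - 1 \<in> M" using \<rho>(2)[OF qS[OF b(1)]] \<rho>(2)[OF S1] trans sym by metis
    then show ?thesis using b(1) FS by blast
  qed
  \<comment> \<open>Fixing the entries beyond N makes V finite and turns congruence of its vectors
    into equality.\<close>
  define V where "V = {u. \<forall>k. (k \<in> {..<N} \<longrightarrow> u k \<in> F) \<and> (k \<notin> {..<N} \<longrightarrow> u k = 0)}"
  have finV: "finite V" unfolding V_def by (intro finite_set_of_finite_funs finF) simp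
  have V_eq: "u = v" if "u \<in> V" "v \<in> V" "eqv M u v" for u v
  proof
    fix k show "u k = v k"
      using that F_eq[of "u k" "v k"] by (cases "k < N") (auto simp: V_def eqv_def)
  qed
  have S0: "0 \<in> S" using S(2) subring_ofD(1) by blast
  have VS: "u k \<in> S" if "u \<in> V" for u k
    using that FS S0 by (cases "k < N") (auto simp: V_def)
  define C where "C = {u \<in> V. dom M c u}"
  have ex_mul: "\<exists>w\<in>C. mul M c u v w" if uv: "u \<in> C" "v \<in> C" for u v
  proof -
    let ?e = "case_sum c (pair_env u v)"
    have "\<exists>x\<in>F. mul_coord M c k u v x" if k: "k < N" for k
    proof -
      obtain f p q where t: "(f, p, q) \<in> set (T k)" "holds M ?e f" "tval ?e q \<notin> M"
        using cover[of u v k] uv k by (auto simp: mul_defined_def C_def)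
      have env: "?e x \<in> S" if "x \<in> set_trm p \<union> set_trm q" for x
      proof (cases x)
        case (Inl b)
        then have "b \<in> Inl -` vars" using t(1) that k by (auto simp: vars_def)
        then show ?thesis using S(1) Inl by (auto simp: X_def)
      next
        case (Inr y)
        then show ?thesis using uv VS by (auto simp: pair_env_def C_def split: prod.split)
      qed
      have pq: "tval ?e p \<in> S" "tval ?e q \<in> S"
        by (rule tval_mem[OF S(2) env]; blast)+
      then obtain b where b: "b \<in> S" "tval ?e q * b - 1 \<in> M" using inverse t(3) by blast
      \<comment> \<open>With b inverse to the denominator modulo M, y solves the equation of
        \<open>mul_coord\<close> inside S; passing to the representative of y does not disturb the
        congruence.\<close>
      define y where "y = b * tval ?e p"
      have y: "y \<in> S" using b(1) pq S(2) subring_ofD(5) by (simp add: y_def)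
      have "tval ?e q * y - tval ?e p = (tval ?e q * b - 1) * tval ?e p"
        by (simp add: y_def algebra_simps)
      then have "tval ?e q * y - tval ?e p \<in> M" using b(2) M.mult_mem' by simp
      moreover have "tval ?e q * \<rho> y - tval ?e q * y \<in> M"
        using M.mult_mem[OF sym[OF \<rho>(2)[OF y]], of "tval ?e q"] by (simp add: right_diff_distrib)
      ultimately have "tval ?e q * \<rho> y - tval ?e p \<in> M" using trans by blast
      then have "mul_coord M c k u v (\<rho> y)" using t unfolding mul_coord_def by blast
      then show ?thesis using y by (auto simp: F_def)
    qed
    then obtain x where x: "\<And>k. k < N \<Longrightarrow> x k \<in> F \<and> mul_coord M c k u v (x k)" by metis
    define w where "w k = (if k < N then x k else 0)" for k
    have "mul M c u v w" using x uv by (simp add: mul_def w_def C_def)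
    moreover from dom_mul[OF this] have "w \<in> C" using x by (auto simp: C_def V_def w_def)
    ultimately show ?thesis by blast
  qed
  define m where "m u v = (SOME w. w \<in> C \<and> mul M c u v w)" for u v
  have m: "m u v \<in> C" "mul M c u v (m u v)" if "u \<in> C" "v \<in> C" for u v
    using ex_mul[OF that] someI_ex[of "\<lambda>w. w \<in> C \<and> mul M c u v w"] by (auto simp: m_def)
  have CV: "u \<in> V" if "u \<in> C" for u using that by (simp add: C_def)
  define cst where "cst g k = (if k < N then \<rho> (c (code g k)) else 0)" for g k
  have cst: "cst g \<in> C" "names M c (cst g) g" if g: "g \<in> set gs" for g
  proof -
    have mem: "c (code g k) \<in> S" if "k < N" for k
    proof -
      have "c (code g k) \<in> X" unfolding X_def using g that by blast
      then show ?thesis using S(1) by blast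
    qed
    then show n: "names M c (cst g) g" using \<rho>(2) sym by (auto simp: names_def cst_def)
    show "cst g \<in> C" using dom_names[OF n g] mem by (auto simp: C_def V_def cst_def F_def)
  qed
  define H :: "(nat \<Rightarrow> algint) monoid" where
    "H = \<lparr>carrier = C, monoid.mult = m, one = cst \<one>\<rparr>"
  have unit: "m (cst \<one>) u = u" if "u \<in> C" for u
    using mul_unit[OF cst(2) m(2)[OF cst(1)]] m(1)[OF cst(1)] gs(1) that V_eq CV by metis
  have H: "group H"
  proof (rule groupI)
    fix x y z assume "x \<in> carrier H" "y \<in> carrier H" "z \<in> carrier H"
    then have xyz: "x \<in> C" "y \<in> C" "z \<in> C" by (auto simp: H_def)
    have "eqv M (m (m x y) z) (m x (m y z))"
      using mul_assoc[OF m(2) m(2) m(2) m(2)] m(1) xyz by blast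
    then show "x \<otimes>\<^bsub>H\<^esub> y \<otimes>\<^bsub>H\<^esub> z = x \<otimes>\<^bsub>H\<^esub> (y \<otimes>\<^bsub>H\<^esub> z)"
      using V_eq CV m(1) xyz by (simp add: H_def)
  next
    fix x assume "x \<in> carrier H"
    then have x: "x \<in> C" by (simp add: H_def)
    \<comment> \<open>Right cancellation makes right multiplication by x injective on the finite set
      C, hence surjective; a preimage of the unit is a left inverse.\<close>
    have "inj_on (\<lambda>y. m y x) C"
    proof (rule inj_onI)
      fix y z assume "y \<in> C" "z \<in> C" "m y x = m z x"
      then show "y = z" using mul_cancel[of y x "m y x" z] m(2) x V_eq CV by metis
    qed
    moreover have "(\<lambda>y. m y x) ` C \<subseteq> C" "finite C" using m(1) x finV by (auto simp: C_def)
    ultimately have "(\<lambda>y. m y x) ` C = C" by (intro endo_inj_surj)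
    then obtain y where "y \<in> C" "m y x = cst \<one>" using cst(1)[OF gs(1)] by (metis imageE)
    then show "\<exists>y\<in>carrier H. y \<otimes>\<^bsub>H\<^esub> x = \<one>\<^bsub>H\<^esub>" by (auto simp: H_def)
  qed (use m(1) cst(1) gs(1) unit in \<open>auto simp: H_def\<close>)
  then interpret H: group H .
  have mul_H: "mul M c u v (u \<otimes>\<^bsub>H\<^esub> v)" if "u \<in> carrier H" "v \<in> carrier H" for u v
    using m(2) that by (simp add: H_def)
  have "finite (carrier H)" using finV by (simp add: H_def C_def)
  then have "solvable_in (r, l, ws) H" using solvable H by blast
  moreover have a': "(\<lambda>i. cst (a i)) \<in> {..<r} \<rightarrow> carrier H" using cst(1) gs(2) by (auto simp: H_def)
  ultimately obtain x where x: "x \<in> {..<l} \<rightarrow> carrier H"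
    "\<And>w. w \<in> set ws \<Longrightarrow> word_value H (\<lambda>i. cst (a i)) x w = \<one>\<^bsub>H\<^esub>"
    unfolding solvable_in_def by auto
  let ?val = "word_value H (\<lambda>i. cst (a i)) x"
  have sym_closed: "symbol_value (\<lambda>i. cst (a i)) x s \<in> carrier H" if "s \<in> symbols r l" for s
    using that a' x(1) by (auto simp: symbols_def)
  have val_closed: "?val w \<in> carrier H" if "fst ` set w \<subseteq> symbols r l" for w
    by (rule word_value_closed[OF H that sym_closed])
  \<comment> \<open>The vector numbered t is the value in H of the word with that number, so all
    suffixes receive their values at once.\<close>
  define e where "e = (\<lambda>(t, k). ?val (from_nat t) k)"
  have e: "(\<lambda>k. e (blk w, k)) = ?val w" for w by (simp add: e_def blk_def)
  have names_one: "names M c (\<one>\<^bsub>H\<^esub>) \<one>" using cst(2)[OF gs(1)] by (simp add: H_def)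
  have "holds M (case_sum c e) (solution r l ws a)"
    unfolding holds_solution[OF one] e
  proof (intro conjI allI ballI impI)
    show "names M c (?val []) \<one>" using names_one by simp
    show "names M c (?val w) \<one>" if "w \<in> set ws" for w using names_one x(2)[OF that] by simp
    show "names M c (?val [(Const i, True)]) (a i)" if "i < r" for i
    proof -
      have "cst (a i) \<in> carrier H" using a' that by auto
      then have "?val [(Const i, True)] = cst (a i)" by simp
      then show ?thesis using cst(2) gs(2) that by auto
    qed
    show "mul M c (?val [(s, True)]) (?val [(s, False)]) (?val [])" if "s \<in> symbols r l" for s
      using mul_H[of "?val [(s, True)]" "?val [(s, False)]"] sym_closed[OF that] by simp
    show "mul M c (?val [y]) (?val w) (?val (y # w))" if "v \<in> set ws" "suffix (y # w) v" for v w y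
    proof -
      have "fst ` set (y # w) \<subseteq> symbols r l" using ws[OF that(1)] set_mono_suffix[OF that(2)] by blast
      then have cl: "?val [y] \<in> carrier H" "?val w \<in> carrier H" "fst y \<in> symbols r l"
        using val_closed[of "[y]"] val_closed[of w] by auto
      have "?val (y # w) = ?val [y] \<otimes>\<^bsub>H\<^esub> ?val w"
        using sym_closed[OF cl(3)] cl(2) by (cases y) (auto simp: H.m_assoc)
      then show ?thesis using mul_H[OF cl(1,2)] by simp
    qed
  qed
  then show False using no_sol by blast
qed

end

theorem proposition20:
  fixes W :: system
    and G :: "'g monoid"
    and A :: "('g, 'k :: alg_closed_field) chart set"
  assumes "W \<in> Sys_Fin"
    and "algebraic_group A G"
  shows "solvable_in W G"
proof -
  obtain r l ws where W: "W = (r, l, ws)" by (cases W) auto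
  have ws: "fst ` set w \<subseteq> symbols r l" if "w \<in> set ws" for w
    using assms(1) that by (auto simp: Sys_Fin_def finite_systems_def free_group_elements_def W)
  have G: "group G" using assms(2) by (simp add: algebraic_group_def)
  have inf: "infinite (UNIV :: 'k set)"
  proof
    assume fin: "finite (UNIV :: 'k set)"
    \<comment> \<open>Over a finite field this polynomial has positive degree and takes the value 1
      everywhere, so it has no root.\<close>
    define f where "f = (\<Prod>c\<in>(UNIV :: 'k set). [:- c, 1:]) + 1"
    have pf: "poly f a = 1" for a
      using fin by (simp add: f_def poly_prod prod_zero_iff)
    have "degree (\<Prod>c\<in>(UNIV :: 'k set). [:- c, 1:]) = card (UNIV :: 'k set)"
      by (subst degree_prod_eq_sum_degree) auto
    moreover have "card (UNIV :: 'k set) > 0" using fin by (simp add: card_gt_0_iff)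
    ultimately have "degree f > 0" unfolding f_def by (subst degree_add_eq_left) auto
    then show False using alg_closed_imp_poly_has_root[of f] pf by auto
  qed
  obtain N code and D :: "('k + nat) form" and T where code:
    "\<And>g h. g \<in> carrier G \<Longrightarrow> h \<in> carrier G \<Longrightarrow> (\<forall>k<N. code g k = code h k) \<Longrightarrow> g = h"
    "\<And>u. holds {0} (case_sum id u) D \<longleftrightarrow> (\<exists>g\<in>carrier G. \<forall>k<N. u k = code g k)"
    "\<And>k. finite (T k)"
    "\<And>k e g h. k < N \<Longrightarrow> g \<in> carrier G \<Longrightarrow> h \<in> carrier G \<Longrightarrow> (\<forall>k<N. e (False, k) = code g k) \<Longrightarrow>
       (\<forall>k<N. e (True, k) = code h k) \<Longrightarrow> \<exists>(c, p, q)\<in>T k. holds {0} (case_sum id e) c"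
    "\<And>k e g h c p q. k < N \<Longrightarrow> g \<in> carrier G \<Longrightarrow> h \<in> carrier G \<Longrightarrow> (\<forall>k<N. e (False, k) = code g k) \<Longrightarrow>
       (\<forall>k<N. e (True, k) = code h k) \<Longrightarrow> (c, p, q) \<in> T k \<Longrightarrow> holds {0} (case_sum id e) c \<Longrightarrow>
       tval (case_sum id e) q \<noteq> 0 \<and>
       code (g \<otimes>\<^bsub>G\<^esub> h) k = tval (case_sum id e) p / tval (case_sum id e) q"
    by (rule algebraic_group_code[OF assms(2) inf]) blast
  obtain T' where T': "\<And>k. set (T' k) = T k" using finite_list[OF code(3)] by metis
  interpret coded_group G N code D T'
    by (intro coded_group.intro coded_group_axioms.intro G) (use code T' in \<open>auto simp: T'\<close>)
  show ?thesis unfolding W solvable_in_def prod.case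
  proof (rule ballI, rule ccontr)
    fix a assume a: "a \<in> {..<r} \<rightarrow> carrier G"
      and neg: "\<not> (\<exists>x\<in>{..<l} \<rightarrow> carrier G. \<forall>w\<in>set ws. word_value G a x w = \<one>\<^bsub>G\<^esub>)"
    \<comment> \<open>The elements that the formulas refer to by name: the unit and the given
      constants.\<close>
    define gs where "gs = \<one>\<^bsub>G\<^esub> # map a [0..<r]"
    have gs: "set gs \<subseteq> carrier G" using a by (auto simp: gs_def)
    define f where "f = Conj (group_law gs) (Neg (solution r l ws a))"
    have "holds {0} (case_sum id e) f" for e
      using group_law_holds[OF gs] solution_solves[of ws r l a e, OF ws a] neg by (auto simp: f_def)
    then obtain M :: "algint set" and p c where M: "residually_closed M" "prime p" "of_int p \<in> M"
      "\<And>v. holds M (case_sum c v) f"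
      by (rule transfer_to_residue_field[of f]) blast
    show False
    proof (rule finite_model_False[OF M(1) _ M(3) ws a])
      show "p > 0" using M(2) prime_gt_0_int by blast
      show "\<one>\<^bsub>G\<^esub> \<in> set gs" "a ` {..<r} \<subseteq> set gs" by (auto simp: gs_def)
      show "holds M (case_sum c e) (group_law gs)" "\<not> holds M (case_sum c e) (solution r l ws a)" for e
        using M(4)[of e] by (auto simp: f_def)
      show "solvable_in (r, l, ws) H" if "group H" "finite (carrier H)" for H :: "(nat \<Rightarrow> algint) monoid"
        using Sys_Fin_solvable_in_finite[OF assms(1) that] by (simp add: W)
    qed
  qed
qed

end
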